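(* Consider the Gaussian sequence model $y_i=\mu_i+\sigma_n z_i$, $i=1,\ldots,n$, where $\mu\in l_p[\eta_n]$, $0<p\le\infty$, and let $\hat\mu$ be the Bayesian maximum a posteriori estimator of $\mu$ (defined in the context) based on the prior $\pi_n$ and the variance ratio $\gamma_n=\tau_n^2/\sigma_n^2$. Assume that there exist positive constants $\gamma_-$ and $\gamma_+$ such that $\gamma_-\le\gamma_n\le\gamma_+$. Define $c(\gamma)=8(\gamma+3/4)^2>9/2$ and let the prior $\pi_n$ satisfy the following conditions: (i) $\pi_n(0)\ge n^{-c_1n^{-\beta}}$ for some $\beta\ge0$ and $c_1>0$; (ii) $\pi_n(\kappa)\ge(\kappa/n)^{c_2\kappa}$ for all $\kappa=1,2,\ldots,\alpha n$, where $\alpha=\exp(-9/2)$ or $\alpha=\exp\{-c(\gamma_-)\}$ if $\gamma_-$ is known, and for some $c_2>0$; (iii) $\pi_n(n)\ge e^{-c_0n}$ for some $c_0>0$. Let $R(l_p[\eta_n])=\inf_{\tilde\mu}\sup_{\mu\in l_p[\eta_n]}E(\|\tilde\mu-\mu\|_2^2)$ be the minimax risk. Then, as $n\to\infty$, depending on $p$ and $\eta_n$, one has: Case 1. Let $0<p\le\infty$, $\eta_n^p>\alpha$. Then $$\sup_{\mu\in l_p[\eta_n]}E(\|\hat\mu-\mu\|_2^2)=O(n\sigma_n^2),\qquad R(l_p[\eta_n])\asymp n\sigma_n^2.$$ Case 2. Let $2\le p\le\infty$, $\eta_n^p\le\alpha$. Then $$\sup_{\mu\in l_p[\eta_n]}E(\|\hat\mu-\mu\|_2^2)=O(\sigma_n^2n\eta_n^2)+O(\sigma_n^2n^{-\beta}\log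 n),\qquad R(l_p[\eta_n])\asymp\sigma_n^2n\eta_n^2.$$ Case 3. Let $0<p<2$, $n^{-1}(2\log n)^{p/2}\le\eta_n^p\le\alpha$. Then $$\sup_{\mu\in l_p[\eta_n]}E(\|\hat\mu-\mu\|_2^2)=O\big\{\sigma_n^2n\eta_n^p(2\log\eta_n^{-p})^{1-p/2}\big\},\qquad R(l_p[\eta_n])\asymp\sigma_n^2n\eta_n^p(2\log\eta_n^{-p})^{1-p/2}.$$ Case 4. Let $0<p<2$, $\eta_n^p<n^{-1}(2\log n)^{p/2}$. Then $$\sup_{\mu\in l_p[\eta_n]}E(\|\hat\mu-\mu\|_2^2)=O(\sigma_n^2n^{2/p}\eta_n^2)+O(\sigma_n^2n^{-\beta}\log n),\qquad R(l_p[\eta_n])\asymp\sigma_n^2n^{2/p}\eta_n^2.$$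
   Context: Model: for each $n$ one observes $y_i=\mu_i+\sigma_nz_i$, $i=1,\ldots,n$, where $\sigma_n^2>0$ is known and may depend on $n$, the $z_i$ are independent $N(0,1)$, and $\mu=(\mu_1,\ldots,\mu_n)'$ is unknown. Balls: $l_p[\eta_n]=\{\mu\in\mathbb R^n:\|\mu\|_p\le C_n\}$ with $C_n=n^{1/p}\sigma_n\eta_n$ (for $p=\infty$: $\max_i|\mu_i|\le\sigma_n\eta_n$). Here $\eta_n>0$ is the normalized radius, which may depend on $n$. For $p=\infty$ the conditions $\eta_n^p>\alpha$ and $\eta_n^p\le\alpha$ are read as $\eta_n>\alpha^{1/p}$ and $\eta_n\le\alpha^{1/p}$ with $\alpha^{1/\infty}=1$. Prior: $\pi_n$ is a probability distribution on $\{0,1,\ldots,n\}$ with $\pi_n(\kappa)>0$ for all $\kappa=0,\ldots,n$ (a prior on the number of non-zero entries of $\mu$), $\tau_n^2>0$ is the prior variance of the non-zero entries, and $\gamma_n=\tau_n^2/\sigma_n^2$. Estimator: let $|y|_{(1)}\ge\cdots\ge|y|_{(n)}$ be the ordered absolute values of the observations, and let $\hat\kappa\in\{0,1,\ldots,n\}$ be a minimizer over $\kappa$ of $$\sum_{i=\kappa+1}^n|y|_{(i)}^2+P_n(\kappa),\qquad P_n(\kappa)=2\sigma_n^2(1+1/\gamma_n)\log\Big\{\binom n\kappa\pi_n^{-1}(\kappa)(1+\gamma_n)^{\kappa/2}\Big\}.$$ The estimator $\hat\mu=(\hat\mu_1,\ldots,\hat\mu_n)'$ is $\hat\mu_i=y_i$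 if $|y_i|\ge|y|_{(\hat\kappa)}$ and $\hat\mu_i=0$ otherwise; if $\hat\kappa=0$, then $\hat\mu\equiv0$. $E$ denotes expectation under the model with mean $\mu$; the infimum in $R(l_p[\eta_n])$ is over all estimators $\tilde\mu$ of $\mu$ based on $y_1,\ldots,y_n$. The constants $\gamma_\pm,c_0,c_1,c_2,\beta$ do not depend on $n$. The notation $g_1(n)\asymp g_2(n)$ means $0<\liminf\{g_1(n)/g_2(n)\}\le\limsup\{g_1(n)/g_2(n)\}<\infty$ as $n\to\infty$. *)

theory Defs
  imports "HOL-Probability.Probability" "HOL-Library.Landau_Symbols"
begin

text \<open>
  Vectors of \<open>R\<^sup>n\<close> are functions on the index set \<open>{1..n}\<close>, i.e. elements of
  \<open>{1..n} \<rightarrow>\<^sub>E UNIV\<close>, so that the dimension can vary.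
\<close>

definition vec_space :: "nat \<Rightarrow> (nat \<Rightarrow> real) measure" where
  "vec_space n = PiM {1..n} (\<lambda>_. borel)"

definition noise_law :: "nat \<Rightarrow> (nat \<Rightarrow> real) measure" where
  "noise_law n = PiM {1..n} (\<lambda>_. density lborel (\<lambda>x. ennreal (std_normal_density x)))"

definition obs_law :: "nat \<Rightarrow> real \<Rightarrow> (nat \<Rightarrow> real) \<Rightarrow> (nat \<Rightarrow> real) measure" where
  "obs_law n \<sigma> \<mu> =
     distr (noise_law n) (vec_space n) (\<lambda>z. \<lambda>i\<in>{1..n}. \<mu> i + \<sigma> * z i)"

definition risk :: "nat \<Rightarrow> real \<Rightarrow> ((nat \<Rightarrow> real) \<Rightarrow> nat \<Rightarrow> real) \<Rightarrow> (nat \<Rightarrow> real) \<Rightarrow> ennreal" where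
  "risk n \<sigma> est \<mu> = (\<integral>\<^sup>+ y. ennreal (\<Sum>i=1..n. (est y i - \<mu> i)\<^sup>2) \<partial>obs_law n \<sigma> \<mu>)"

text \<open>The exponent ranges over \<open>(0, \<infinity>]\<close>; note \<open>1 / \<infinity> = 0\<close> in \<^typ>\<open>ereal\<close>.\<close>

definition lp_norm :: "nat \<Rightarrow> ereal \<Rightarrow> (nat \<Rightarrow> real) \<Rightarrow> real" where
  "lp_norm n p \<mu> =
     (if p = \<infinity> then Max ((\<lambda>i. \<bar>\<mu> i\<bar>) ` {1..n})
      else (\<Sum>i=1..n. \<bar>\<mu> i\<bar> powr real_of_ereal p) powr (1 / real_of_ereal p))"

definition lp_ball :: "nat \<Rightarrow> ereal \<Rightarrow> real \<Rightarrow> real \<Rightarrow> (nat \<Rightarrow> real) set" where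
  "lp_ball n p \<sigma> \<eta> =
     {\<mu> \<in> {1..n} \<rightarrow>\<^sub>E UNIV. lp_norm n p \<mu> \<le> real n powr real_of_ereal (1 / p) * \<sigma> * \<eta>}"

text \<open>
  The conditions \<open>\<eta>\<^sup>p > \<alpha>\<close> and \<open>\<eta>\<^sup>p \<le> \<alpha>\<close>, read for \<open>p = \<infinity>\<close> as
  \<open>\<eta> > \<alpha>\<^bsup>1/p\<^esup>\<close> and \<open>\<eta> \<le> \<alpha>\<^bsup>1/p\<^esup>\<close> with \<open>\<alpha>\<^bsup>1/\<infinity>\<^esup> = 1\<close>.
\<close>

definition radius_gt :: "ereal \<Rightarrow> real \<Rightarrow> real \<Rightarrow> bool" where
  "radius_gt p \<eta> \<alpha> \<longleftrightarrow> (if p = \<infinity> then \<eta> > 1 else \<eta> powr real_of_ereal p > \<alpha>)"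

definition radius_le :: "ereal \<Rightarrow> real \<Rightarrow> real \<Rightarrow> bool" where
  "radius_le p \<eta> \<alpha> \<longleftrightarrow> (if p = \<infinity> then \<eta> \<le> 1 else \<eta> powr real_of_ereal p \<le> \<alpha>)"

definition sup_risk ::
  "nat \<Rightarrow> ereal \<Rightarrow> real \<Rightarrow> real \<Rightarrow> ((nat \<Rightarrow> real) \<Rightarrow> nat \<Rightarrow> real) \<Rightarrow> ennreal" where
  "sup_risk n p \<sigma> \<eta> est = (SUP \<mu>\<in>lp_ball n p \<sigma> \<eta>. risk n \<sigma> est \<mu>)"

definition minimax_risk :: "nat \<Rightarrow> ereal \<Rightarrow> real \<Rightarrow> real \<Rightarrow> ennreal" where
  "minimax_risk n p \<sigma> \<eta> =
     (INF est \<in> measurable (vec_space n) (vec_space n). sup_risk n p \<sigma> \<eta> est)"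

text \<open>The \<open>i\<close>-th largest of \<open>\<bar>y 1\<bar>, \<dots>, \<bar>y n\<bar>\<close>, for \<open>1 \<le> i \<le> n\<close>.\<close>

definition ord_abs :: "nat \<Rightarrow> (nat \<Rightarrow> real) \<Rightarrow> nat \<Rightarrow> real" where
  "ord_abs n y i = rev (sort (map (\<lambda>j. \<bar>y j\<bar>) [1..<Suc n])) ! (i - 1)"

definition penalty :: "nat \<Rightarrow> real \<Rightarrow> real \<Rightarrow> nat pmf \<Rightarrow> nat \<Rightarrow> real" where
  "penalty n \<sigma> \<gamma> prior \<kappa> =
     2 * \<sigma>\<^sup>2 * (1 + 1 / \<gamma>) *
       ln (real (n choose \<kappa>) * inverse (pmf prior \<kappa>) * (1 + \<gamma>) powr (real \<kappa> / 2))"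

definition map_criterion ::
  "nat \<Rightarrow> real \<Rightarrow> real \<Rightarrow> nat pmf \<Rightarrow> (nat \<Rightarrow> real) \<Rightarrow> nat \<Rightarrow> real" where
  "map_criterion n \<sigma> \<gamma> prior y \<kappa> =
     (\<Sum>i=\<kappa>+1..n. (ord_abs n y i)\<^sup>2) + penalty n \<sigma> \<gamma> prior \<kappa>"

text \<open>
  \<open>khat\<close> is an arbitrary selection of minimizers. Two minimizers coexist only on a null set
  (a nonempty sum of squared order statistics would have to equal a constant), so the law of
  the estimator does not depend on the selection and no measurability of \<open>khat\<close> is required.
\<close>

definition is_map_selector ::
  "nat \<Rightarrow> real \<Rightarrow> real \<Rightarrow> nat pmf \<Rightarrow> ((nat \<Rightarrow> real) \<Rightarrow> nat) \<Rightarrow> bool" where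
  "is_map_selector n \<sigma> \<gamma> prior khat \<longleftrightarrow>
     (\<forall>y \<in> space (vec_space n).
        is_arg_min (map_criterion n \<sigma> \<gamma> prior y) (\<lambda>\<kappa>. \<kappa> \<in> {0..n}) (khat y))"

definition map_estimator ::
  "nat \<Rightarrow> ((nat \<Rightarrow> real) \<Rightarrow> nat) \<Rightarrow> (nat \<Rightarrow> real) \<Rightarrow> nat \<Rightarrow> real" where
  "map_estimator n khat y =
     (\<lambda>i\<in>{1..n}. if khat y \<noteq> 0 \<and> \<bar>y i\<bar> \<ge> ord_abs n y (khat y) then y i else 0)"

definition c_const :: "real \<Rightarrow> real" where
  "c_const \<gamma> = 8 * (\<gamma> + 3 / 4)\<^sup>2"

text \<open>
  Risks are extended nonnegative reals; \<open>f = O(g)\<close> and \<open>f = O(g\<^sub>1) + O(g\<^sub>2)\<close> include that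
  \<open>f\<close> is eventually finite.
\<close>

definition is_bigo :: "(nat \<Rightarrow> ennreal) \<Rightarrow> (nat \<Rightarrow> real) \<Rightarrow> bool" where
  "is_bigo f g \<longleftrightarrow> (\<exists>h \<in> O(g). \<forall>\<^sub>F n in sequentially. f n = ennreal (h n))"

definition is_bigo_sum :: "(nat \<Rightarrow> ennreal) \<Rightarrow> (nat \<Rightarrow> real) \<Rightarrow> (nat \<Rightarrow> real) \<Rightarrow> bool" where
  "is_bigo_sum f g1 g2 \<longleftrightarrow>
     (\<exists>h1 \<in> O(g1). \<exists>h2 \<in> O(g2). \<forall>\<^sub>F n in sequentially. f n = ennreal (h1 n + h2 n))"

definition same_order :: "(nat \<Rightarrow> ennreal) \<Rightarrow> (nat \<Rightarrow> real) \<Rightarrow> bool" where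
  "same_order f g \<longleftrightarrow>
     0 < liminf (\<lambda>n. f n / ennreal (g n)) \<and>
     liminf (\<lambda>n. f n / ennreal (g n)) \<le> limsup (\<lambda>n. f n / ennreal (g n)) \<and>
     limsup (\<lambda>n. f n / ennreal (g n)) < \<infinity>"

end

theory Submission
  imports Defs "HOL-Real_Asymp.Real_Asymp"
begin

text \<open>
  Upper bounds. Write \<open>y = \<mu> + w\<close> with \<open>w = \<sigma> z\<close>. The set \<open>K\<close> of kept coordinates minimizes
  \<open>\<parallel>y\<parallel>\<^sup>2\<close> over the complement of \<open>K\<close> plus \<open>P(|K|)\<close>; comparing with an arbitrary set \<open>M\<close> and
  completing squares bounds the loss by \<open>\<parallel>\<mu>\<parallel>\<^sup>2\<close> outside \<open>M\<close>, \<open>\<parallel>w\<parallel>\<^sup>2\<close> on \<open>M\<close>, \<open>P(|M|)\<close> and the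
  supremum over \<open>K\<close> of \<open>a \<parallel>w\<parallel>\<^sup>2 - P(|K|)\<close> on \<open>K\<close>, where \<open>a > 1\<close>. That supremum no longer involves \<open>\<mu>\<close>.
  The penalty is exactly what a union bound over all \<open>K\<close> requires for \<open>a = 1\<close>. For \<open>|K| \<le> \<epsilon> n\<close> the
  binomial coefficient leaves room for \<open>a > 1\<close>; for larger \<open>K\<close> the union bound is applied to square
  roots of likelihood ratios, and strict concavity of the root gains a factor \<open>\<rho>\<^sup>n\<close> with \<open>\<rho> < 1\<close>.
  The four cases take \<open>M\<close> to be everything, nothing, or a set of the right size containing all
  coordinates above \<open>\<sigma> \<surd>(2 ln \<eta>\<^sup>-\<^sup>p)\<close>.

  Lower bounds. Cut the coordinates into blocks of length \<open>m\<close> and put a spike of height \<open>h\<close> at an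
  unknown place of each block. If \<open>exp (2 h\<^sup>2 / \<sigma>\<^sup>2) \<le> 2 (m - 1)\<close>, the place cannot be guessed and every
  block costs \<open>h\<^sup>2 / 3\<close> on average.
\<close>

section \<open>Gaussian integrals\<close>

text \<open>Why \<open>a > 1\<close>: absorbing the cross terms of \<open>\<mu>\<close> and
  \<open>w\<close> by Young's inequality costs a multiple \<open>eps\<close> of the noise energy on
  \<open>K\<close>, and a second \<open>eps\<close> must be left over as the loss itself. The plain
  union bound cannot give this near \<open>|K| = n\<close>: there the binomial coefficient is about
  1, while the mean of \<open>exp (a * T * z\<^sup>2 / 2)\<close> with
  \<open>T = \<gamma> / (1 + \<gamma>)\<close> exceeds \<open>sqrt (1 + \<gamma>)\<close>, which is
  all that the penalty offers per coordinate. Why the remainder is small: each set of size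
  \<open>k\<close> costs its share of the prior mass of \<open>k\<close>, so the union bound totals
  \<open>1 - pmf prior 0\<close> and not a constant. Condition (i) bounds this, and the price
  \<open>- ln (pmf prior 0)\<close> of \<open>M = {}\<close>, by
  \<open>n powr (- \<beta>) * ln n\<close> up to a factor; a constant would spoil Cases 2 and 4 for
  \<open>\<beta> > 0\<close>. Why other estimators appear: \<open>khat\<close> is an arbitrary
  selection, so the loss need not be measurable and is only dominated by measurable functions,
  whereas the minimax risk ranges over measurable estimators. In Cases 2 and 4 the remainder may
  also exceed the minimax rate. Zero, identity and hard thresholding therefore give the minimax
  upper bounds.\<close>

abbreviation gauss :: "real measure" where
  "gauss \<equiv> density lborel (\<lambda>x. ennreal (std_normal_density x))"

lemma nn_integral_normal_density:
  assumes "\<sigma> > 0"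
  shows "(\<integral>\<^sup>+x. ennreal (normal_density \<mu> \<sigma> x) \<partial>lborel) = 1"
  using assms by (simp add: nn_integral_eq_integral)

lemma prob_space_gauss: "prob_space gauss"
  by (rule prob_space_normal_density) simp

interpretation gauss: prob_space gauss
  by (rule prob_space_gauss)

interpretation noise: product_sigma_finite "\<lambda>_::nat. gauss"
  by standard

lemma sets_noise_law [measurable_cong]: "sets (noise_law n) = sets (vec_space n)"
  unfolding noise_law_def vec_space_def by (intro sets_PiM_cong) auto

lemma space_noise_law: "space (noise_law n) = space (vec_space n)"
  by (rule sets_eq_imp_space_eq[OF sets_noise_law])

lemma space_vec_space: "space (vec_space n) = {1..n} \<rightarrow>\<^sub>E UNIV"
  by (simp add: vec_space_def space_PiM)

lemma prob_space_noise_law: "prob_space (noise_law n)"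
  unfolding noise_law_def by (intro prob_space_PiM prob_space_gauss)

lemma measurable_vec_component [measurable]:
  "i \<in> {1..n} \<Longrightarrow> (\<lambda>z. z i) \<in> borel_measurable (vec_space n)"
  unfolding vec_space_def by measurable

abbreviation gauss_mean :: "(real \<Rightarrow> real) \<Rightarrow> ennreal" where
  "gauss_mean f \<equiv> \<integral>\<^sup>+x. ennreal (f x) \<partial>gauss"

abbreviation noise_mean :: "nat \<Rightarrow> ((nat \<Rightarrow> real) \<Rightarrow> real) \<Rightarrow> ennreal" where
  "noise_mean n f \<equiv> \<integral>\<^sup>+z. ennreal (f z) \<partial>noise_law n"

text \<open>Tilting only rescales: the integrand is \<open>s\<close> times the normal density of
  variance \<open>1 / (1 - t)\<close>.\<close>

lemma gauss_exp_square:
  assumes "t < 1"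
  shows "gauss_mean (\<lambda>x. exp (t * x\<^sup>2 / 2)) = ennreal (1 / sqrt (1 - t))"
proof -
  define s where "s = 1 / sqrt (1 - t)"
  have s: "s > 0" "s\<^sup>2 = 1 / (1 - t)" using assms by (auto simp: s_def power_divide)
  have eq: "std_normal_density x * exp (t * x\<^sup>2 / 2) = s * normal_density 0 s x" for x
  proof -
    have a: "exp (- x\<^sup>2 / 2) * exp (t * x\<^sup>2 / 2) = exp (- (x\<^sup>2 * (1 - t)) / 2)"
      by (simp add: exp_add[symmetric] field_simps)
    have b: "sqrt (2 * pi * s\<^sup>2) = sqrt (2 * pi) * s" using s(1) by (simp add: real_sqrt_mult)
    have c: "- (x - 0)\<^sup>2 / (2 * s\<^sup>2) = - (x\<^sup>2 * (1 - t)) / 2" unfolding s(2) using assms by simp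
    have "std_normal_density x * exp (t * x\<^sup>2 / 2) = 1 / sqrt (2 * pi) * exp (- (x\<^sup>2 * (1 - t)) / 2)"
      unfolding std_normal_density_def using a by simp
    also have "\<dots> = s * normal_density 0 s x" unfolding normal_density_def b c using s(1) by simp
    finally show ?thesis .
  qed
  have "gauss_mean (\<lambda>x. exp (t * x\<^sup>2 / 2))
      = (\<integral>\<^sup>+x. ennreal s * ennreal (normal_density 0 s x) \<partial>lborel)"
    using s by (subst nn_integral_density)
      (auto intro!: nn_integral_cong simp: ennreal_mult'[symmetric] eq)
  also have "\<dots> = ennreal s"
    using s by (subst nn_integral_cmult) (auto simp: nn_integral_normal_density)
  finally show ?thesis by (simp add: s_def)
qed

lemma nn_integral_noise_prod:
  assumes "\<And>i. i \<in> {1..n} \<Longrightarrow> f i \<in> borel_measurable borel"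
  shows "(\<integral>\<^sup>+z. (\<Prod>i=1..n. f i (z i)) \<partial>noise_law n) = (\<Prod>i=1..n. \<integral>\<^sup>+x. f i x \<partial>gauss)"
  unfolding noise_law_def using assms by (intro noise.product_nn_integral_prod) auto

lemma nn_integral_noise_subset_prod:
  assumes "M \<subseteq> {1..n}" and f: "f \<in> borel_measurable borel"
  shows "(\<integral>\<^sup>+z. (\<Prod>i\<in>M. f (z i)) \<partial>noise_law n) = (\<integral>\<^sup>+x. f x \<partial>gauss) ^ card M"
proof -
  have *: "(\<Prod>i=1..n. g i) = (\<Prod>i\<in>M. g i)" if "\<And>i. i \<in> {1..n} - M \<Longrightarrow> g i = 1" for g :: "nat \<Rightarrow> ennreal"
    using assms(1) that by (intro prod.mono_neutral_right) auto
  have "(\<integral>\<^sup>+z. (\<Prod>i\<in>M. f (z i)) \<partial>noise_law n)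
      = (\<integral>\<^sup>+z. (\<Prod>i=1..n. if i \<in> M then f (z i) else 1) \<partial>noise_law n)"
    by (subst *) auto
  also have "\<dots> = (\<integral>\<^sup>+z. (\<Prod>i=1..n. (if i \<in> M then f else (\<lambda>_. 1)) (z i)) \<partial>noise_law n)"
    by (intro nn_integral_cong prod.cong) auto
  also have "\<dots> = (\<Prod>i=1..n. \<integral>\<^sup>+x. (if i \<in> M then f else (\<lambda>_. 1)) x \<partial>gauss)"
    using f by (intro nn_integral_noise_prod) auto
  also have "\<dots> = (\<Prod>i\<in>M. \<integral>\<^sup>+x. f x \<partial>gauss)"
    by (subst *) (auto simp: gauss.emeasure_space_1 intro!: gauss.emeasure_space_1[simplified])
  finally show ?thesis by simp
qed

lemma nn_integral_noise_component:
  assumes "i \<in> {1..n}" "f \<in> borel_measurable borel"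
  shows "(\<integral>\<^sup>+z. f (z i) \<partial>noise_law n) = (\<integral>\<^sup>+x. f x \<partial>gauss)"
  using nn_integral_noise_subset_prod[of "{i}" n f] assms by simp

lemma noise_exp_sum_squares:
  assumes "t < 1" "M \<subseteq> {1..n}"
  shows "noise_mean n (\<lambda>z. exp (t / 2 * (\<Sum>i\<in>M. (z i)\<^sup>2)))
    = ennreal ((1 / sqrt (1 - t)) ^ card M)"
proof -
  have fin: "finite M" using assms(2) finite_subset by blast
  have "exp (t / 2 * (\<Sum>i\<in>M. (z i)\<^sup>2)) = (\<Prod>i\<in>M. exp (t * (z i)\<^sup>2 / 2))" for z :: "nat \<Rightarrow> real"
    using fin by (simp add: exp_sum[symmetric] sum_distrib_left)
  then have "noise_mean n (\<lambda>z. exp (t / 2 * (\<Sum>i\<in>M. (z i)\<^sup>2)))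
    = (\<integral>\<^sup>+z. (\<Prod>i\<in>M. ennreal (exp (t * (z i)\<^sup>2 / 2))) \<partial>noise_law n)"
    by (simp add: prod_ennreal)
  also have "\<dots> = ennreal (1 / sqrt (1 - t)) ^ card M"
    using assms by (subst nn_integral_noise_subset_prod) (auto simp: gauss_exp_square)
  finally show ?thesis using assms by (simp add: ennreal_power)
qed

lemma square_le_exp: "x\<^sup>2 \<le> 4 * exp (x\<^sup>2 / 4)" for x :: real
  using exp_ge_add_one_self[of "x\<^sup>2 / 4"] by linarith

text \<open>The exact value is 1; a crude constant suffices because the final claims concern orders
  only.\<close>

lemma gauss_square_le: "gauss_mean (\<lambda>x. x\<^sup>2) \<le> ennreal 8"
proof -
  have "gauss_mean (\<lambda>x. x\<^sup>2) \<le> (\<integral>\<^sup>+x. 4 * ennreal (exp ((1/2) * x\<^sup>2 / 2)) \<partial>gauss)"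
  proof (rule nn_integral_mono)
    fix x :: real
    have "ennreal (x\<^sup>2) \<le> ennreal (4 * exp ((1/2) * x\<^sup>2 / 2))"
      using square_le_exp[of x] by (intro ennreal_leI) simp
    then show "ennreal (x\<^sup>2) \<le> 4 * ennreal (exp ((1/2) * x\<^sup>2 / 2))" by (simp add: ennreal_mult')
  qed
  also have "\<dots> = 4 * ennreal (1 / sqrt (1 - 1/2))"
    using gauss_exp_square[of "1/2"] by (subst nn_integral_cmult) simp_all
  also have "\<dots> = ennreal (4 * (1 / sqrt (1/2)))" by (subst ennreal_mult) simp_all
  also have "\<dots> \<le> ennreal 8"
  proof (rule ennreal_leI)
    have "sqrt (1/4) \<le> sqrt (1/2::real)" by (intro real_sqrt_le_mono) simp
    then have "1/2 \<le> sqrt (1/2::real)" by (simp add: real_sqrt_divide)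
    then show "4 * (1 / sqrt (1/2)) \<le> (8::real)" by (simp add: field_simps)
  qed
  finally show ?thesis .
qed

text \<open>The interval has length one and the density is smallest at its endpoints. This mass is
  where the concavity gain of \<open>gauss_sqrt_tilted_le\<close> is collected.\<close>

lemma gauss_interval_mass:
  "ennreal (std_normal_density (1/2)) \<le> emeasure gauss {-(1/2)..1/2::real}"
proof -
  have "ennreal (std_normal_density (1/2)) = (\<integral>\<^sup>+x. ennreal (std_normal_density (1/2)) * indicator {-(1/2)..1/2::real} x \<partial>lborel)"
    by (subst nn_integral_cmult_indicator) simp_all
  also have "\<dots> \<le> (\<integral>\<^sup>+x. ennreal (std_normal_density x) * indicator {-(1/2)..1/2} x \<partial>lborel)"
  proof (rule nn_integral_mono)
    fix x :: real
    show "ennreal (std_normal_density (1/2)) * indicator {-(1/2)..1/2} x \<le> ennreal (std_normal_density x) * indicator {-(1/2)..1/2} x"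
    proof (cases "x \<in> {-(1/2)..1/2}")
      case True
      then have "\<bar>x\<bar> \<le> \<bar>1/2\<bar>" by auto
      then have "x\<^sup>2 \<le> (1/2)\<^sup>2" by (simp only: abs_le_square_iff)
      then have "std_normal_density (1/2) \<le> std_normal_density x"
        unfolding std_normal_density_def by (intro mult_left_mono) auto
      then show ?thesis by (intro mult_right_mono ennreal_leI) auto
    qed auto
  qed
  also have "\<dots> = emeasure gauss {-(1/2)..1/2::real}"
    by (subst emeasure_density) auto
  finally show ?thesis .
qed

\<comment> \<open>keeps \<open>{1..n}\<close> from being rewritten to \<open>{Suc 0..n}\<close>\<close>
declare One_nat_def [simp del]

section \<open>Minimax lower bound\<close>

abbreviation estimators :: "nat \<Rightarrow> ((nat \<Rightarrow> real) \<Rightarrow> nat \<Rightarrow> real) set" where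
  "estimators n \<equiv> measurable (vec_space n) (vec_space n)"

abbreviation lebesgue_vec :: "nat \<Rightarrow> (nat \<Rightarrow> real) measure" where
  "lebesgue_vec n \<equiv> PiM {1..n} (\<lambda>_. lborel)"

interpretation lebvec: product_sigma_finite "\<lambda>_::nat. lborel :: real measure"
  by standard

section \<open>Densities and likelihood ratios of the observations\<close>

definition gauss_dens :: "nat \<Rightarrow> real \<Rightarrow> (nat \<Rightarrow> real) \<Rightarrow> (nat \<Rightarrow> real) \<Rightarrow> real" where
  "gauss_dens n \<sigma> \<mu> y = (\<Prod>i=1..n. normal_density (\<mu> i) \<sigma> (y i))"

lemma sets_lebesgue_vec [measurable_cong]: "sets (lebesgue_vec n) = sets (vec_space n)"
  unfolding vec_space_def by (intro sets_PiM_cong) auto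

lemma gauss_dens_pos: "\<sigma> > 0 \<Longrightarrow> gauss_dens n \<sigma> \<mu> y > 0"
  unfolding gauss_dens_def by (intro prod_pos) (auto intro: normal_density_pos)

lemma measurable_gauss_dens [measurable]: "gauss_dens n \<sigma> \<mu> \<in> borel_measurable (vec_space n)"
  unfolding gauss_dens_def by measurable

lemma measurable_affine [measurable]:
  "(\<lambda>z. \<lambda>i\<in>{1..n}. \<mu> i + \<sigma> * z i) \<in> estimators n"
  unfolding vec_space_def by measurable

lemma measurable_affine_noise [measurable]:
  "(\<lambda>z. \<lambda>i\<in>{1..n}. \<mu> i + \<sigma> * z i) \<in> measurable (noise_law n) (vec_space n)"
  by measurable

lemma sets_obs_law [measurable_cong]: "sets (obs_law n \<sigma> \<mu>) = sets (vec_space n)"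
  by (simp add: obs_law_def)

lemma space_obs_law: "space (obs_law n \<sigma> \<mu>) = space (vec_space n)"
  by (simp add: obs_law_def)

lemma prob_space_obs_law: "prob_space (obs_law n \<sigma> \<mu>)"
  unfolding obs_law_def by (intro prob_space.prob_space_distr prob_space_noise_law) measurable

lemma distr_gauss_affine:
  assumes "\<sigma> > 0"
  shows "distr gauss borel (\<lambda>x. a + \<sigma> * x) = density lborel (\<lambda>x. ennreal (normal_density a \<sigma> x))"
proof -
  have "distributed gauss lborel (\<lambda>x. x) std_normal_density"
    by (auto simp: distributed_def distr_id2)
  from gauss.normal_density_affine[OF this, of \<sigma> a] assms
  have "distributed gauss lborel (\<lambda>x. a + \<sigma> * x) (normal_density a \<sigma>)" by simp
  then have "distr gauss lborel (\<lambda>x. a + \<sigma> * x) = density lborel (\<lambda>x. ennreal (normal_density a \<sigma> x))"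
    by (simp add: distributed_def)
  moreover have "distr gauss borel (\<lambda>x. a + \<sigma> * x) = distr gauss lborel (\<lambda>x. a + \<sigma> * x)"
    by (intro distr_cong) auto
  ultimately show ?thesis by simp
qed

text \<open>Both measures are identified with the product of the one-dimensional laws
  \<open>N i\<close> by their values on boxes. The density form gives access to likelihood ratios
  and to Lebesgue null sets.\<close>

lemma obs_law_eq_density:
  assumes "\<sigma> > 0"
  shows "obs_law n \<sigma> \<mu> = density (lebesgue_vec n) (\<lambda>y. ennreal (gauss_dens n \<sigma> \<mu> y))"
proof -
  let ?G = "density (lebesgue_vec n) (\<lambda>y. ennreal (gauss_dens n \<sigma> \<mu> y))"
  define N where "N i = density lborel (\<lambda>x. ennreal (normal_density (\<mu> i) \<sigma> x))" for i
  have "prob_space (N i)" for i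
    using prob_space_normal_density[OF assms, of "\<mu> i"] by (simp add: N_def)
  then interpret N: product_sigma_finite N
    by (simp add: product_sigma_finite_def prob_space_imp_sigma_finite)
  have [simp]: "sets (N i) = sets borel" for i by (simp add: N_def)
  have setsN: "sets (PiM {1..n} N) = sets (vec_space n)"
    unfolding vec_space_def by (intro sets_PiM_cong) auto
  have "obs_law n \<sigma> \<mu> = PiM {1..n} N"
  proof (rule N.PiM_eqI)
    show "finite {1..n}" by simp
    show "sets (obs_law n \<sigma> \<mu>) = sets (PiM {1..n} N)"
      by (rule trans[OF sets_obs_law setsN[symmetric]])
    fix A assume A: "\<And>i. i \<in> {1..n} \<Longrightarrow> A i \<in> sets (N i)"
    then have A': "A i \<in> sets borel" if "i \<in> {1..n}" for i using that by simp
    then have "Pi\<^sub>E {1..n} A \<in> sets (vec_space n)"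
      unfolding vec_space_def by (intro sets_PiM_I_finite) auto
    then have "emeasure (obs_law n \<sigma> \<mu>) (Pi\<^sub>E {1..n} A)
      = emeasure (noise_law n) ((\<lambda>z. \<lambda>i\<in>{1..n}. \<mu> i + \<sigma> * z i) -` Pi\<^sub>E {1..n} A \<inter> space (noise_law n))"
      unfolding obs_law_def by (intro emeasure_distr) auto
    also have "(\<lambda>z. \<lambda>i\<in>{1..n}. \<mu> i + \<sigma> * z i) -` Pi\<^sub>E {1..n} A \<inter> space (noise_law n)
      = Pi\<^sub>E {1..n} (\<lambda>i. (\<lambda>x. \<mu> i + \<sigma> * x) -` A i)"
      unfolding space_noise_law space_vec_space by (auto simp: PiE_iff)
    also have "emeasure (noise_law n) \<dots> = (\<Prod>i=1..n. emeasure gauss ((\<lambda>x. \<mu> i + \<sigma> * x) -` A i))"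
      unfolding noise_law_def
    proof (rule noise.emeasure_PiM)
      fix i assume "i \<in> {1..n}"
      from A'[OF this] have "(\<lambda>x. \<mu> i + \<sigma> * x) -` A i \<inter> space borel \<in> sets borel"
        by (intro measurable_sets) auto
      then show "(\<lambda>x. \<mu> i + \<sigma> * x) -` A i \<in> sets gauss" by simp
    qed simp
    also have "\<dots> = (\<Prod>i=1..n. emeasure (N i) (A i))"
    proof (rule prod.cong)
      fix i assume "i \<in> {1..n}"
      from A'[OF this] show "emeasure gauss ((\<lambda>x. \<mu> i + \<sigma> * x) -` A i) = emeasure (N i) (A i)"
        unfolding N_def distr_gauss_affine[OF assms, symmetric] by (subst emeasure_distr) auto
    qed simp
    finally show "emeasure (obs_law n \<sigma> \<mu>) (Pi\<^sub>E {1..n} A) = (\<Prod>i=1..n. emeasure (N i) (A i))" .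
  qed
  also have "PiM {1..n} N = ?G"
  proof (rule N.PiM_eqI[symmetric])
    show "finite {1..n}" by simp
    show "sets (?G) = sets (PiM {1..n} N)"
      by (rule trans[OF trans[OF sets_density sets_lebesgue_vec] setsN[symmetric]])
    fix A assume A: "\<And>i. i \<in> {1..n} \<Longrightarrow> A i \<in> sets (N i)"
    then have A'[measurable]: "A i \<in> sets borel" if "i \<in> {1..n}" for i using that by simp
    then have box: "Pi\<^sub>E {1..n} A \<in> sets (lebesgue_vec n)"
      by (intro sets_PiM_I_finite) auto
    have "emeasure (?G) (Pi\<^sub>E {1..n} A)
      = (\<integral>\<^sup>+y. ennreal (gauss_dens n \<sigma> \<mu> y) * indicator (Pi\<^sub>E {1..n} A) y \<partial>lebesgue_vec n)"
      using box by (subst emeasure_density) auto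
    also have "\<dots> = (\<integral>\<^sup>+y. (\<Prod>i=1..n. ennreal (normal_density (\<mu> i) \<sigma> (y i)) * indicator (A i) (y i)) \<partial>lebesgue_vec n)"
    proof (rule nn_integral_cong)
      fix y assume "y \<in> space (lebesgue_vec n)"
      then have "y \<in> extensional {1..n}" by (auto simp: space_PiM PiE_def)
      then have "(indicator (Pi\<^sub>E {1..n} A) y :: ennreal) = (\<Prod>i=1..n. indicator (A i) (y i))"
        by (auto simp: indicator_def PiE_iff prod_zero_iff split: if_splits)
      then show "ennreal (gauss_dens n \<sigma> \<mu> y) * indicator (Pi\<^sub>E {1..n} A) y
        = (\<Prod>i=1..n. ennreal (normal_density (\<mu> i) \<sigma> (y i)) * indicator (A i) (y i))"
        unfolding gauss_dens_def by (simp add: prod.distrib prod_ennreal)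
    qed
    also have "\<dots> = (\<Prod>i=1..n. \<integral>\<^sup>+x. ennreal (normal_density (\<mu> i) \<sigma> x) * indicator (A i) x \<partial>lborel)"
      using A' by (intro lebvec.product_nn_integral_prod) auto
    also have "\<dots> = (\<Prod>i=1..n. emeasure (N i) (A i))"
      using A' by (intro prod.cong) (auto simp: N_def emeasure_density)
    finally show "emeasure (?G) (Pi\<^sub>E {1..n} A)
      = (\<Prod>i=1..n. emeasure (N i) (A i))" .
  qed
  finally show ?thesis .
qed

text \<open>Completing the square: \<open>2 * (x - a)\<^sup>2 - (x - b)\<^sup>2 = (x - (2 * a -
  b))\<^sup>2 - 2 * (a - b)\<^sup>2\<close>.\<close>

lemma normal_density_square_divide:
  assumes "\<sigma> > 0"
  shows "(normal_density a \<sigma> x)\<^sup>2 / normal_density b \<sigma> x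
    = exp ((a - b)\<^sup>2 / \<sigma>\<^sup>2) * normal_density (2 * a - b) \<sigma> x"
proof -
  have e: "(exp (- (x - a)\<^sup>2 / (2 * \<sigma>\<^sup>2)))\<^sup>2 / exp (- (x - b)\<^sup>2 / (2 * \<sigma>\<^sup>2))
    = exp ((a - b)\<^sup>2 / \<sigma>\<^sup>2) * exp (- (x - (2 * a - b))\<^sup>2 / (2 * \<sigma>\<^sup>2))"
    using assms
    by (simp add: power2_eq_square[of "exp _"] exp_add[symmetric] exp_diff[symmetric])
       (simp add: field_simps, simp add: power2_eq_square algebra_simps)
  have "(normal_density a \<sigma> x)\<^sup>2 / normal_density b \<sigma> x
    = 1 / sqrt (2 * pi * \<sigma>\<^sup>2) * ((exp (- (x - a)\<^sup>2 / (2 * \<sigma>\<^sup>2)))\<^sup>2 / exp (- (x - b)\<^sup>2 / (2 * \<sigma>\<^sup>2)))"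
  proof -
    have *: "(1 / K * A)\<^sup>2 / (1 / K * B) = 1 / K * (A\<^sup>2 / B)" if "K \<noteq> 0" for K A B :: real
      using that by (simp add: power2_eq_square)
    show ?thesis unfolding normal_density_def by (rule *) (use assms in simp)
  qed
  then show ?thesis unfolding e by (simp add: normal_density_def)
qed

text \<open>One plus the chi-square divergence of the laws with means \<open>\<mu>\<close> and
  \<open>\<nu>\<close>. The integrand is a constant times the density with mean
  \<open>2 * \<mu> - \<nu>\<close>, whose mass is 1.\<close>

lemma gauss_dens_chi_square:
  assumes "\<sigma> > 0"
  shows "(\<integral>\<^sup>+y. ennreal ((gauss_dens n \<sigma> \<mu> y)\<^sup>2 / gauss_dens n \<sigma> \<nu> y) \<partial>lebesgue_vec n)
    = ennreal (exp ((\<Sum>i=1..n. (\<mu> i - \<nu> i)\<^sup>2) / \<sigma>\<^sup>2))"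
proof -
  have "(gauss_dens n \<sigma> \<mu> y)\<^sup>2 / gauss_dens n \<sigma> \<nu> y
     = exp ((\<Sum>i=1..n. (\<mu> i - \<nu> i)\<^sup>2) / \<sigma>\<^sup>2) * gauss_dens n \<sigma> (\<lambda>i. 2 * \<mu> i - \<nu> i) y" for y
  proof -
    have "(gauss_dens n \<sigma> \<mu> y)\<^sup>2 / gauss_dens n \<sigma> \<nu> y
      = (\<Prod>i=1..n. (normal_density (\<mu> i) \<sigma> (y i))\<^sup>2 / normal_density (\<nu> i) \<sigma> (y i))"
      unfolding gauss_dens_def by (simp add: prod_power_distrib prod_dividef)
    then show ?thesis
      unfolding gauss_dens_def normal_density_square_divide[OF assms] sum_divide_distrib
      by (simp add: prod.distrib exp_sum)
  qed
  moreover have "(\<integral>\<^sup>+y. ennreal (gauss_dens n \<sigma> (\<lambda>i. 2 * \<mu> i - \<nu> i) y) \<partial>lebesgue_vec n) = 1"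
    using prob_space.emeasure_space_1[OF prob_space_obs_law[of n \<sigma> "\<lambda>i. 2 * \<mu> i - \<nu> i"]]
    unfolding obs_law_eq_density[OF assms] by (subst (asm) emeasure_density) (auto cong: nn_integral_cong)
  ultimately show ?thesis
    using gauss_dens_pos[OF assms] by (simp add: ennreal_mult' nn_integral_cmult)
qed

text \<open>Read \<open>x\<close> and \<open>y\<close> as weighted densities under the true values
  \<open>h\<close> and 0, and \<open>d\<close> as the estimate: \<open>d\<close> can be good for
  both only where \<open>x / y\<close> is large, and the last term pays for that. The difference of
  the two sides is a sum of two nonnegative terms, the first one centred at
  \<open>d = 2 / 3 * h\<close>.\<close>

lemma two_point_inequality:
  fixes x y d h :: real
  assumes "y > 0" "x \<ge> 0"
  shows "5 / 9 * h\<^sup>2 * x \<le> x * (d - h)\<^sup>2 + y * d\<^sup>2 + h\<^sup>2 * x\<^sup>2 / (9 * y)"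
proof -
  have "x * (d - h)\<^sup>2 + y * d\<^sup>2 + h\<^sup>2 * x\<^sup>2 / (9 * y) - 5 / 9 * h\<^sup>2 * x
    = x * (d - 2 / 3 * h)\<^sup>2 + (y * d - x * h / 3)\<^sup>2 / y"
    using assms by (simp add: field_simps power2_eq_square)
  also have "\<dots> \<ge> 0" using assms by simp
  finally show ?thesis by simp
qed

definition coord_risk :: "nat \<Rightarrow> real \<Rightarrow> ((nat \<Rightarrow> real) \<Rightarrow> nat \<Rightarrow> real) \<Rightarrow> (nat \<Rightarrow> real) \<Rightarrow> nat \<Rightarrow> ennreal" where
  "coord_risk n \<sigma> est \<mu> i = (\<integral>\<^sup>+y. ennreal ((est y i - \<mu> i)\<^sup>2) \<partial>obs_law n \<sigma> \<mu>)"

lemma measurable_estimator_component: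
  assumes "est \<in> estimators n" "i \<in> {1..n}"
  shows "(\<lambda>y. est y i) \<in> borel_measurable (vec_space n)"
  using measurable_compose[OF assms(1) measurable_vec_component[OF assms(2)]] .

lemma risk_eq_sum_coord_risk:
  assumes "est \<in> estimators n"
  shows "risk n \<sigma> est \<mu> = (\<Sum>i=1..n. coord_risk n \<sigma> est \<mu> i)"
proof -
  note [measurable] = measurable_estimator_component[OF assms]
  show ?thesis
    unfolding risk_def coord_risk_def
    by (subst nn_integral_sum[symmetric]) (auto simp: sum_ennreal intro!: nn_integral_cong)
qed

text \<open>This is \<open>two_point_inequality\<close> integrated with
  \<open>x = c * gauss_dens n \<sigma> \<mu> y\<close>. The weight \<open>c\<close> allows one
  spiked hypothesis to be shared among many alternatives.\<close>

lemma coord_risk_two_point: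
  assumes "\<sigma> > 0" and est: "est \<in> estimators n"
    and i: "i \<in> {1..n}" "\<mu> i = h" "\<nu> i = 0" and "c > 0"
  shows "ennreal (5 / 9 * h\<^sup>2 * c) \<le> ennreal c * coord_risk n \<sigma> est \<mu> i + coord_risk n \<sigma> est \<nu> i
     + ennreal (h\<^sup>2 * c\<^sup>2 / 9 * exp ((\<Sum>i=1..n. (\<mu> i - \<nu> i)\<^sup>2) / \<sigma>\<^sup>2))"
proof -
  note [measurable] = measurable_estimator_component[OF est i(1)]
  let ?f = "gauss_dens n \<sigma>"
  note pos = gauss_dens_pos[OF assms(1)]
  note nn = pos[THEN less_imp_le]
  have cr: "coord_risk n \<sigma> est \<xi> i
     = (\<integral>\<^sup>+y. ennreal (?f \<xi> y) * ennreal ((est y i - \<xi> i)\<^sup>2) \<partial>lebesgue_vec n)" for \<xi>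
    unfolding coord_risk_def obs_law_eq_density[OF assms(1)] by (rule nn_integral_density) measurable
  \<comment> \<open>With equal means the chi-square integral is the total mass.\<close>
  have mass: "(\<integral>\<^sup>+y. ennreal (?f \<mu> y) \<partial>lebesgue_vec n) = 1"
    using gauss_dens_chi_square[OF assms(1), of n \<mu> \<mu>] pos[of n \<mu>]
    by (simp add: power2_eq_square less_imp_neq[symmetric])
  have "ennreal (5 / 9 * h\<^sup>2 * c) = (\<integral>\<^sup>+y. ennreal (5 / 9 * h\<^sup>2 * c) * ennreal (?f \<mu> y) \<partial>lebesgue_vec n)"
    by (subst nn_integral_cmult) (auto simp: mass)
  also have "\<dots> \<le> (\<integral>\<^sup>+y. ennreal c * (ennreal (?f \<mu> y) * ennreal ((est y i - \<mu> i)\<^sup>2))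
       + ennreal (?f \<nu> y) * ennreal ((est y i - \<nu> i)\<^sup>2)
       + ennreal (h\<^sup>2 * c\<^sup>2 / 9) * ennreal ((?f \<mu> y)\<^sup>2 / ?f \<nu> y) \<partial>lebesgue_vec n)"
  proof (rule nn_integral_mono)
    fix y
    let ?x = "c * ?f \<mu> y" and ?w = "?f \<nu> y" and ?d = "est y i"
    have "ennreal (5 / 9 * h\<^sup>2 * c) * ennreal (?f \<mu> y) = ennreal (5 / 9 * h\<^sup>2 * ?x)"
      using assms(6) nn by (subst ennreal_mult'[symmetric]) (auto simp: ac_simps)
    also have "\<dots> \<le> ennreal (?x * (?d - h)\<^sup>2 + ?w * ?d\<^sup>2 + h\<^sup>2 * ?x\<^sup>2 / (9 * ?w))"
      using two_point_inequality[of ?w ?x h ?d] pos[of n \<nu> y] nn[of n \<mu> y] assms(6)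
      by (intro ennreal_leI) simp
    also have "\<dots> = ennreal c * (ennreal (?f \<mu> y) * ennreal ((est y i - \<mu> i)\<^sup>2))
       + ennreal (?f \<nu> y) * ennreal ((est y i - \<nu> i)\<^sup>2)
       + ennreal (h\<^sup>2 * c\<^sup>2 / 9) * ennreal ((?f \<mu> y)\<^sup>2 / ?f \<nu> y)"
      using nn[of n \<mu> y] nn[of n \<nu> y] assms(6) i
      by (simp add: ennreal_mult'[symmetric] ennreal_plus[symmetric] del: ennreal_plus)
        (simp add: field_simps)
    finally show "ennreal (5 / 9 * h\<^sup>2 * c) * ennreal (?f \<mu> y) \<le> \<dots>" .
  qed
  also have "\<dots> = ennreal c * coord_risk n \<sigma> est \<mu> i + coord_risk n \<sigma> est \<nu> i
     + ennreal (h\<^sup>2 * c\<^sup>2 / 9) * ennreal (exp ((\<Sum>i=1..n. (\<mu> i - \<nu> i)\<^sup>2) / \<sigma>\<^sup>2))"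
    unfolding cr gauss_dens_chi_square[OF assms(1), symmetric]
    by (subst nn_integral_add, measurable, subst nn_integral_add, measurable, subst nn_integral_cmult,
        measurable, subst nn_integral_cmult, measurable)
  finally show ?thesis using assms(6) by (simp add: ennreal_mult'[symmetric])
qed

section \<open>Averaging over spike configurations\<close>

abbreviation configs :: "nat \<Rightarrow> nat \<Rightarrow> (nat \<Rightarrow> nat) set" where
  "configs k m \<equiv> {..<k} \<rightarrow>\<^sub>E {..<m}"

text \<open>The map \<open>(c, j) \<mapsto> (c(b := j), c b)\<close> is an involution.\<close>

lemma sum_config_update:
  fixes G :: "(nat \<Rightarrow> nat) \<Rightarrow> real" and m :: nat
  assumes "b < k"
  defines "C \<equiv> configs k m"
  shows "(\<Sum>c\<in>C. \<Sum>j<m. G (c(b := j))) = real m * (\<Sum>c\<in>C. G c)"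
proof -
  define \<phi> where "\<phi> = (\<lambda>(c, j). (c(b := j), c b :: nat))"
  have "(\<Sum>c\<in>C. \<Sum>j<m. G (c(b := j))) = (\<Sum>(c, j)\<in>C \<times> {..<m}. G (c(b := j)))"
    by (simp add: sum.cartesian_product)
  also have "\<dots> = (\<Sum>(c, j)\<in>C \<times> {..<m}. G c)"
  proof (rule sum.reindex_bij_witness[of _ \<phi> \<phi>])
    fix a assume "a \<in> C \<times> {..<m}"
    then obtain c j where a: "a = (c, j)" and c: "c \<in> C" "j < m" by auto
    have "c(b := j) \<in> C" using c assms(1) unfolding C_def by (simp add: PiE_iff extensional_def)
    moreover have "c b < m" using c assms(1) unfolding C_def by (auto simp: PiE_iff)
    ultimately show "\<phi> a \<in> C \<times> {..<m}" "\<phi> a \<in> C \<times> {..<m}" by (simp_all add: a \<phi>_def)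
    show "\<phi> (\<phi> a) = a" "\<phi> (\<phi> a) = a" by (simp_all add: a \<phi>_def)
    show "(case \<phi> a of (c, j) \<Rightarrow> G c) = (case a of (c, j) \<Rightarrow> G (c(b := j)))" by (simp add: a \<phi>_def)
  qed
  also have "\<dots> = real m * (\<Sum>c\<in>C. G c)"
    by (simp add: sum.cartesian_product[symmetric] sum_distrib_left)
  finally show ?thesis .
qed

definition two_valued :: "nat \<Rightarrow> real \<Rightarrow> nat set \<Rightarrow> nat \<Rightarrow> real" where
  "two_valued n h M = (\<lambda>i\<in>{1..n}. if i \<in> M then h else 0)"

text \<open>\<open>r c b i\<close> is to be the risk at place \<open>i\<close> of block
  \<open>b\<close> when the spikes sit at \<open>c\<close>, and \<open>E\<close> a bound for the
  second moment of the likelihood ratios. All ordered pairs of places are compared with weight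
  \<open>1 / (m - 1)\<close>, so that each spiked place receives total weight one. The condition on
  \<open>E\<close> leaves \<open>5 / 9 - 2 / 9 = 1 / 3\<close>.\<close>

lemma averaged_risk_lower_bound:
  fixes r :: "(nat \<Rightarrow> nat) \<Rightarrow> nat \<Rightarrow> nat \<Rightarrow> real"
  assumes "m \<ge> 2" and E: "E \<le> 2 * (real m - 1)"
    and pair: "\<And>c b i j. \<lbrakk>c \<in> configs k m; b < k; i < m; j < m; i \<noteq> j\<rbrakk> \<Longrightarrow>
      5 / 9 * h\<^sup>2 * (1 / (real m - 1)) \<le> 1 / (real m - 1) * r (c(b := i)) b i + r (c(b := j)) b i
        + h\<^sup>2 * (1 / (real m - 1))\<^sup>2 / 9 * E"
    and B: "\<And>c. c \<in> configs k m \<Longrightarrow> (\<Sum>b<k. \<Sum>i<m. r c b i) \<le> B"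
  shows "real k * h\<^sup>2 / 3 \<le> B"
proof -
  define C where "C = configs k m"
  define w where "w = 1 / (real m - 1)"
  have w: "w > 0" "w * (real m - 1) = 1" using assms(1) by (auto simp: w_def)
  have finC: "finite C" unfolding C_def by (intro finite_PiE) auto
  have "(\<lambda>b\<in>{..<k}. 0) \<in> C" unfolding C_def using assms(1) by auto
  then have "C \<noteq> {}" by blast
  then have cardC: "real (card C) > 0" using finC by (simp add: card_gt_0_iff)
  have block: "real m * h\<^sup>2 / 3 \<le> (\<Sum>j<m. \<Sum>i<m. r (c(b := j)) b i)" if c: "c \<in> C" and b: "b < k" for c b
  proof -
    have p: "h\<^sup>2 * w / 3 \<le> w * r (c(b := i)) b i + r (c(b := j)) b i" if "i < m" "j < m" "i \<noteq> j" for i j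
    proof -
      have "h\<^sup>2 * w\<^sup>2 / 9 * E \<le> h\<^sup>2 * w\<^sup>2 / 9 * (2 * (real m - 1))"
        using E by (intro mult_left_mono) auto
      also have "\<dots> = 2 / 9 * h\<^sup>2 * w * (w * (real m - 1))" by (simp add: power2_eq_square)
      also have "\<dots> = 2 / 9 * h\<^sup>2 * w" using w by simp
      finally show ?thesis using pair[OF c[unfolded C_def] b that] unfolding w_def[symmetric] by simp
    qed
    have "real m * h\<^sup>2 / 3 = (\<Sum>i<m. \<Sum>j\<in>{..<m} - {i}. h\<^sup>2 * w / 3)"
    proof -
      have "(\<Sum>j\<in>{..<m} - {i}. h\<^sup>2 * w / 3) = h\<^sup>2 / 3" if "i < m" for i
      proof -
        have "real (card ({..<m} - {i})) = real m - 1" using that by (simp add: of_nat_diff)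
        then have "(\<Sum>j\<in>{..<m} - {i}. h\<^sup>2 * w / 3) = h\<^sup>2 / 3 * (w * (real m - 1))" by simp
        then show ?thesis using w by simp
      qed
      then have "(\<Sum>i<m. \<Sum>j\<in>{..<m} - {i}. h\<^sup>2 * w / 3) = (\<Sum>i<m. h\<^sup>2 / 3)"
        by (intro sum.cong) auto
      then show ?thesis by simp
    qed
    also have "\<dots> \<le> (\<Sum>i<m. \<Sum>j\<in>{..<m} - {i}. w * r (c(b := i)) b i + r (c(b := j)) b i)"
      using p by (intro sum_mono) auto
    also have "\<dots> = (\<Sum>i<m. \<Sum>j<m. r (c(b := j)) b i)"
    proof (rule sum.cong)
      fix i assume i: "i \<in> {..<m}"
      have cd: "real (card ({..<m} - {i})) = real m - 1" using i by (simp add: of_nat_diff)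
      have "(\<Sum>j\<in>{..<m} - {i}. w * r (c(b := i)) b i + r (c(b := j)) b i)
        = (w * (real m - 1)) * r (c(b := i)) b i + (\<Sum>j\<in>{..<m} - {i}. r (c(b := j)) b i)"
        using cd by (simp add: sum.distrib)
      \<comment> \<open>The term \<open>j = i\<close> is missing among the pairs; the
        \<open>m - 1\<close> copies of weight \<open>w\<close> supply it.\<close>
      also have "\<dots> = (\<Sum>j<m. r (c(b := j)) b i)"
        using w i by (subst sum.remove[of "{..<m}" i]) auto
      finally show "(\<Sum>j\<in>{..<m} - {i}. w * r (c(b := i)) b i + r (c(b := j)) b i) = (\<Sum>j<m. r (c(b := j)) b i)" .
    qed simp
    also have "\<dots> = (\<Sum>j<m. \<Sum>i<m. r (c(b := j)) b i)" by (rule sum.swap)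
    finally show ?thesis .
  qed
  have "real (card C) * real k * (real m * h\<^sup>2 / 3) = (\<Sum>b<k. \<Sum>c\<in>C. real m * h\<^sup>2 / 3)" by simp
  also have "\<dots> \<le> (\<Sum>b<k. \<Sum>c\<in>C. \<Sum>j<m. \<Sum>i<m. r (c(b := j)) b i)"
    by (intro sum_mono block) auto
  also have "\<dots> = (\<Sum>b<k. real m * (\<Sum>c\<in>C. \<Sum>i<m. r c b i))"
    unfolding C_def by (intro sum.cong refl sum_config_update) auto
  also have "\<dots> = real m * (\<Sum>c\<in>C. \<Sum>b<k. \<Sum>i<m. r c b i)"
    by (simp add: sum_distrib_left[symmetric] sum.swap[of _ "{..<k}" C])
  also have "\<dots> \<le> real m * (\<Sum>c\<in>C. B)"
    using B by (intro mult_left_mono sum_mono) (auto simp: C_def)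
  finally have "(real (card C) * real m) * (real k * h\<^sup>2 / 3) \<le> (real (card C) * real m) * B"
    by (simp add: ac_simps)
  moreover have "real (card C) * real m > 0" using cardC assms(1) by simp
  ultimately show ?thesis by (rule mult_left_le_imp_le)
qed

lemma minimax_risk_lower_bound:
  assumes \<sigma>: "\<sigma> > 0" and m: "m \<ge> 2" and km: "k * m \<le> n"
    and h: "exp (2 * h\<^sup>2 / \<sigma>\<^sup>2) \<le> 2 * (real m - 1)"
    and ball: "\<And>M. M \<subseteq> {1..n} \<Longrightarrow> card M \<le> k \<Longrightarrow> two_valued n h M \<in> lp_ball n p \<sigma> \<eta>"
  shows "ennreal (real k * h\<^sup>2 / 3) \<le> minimax_risk n p \<sigma> \<eta>"
  unfolding minimax_risk_def
proof (rule INF_greatest)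
  fix est assume est: "est \<in> estimators n"
  define S where "S = sup_risk n p \<sigma> \<eta> est"
  show "ennreal (real k * h\<^sup>2 / 3) \<le> sup_risk n p \<sigma> \<eta> est"
  \<comment> \<open>An infinite risk satisfies the bound trivially; a finite one makes all
    coordinate risks real numbers, as the averaging argument requires.\<close>
  proof (cases "sup_risk n p \<sigma> \<eta> est = \<infinity>")
    case False
    \<comment> \<open>Blocks and places are counted from 0, coordinates from 1.\<close>
    define ps where "ps b j = b * m + j + 1" for b j :: nat
    define Mc where "Mc c = (\<lambda>b. ps b (c b)) ` {..<k}" for c
    define \<mu> where "\<mu> c = two_valued n h (Mc c)" for c
    have ps_inj: "ps b i = ps b' j \<longleftrightarrow> b = b' \<and> i = j" if "i < m" "j < m" for b b' i j
    proof
      assume "ps b i = ps b' j"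
      then have e: "b * m + i = b' * m + j" by (simp add: ps_def)
      from arg_cong[OF e, of "\<lambda>x. x div m"] arg_cong[OF e, of "\<lambda>x. x mod m"] that
      show "b = b' \<and> i = j" by simp
    qed simp
    have ps_range: "ps b i \<in> {1..n}" if "b < k" "i < m" for b i
    proof -
      have "b * m + i + 1 \<le> (b + 1) * m" using that by (simp add: algebra_simps)
      also have "\<dots> \<le> k * m" using that by (intro mult_right_mono) auto
      finally show ?thesis using km by (simp add: ps_def)
    qed
    have Mc_iff: "ps b i \<in> Mc c \<longleftrightarrow> c b = i" if "c \<in> configs k m" "b < k" "i < m" for c b i
    proof -
      have "c b' < m" if "b' < k" for b' using \<open>c \<in> _\<close> that by (auto simp: PiE_iff)
      then have "ps b i = ps b' (c b') \<longleftrightarrow> b = b' \<and> i = c b'" if "b' < k" for b'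
        using ps_inj[OF \<open>i < m\<close>] that by blast
      then show ?thesis using \<open>b < k\<close> unfolding Mc_def by blast
    qed
    have Mc: "Mc c \<subseteq> {1..n}" "card (Mc c) \<le> k" if "c \<in> configs k m" for c
    proof -
      show "Mc c \<subseteq> {1..n}" using that ps_range unfolding Mc_def by (auto simp: PiE_iff)
      show "card (Mc c) \<le> k" unfolding Mc_def using card_image_le[of "{..<k}"] by simp
    qed
    have upd: "c(b := i) \<in> configs k m" if "c \<in> configs k m" "b < k" "i < m" for c b i
      using that by (auto simp: PiE_iff extensional_def)
    have risk_le: "risk n \<sigma> est (\<mu> c) \<le> S" if "c \<in> configs k m" for c
      unfolding S_def sup_risk_def \<mu>_def using ball[OF Mc[OF that]] by (rule SUP_upper)
    have S: "S < \<infinity>" using False by (simp add: S_def top.not_eq_extremum)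
    have fin: "coord_risk n \<sigma> est (\<mu> c) i < \<infinity>" if "c \<in> configs k m" "i \<in> {1..n}" for c i
    proof -
      have "coord_risk n \<sigma> est (\<mu> c) i \<le> (\<Sum>i=1..n. coord_risk n \<sigma> est (\<mu> c) i)"
        using that(2) by (intro member_le_sum) auto
      also have "\<dots> \<le> S" using risk_le[OF that(1)] by (simp add: risk_eq_sum_coord_risk[OF est])
      finally show ?thesis using S by (rule le_less_trans)
    qed
    define r where "r c b i = enn2real (coord_risk n \<sigma> est (\<mu> c) (ps b i))" for c b i
    have r: "coord_risk n \<sigma> est (\<mu> c) (ps b i) = ennreal (r c b i)"
      if "c \<in> configs k m" "b < k" "i < m" for c b i
      using fin[OF that(1) ps_range[OF that(2,3)]] by (simp add: r_def)
    have r0: "r c b i \<ge> 0" for c b i by (simp add: r_def)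
    have "real k * h\<^sup>2 / 3 \<le> enn2real S"
    proof (rule averaged_risk_lower_bound[OF m h])
      fix c b i j assume c: "c \<in> configs k m" and b: "b < k" and ij: "i < m" "j < m" "i \<noteq> j"
      let ?c = "1 / (real m - 1)"
      let ?\<mu> = "\<mu> (c(b := i))" and ?\<nu> = "\<mu> (c(b := j))"
      let ?D = "\<Sum>l=1..n. (?\<mu> l - ?\<nu> l)\<^sup>2"
      have c0: "?c > 0" using m by simp
      have \<mu>i: "?\<mu> (ps b i) = h" "?\<nu> (ps b i) = 0"
        using Mc_iff[OF upd[OF c b ij(1)] b ij(1)] Mc_iff[OF upd[OF c b ij(2)] b ij(1)] ps_range[OF b ij(1)] ij
        by (auto simp: \<mu>_def two_valued_def)
      have zero: "?\<mu> l = ?\<nu> l" if "l \<in> {1..n} - {ps b i, ps b j}" for l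
      proof -
        have "l \<in> Mc (c(b := i)) \<longleftrightarrow> l \<in> Mc (c(b := j))"
        proof -
          have "l = ps b' ((c(b := i)) b') \<longleftrightarrow> l = ps b' ((c(b := j)) b')" for b'
            using that by (cases "b' = b") auto
          then show ?thesis unfolding Mc_def by blast
        qed
        then show ?thesis by (simp add: \<mu>_def two_valued_def)
      qed
      \<comment> \<open>Only the old and the new place of the moved spike differ, which is the
        origin of the 2 in \<open>exp (2 * h\<^sup>2 / \<sigma>\<^sup>2)\<close>.\<close>
      have "?D = (\<Sum>l\<in>{ps b i, ps b j}. (?\<mu> l - ?\<nu> l)\<^sup>2)"
        using zero ps_range b ij by (intro sum.mono_neutral_right) auto
      also have "\<dots> \<le> (\<Sum>l\<in>{ps b i, ps b j}. h\<^sup>2)"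
        by (intro sum_mono) (auto simp: \<mu>_def two_valued_def)
      also have "\<dots> \<le> 2 * h\<^sup>2" using ij by (simp add: ps_inj)
      finally have D: "exp (?D / \<sigma>\<^sup>2) \<le> exp (2 * h\<^sup>2 / \<sigma>\<^sup>2)"
        using \<sigma> by (simp add: divide_right_mono)
      have "ennreal (5 / 9 * h\<^sup>2 * ?c) \<le> ennreal ?c * coord_risk n \<sigma> est ?\<mu> (ps b i)
          + coord_risk n \<sigma> est ?\<nu> (ps b i)
          + ennreal (h\<^sup>2 * ?c\<^sup>2 / 9 * exp (?D / \<sigma>\<^sup>2))"
        by (rule coord_risk_two_point[where \<mu> = ?\<mu> and \<nu> = ?\<nu>,
              OF \<sigma> est ps_range[OF b ij(1)] \<mu>i c0])
      also have "\<dots> = ennreal (?c * r (c(b := i)) b i + r (c(b := j)) b i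
          + h\<^sup>2 * ?c\<^sup>2 / 9 * exp (?D / \<sigma>\<^sup>2))"
        unfolding r[OF upd[OF c b ij(1)] b ij(1)] r[OF upd[OF c b ij(2)] b ij(1)]
        using c0 r0 by (simp add: ennreal_mult'[symmetric] ennreal_plus[symmetric] del: ennreal_plus)
      finally have "5 / 9 * h\<^sup>2 * ?c \<le> ?c * r (c(b := i)) b i + r (c(b := j)) b i
          + h\<^sup>2 * ?c\<^sup>2 / 9 * exp (?D / \<sigma>\<^sup>2)"
        using c0 r0 by (subst (asm) ennreal_le_iff) (auto intro!: add_nonneg_nonneg mult_nonneg_nonneg)
      also have "\<dots> \<le> ?c * r (c(b := i)) b i + r (c(b := j)) b i
          + h\<^sup>2 * ?c\<^sup>2 / 9 * exp (2 * h\<^sup>2 / \<sigma>\<^sup>2)"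
        using D by (intro add_left_mono mult_left_mono) auto
      finally show "5 / 9 * h\<^sup>2 * ?c \<le> ?c * r (c(b := i)) b i + r (c(b := j)) b i
          + h\<^sup>2 * ?c\<^sup>2 / 9 * exp (2 * h\<^sup>2 / \<sigma>\<^sup>2)" .
    next
      fix c assume c: "c \<in> configs k m"
      have "ennreal (\<Sum>b<k. \<Sum>i<m. r c b i) = (\<Sum>(b, i)\<in>{..<k} \<times> {..<m}. ennreal (r c b i))"
        using r0 by (simp add: sum.cartesian_product case_prod_unfold sum_ennreal)
      also have "\<dots> = (\<Sum>(b, i)\<in>{..<k} \<times> {..<m}. coord_risk n \<sigma> est (\<mu> c) (ps b i))"
        using r[OF c] by (intro sum.cong) auto
      also have "\<dots> = (\<Sum>l\<in>(\<lambda>(b, i). ps b i) ` ({..<k} \<times> {..<m}). coord_risk n \<sigma> est (\<mu> c) l)"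
        using ps_inj by (subst sum.reindex) (auto simp: inj_on_def case_prod_unfold)
      also have "\<dots> \<le> (\<Sum>l=1..n. coord_risk n \<sigma> est (\<mu> c) l)"
        using ps_range by (intro sum_mono2) auto
      also have "\<dots> \<le> S" using risk_le[OF c] by (simp add: risk_eq_sum_coord_risk[OF est])
      finally have "ennreal (\<Sum>b<k. \<Sum>i<m. r c b i) \<le> ennreal (enn2real S)" using S by simp
      then show "(\<Sum>b<k. \<Sum>i<m. r c b i) \<le> enn2real S" by (subst (asm) ennreal_le_iff) auto
    qed
    then have "ennreal (real k * h\<^sup>2 / 3) \<le> ennreal (enn2real S)" by (rule ennreal_leI)
    also have "\<dots> = S" using S by simp
    finally show ?thesis by (simp only: S_def)
  qed simp
qed

section \<open>Control of the noise\<close>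

text \<open>The \<open>k\<close>-th of the \<open>n + 1\<close> binomial probabilities with parameter \<open>k / n\<close> is the largest one.\<close>

lemma binomial_entropy_bound:
  fixes n k :: nat
  assumes "k \<le> n" "n > 0"
  defines "r \<equiv> real k / real n"
  shows "1 / (real n + 1) \<le> real (n choose k) * r ^ k * (1 - r) ^ (n - k)"
proof -
  define f where "f j = real (n choose j) * r ^ j * (1 - r) ^ (n - j)" for j
  have r: "0 \<le> r" "r \<le> 1" using assms by (auto simp: r_def)
  have f0: "f j \<ge> 0" for j using r by (simp add: f_def)
  \<comment> \<open>Cross-multiplied, because \<open>k\<close> and \<open>n - k\<close> may
    vanish.\<close>
  have ratio: "f (Suc j) * (real (Suc j) * real (n - k)) = f j * (real (n - j) * real k)" if "j < n" for j
  proof -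
    have c: "real (n choose Suc j) * real (Suc j) = real (n choose j) * real (n - j)"
    proof -
      have "(n choose Suc j) * Suc j = (n choose j) * (n - j)"
        using binomial_absorb_comp[of n j] binomial_absorption[of j n] by (simp only: mult.commute)
      then show ?thesis by (simp only: of_nat_mult[symmetric])
    qed
    have e: "(1 - r) * real n = real (n - k)" "r * real n = real k"
      using assms by (auto simp: r_def field_simps of_nat_diff)
    have p: "(1 - r) ^ (n - j) = (1 - r) * (1 - r) ^ (n - Suc j)"
      using that by (simp add: power_Suc[symmetric] Suc_diff_Suc)
    have "f (Suc j) * (real (Suc j) * real (n - k))
      = (real (n choose Suc j) * real (Suc j)) * (r * r ^ j) * ((1 - r) ^ (n - Suc j) * real (n - k))"
      by (simp add: f_def)
    also have "\<dots> = (real (n choose j) * real (n - j)) * (r * r ^ j) * ((1 - r) ^ (n - Suc j) * ((1 - r) * real n))"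
      by (simp only: c e)
    also have "\<dots> = f j * (real (n - j) * (r * real n))" unfolding f_def p by (simp add: ac_simps)
    finally show ?thesis by (simp only: e)
  qed
  have up: "f j \<le> f k" if "j \<le> k" for j
    using that
  proof (induction rule: inc_induct)
    case (step j)
    then have "j < n" using assms by simp
    have "real (Suc j) * real (n - k) \<le> real k * real (n - j)"
      using step by (intro mult_mono) auto
    then have "real (Suc j) * real (n - k) \<le> real (n - j) * real k" by (simp only: mult.commute)
    moreover have "real (n - j) * real k > 0" using \<open>j < n\<close> step by simp
    ultimately have "f j * (real (n - j) * real k) \<le> f (Suc j) * (real (n - j) * real k)"
      using ratio[OF \<open>j < n\<close>] f0 mult_left_mono[of "real (Suc j) * real (n - k)" _ "f (Suc j)"]
      by simp
    then have "f j \<le> f (Suc j)" using \<open>real (n - j) * real k > 0\<close> by (rule mult_right_le_imp_le)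
    then show ?case using step by simp
  qed simp
  have down: "f j \<le> f k" if "k \<le> j" "j \<le> n" for j
    using that
  proof (induction rule: dec_induct)
    case (step j)
    then have "j < n" by simp
    have "real k * real (n - j) \<le> real (Suc j) * real (n - k)"
      using step by (intro mult_mono) auto
    then have "real (n - j) * real k \<le> real (Suc j) * real (n - k)" by (simp only: mult.commute)
    moreover have "real (Suc j) * real (n - k) > 0" using \<open>j < n\<close> step by simp
    ultimately have "f (Suc j) * (real (Suc j) * real (n - k)) \<le> f j * (real (Suc j) * real (n - k))"
      using ratio[OF \<open>j < n\<close>] f0 mult_left_mono[of "real (n - j) * real k" _ "f j"]
      by simp
    then have "f (Suc j) \<le> f j" using \<open>real (Suc j) * real (n - k) > 0\<close> by (rule mult_right_le_imp_le)
    then show ?case using step by simp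
  qed simp
  have "1 = (r + (1 - r)) ^ n" by simp
  also have "\<dots> = (\<Sum>j\<le>n. f j)" unfolding f_def by (subst binomial_ring) simp
  also have "\<dots> \<le> (\<Sum>j\<le>n. f k)" using up down by (intro sum_mono) (metis atMost_iff linear)
  also have "\<dots> = (real n + 1) * f k" by simp
  finally show ?thesis by (simp add: f_def field_simps)
qed

text \<open>Quantitative strict concavity:
  \<open>(1 + v) / 2 - sqrt v = (1 - sqrt v)\<^sup>2 / 2\<close>, and
  \<open>1 - sqrt v \<ge> (1 - v) / 2 \<ge> \<delta> / 2\<close>.\<close>

lemma sqrt_le_minus_deviation:
  fixes v \<delta> :: real
  assumes "0 \<le> v" "v \<le> 1 - \<delta>" "0 \<le> \<delta>"
  shows "sqrt v + \<delta>\<^sup>2 / 8 \<le> (1 + v) / 2"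
proof -
  have sv: "sqrt v \<ge> 0" "(sqrt v)\<^sup>2 = v" "sqrt v \<le> 1" using assms by auto
  have "(1 - v) = (1 - sqrt v) * (1 + sqrt v)"
    using sv(2) by (simp add: algebra_simps power2_eq_square)
  also have "\<dots> \<le> (1 - sqrt v) * 2" using sv by (intro mult_left_mono) auto
  finally have "\<delta> / 2 \<le> 1 - sqrt v" using assms by simp
  then have "(\<delta> / 2)\<^sup>2 \<le> (1 - sqrt v)\<^sup>2" using assms by (intro power_mono) auto
  also have "\<dots> = 1 + v - 2 * sqrt v" using sv(2) by (simp add: power2_eq_square algebra_simps)
  finally show ?thesis by (simp add: power2_eq_square)
qed

lemma sqrt_le_half: "0 \<le> v \<Longrightarrow> sqrt v \<le> (1 + v) / 2" for v :: real
  using arith_geo_mean_sqrt[of v 1] by simp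

text \<open>
  With \<open>T = \<gamma> / (1 + \<gamma>)\<close> and \<open>a = 1\<close> the factor \<open>exp (T x\<^sup>2 / 2) \<surd>(1 - T)\<close> is the likelihood ratio of
  \<open>N(0, 1 + \<gamma>)\<close> to \<open>N(0, 1)\<close>, so that \<open>tilted 1 T r\<close> has mean one.
\<close>

definition tilted :: "real \<Rightarrow> real \<Rightarrow> real \<Rightarrow> real \<Rightarrow> real" where
  "tilted a T r x = 1 - r + r * (exp (a * T * x\<^sup>2 / 2) * sqrt (1 - T))"

lemma tilted_nonneg:
  assumes "0 \<le> r" "r \<le> 1" "T \<le> 1"
  shows "0 \<le> tilted a T r x"
  unfolding tilted_def using assms by (intro add_nonneg_nonneg mult_nonneg_nonneg) auto

lemma ln_one_minus_le: "T \<in> {0<..<1} \<Longrightarrow> ln (1 - T) \<le> - T" for T :: real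
  using ln_le_minus_one[of "1 - T"] by simp

text \<open>For such \<open>x\<close> the exponent is at most
  \<open>T / 4 \<le> - ln (1 - T) / 4\<close>. This uses up only half of the factor
  \<open>sqrt (1 - T)\<close>, so the likelihood ratio stays below
  \<open>(1 - T) powr (1/4) < 1\<close>.\<close>

lemma tilted_le_near_zero:
  assumes "0 \<le> r" "r \<le> 1" "0 < T" "T < 1" "0 \<le> a" "a \<le> 2" "\<bar>x\<bar> \<le> 1/2"
  shows "tilted a T r x \<le> 1 - r * (1 - (1 - T) powr (1/4))"
proof -
  have "x\<^sup>2 \<le> (1/2)\<^sup>2" using assms(7) abs_le_square_iff[of x "1/2"] by simp
  then have "a * x\<^sup>2 \<le> 2 * (1/2)\<^sup>2" using assms by (intro mult_mono) auto
  then have "T * (a * x\<^sup>2) \<le> T * (1/2)" using assms by (intro mult_left_mono) (auto simp: power2_eq_square)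
  then have "a * T * x\<^sup>2 / 2 \<le> T / 4" by (simp add: ac_simps)
  also have "\<dots> \<le> - (ln (1 - T) / 4)" using ln_one_minus_le[of T] assms by simp
  finally have "exp (a * T * x\<^sup>2 / 2) \<le> exp (- (ln (1 - T) / 4))" by simp
  then have "exp (a * T * x\<^sup>2 / 2) * sqrt (1 - T) \<le> exp (- (ln (1 - T) / 4)) * sqrt (1 - T)"
    using assms by (intro mult_right_mono) auto
  also have "exp (- (ln (1 - T) / 4)) * sqrt (1 - T) = (1 - T) powr (1/4)"
    using assms by (simp add: powr_half_sqrt[symmetric] powr_def exp_add[symmetric])
  finally have "r * (exp (a * T * x\<^sup>2 / 2) * sqrt (1 - T)) \<le> r * (1 - T) powr (1/4)"
    using assms by (intro mult_left_mono)
  then show ?thesis by (simp add: tilted_def algebra_simps)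
qed

text \<open>The mean of \<open>(1 + tilted a T r x) / 2\<close> bounds the mean of the root; its
  excess over 1 vanishes at \<open>a = 1\<close>. On the interval of
  \<open>gauss_interval_mass\<close> the comparison has slack \<open>\<delta>\<^sup>2 / 8\<close>,
  and this gain is subtracted.\<close>

lemma gauss_sqrt_tilted_le:
  assumes r: "0 \<le> r" "r \<le> 1" and T: "0 < T" "T < 1" and a: "0 \<le> a" "a \<le> 2" "a * T < 1"
  defines "\<delta> \<equiv> r * (1 - (1 - T) powr (1/4))"
  shows "gauss_mean (\<lambda>x. sqrt (tilted a T r x))
    \<le> ennreal (1 + (sqrt ((1 - T) / (1 - a * T)) - 1) * r / 2 - \<delta>\<^sup>2 / 8 * std_normal_density (1/2))"
proof -
  have \<delta>: "0 \<le> \<delta>" unfolding \<delta>_def using r T by (intro mult_nonneg_nonneg) (auto simp: powr_le1)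
  note V0 = tilted_nonneg[OF r less_imp_le[OF T(2)], of a]
  let ?J = "{-(1/2)..1/2::real}"
  have mV: "tilted a T r \<in> borel_measurable borel" unfolding tilted_def by measurable
  let ?L = "\<integral>\<^sup>+x. ennreal (sqrt (tilted a T r x)) \<partial>gauss"
  have mean: "gauss_mean (\<lambda>x. (1 + tilted a T r x) / 2)
     = ennreal (1 + (sqrt ((1 - T) / (1 - a * T)) - 1) * r / 2)"
  proof -
    have e: "(1 + tilted a T r x) / 2 = (1 - r / 2) + r * sqrt (1 - T) / 2 * exp (a * T * x\<^sup>2 / 2)" for x
      by (simp add: tilted_def field_simps)
    have "gauss_mean (\<lambda>x. (1 + tilted a T r x) / 2)
      = (\<integral>\<^sup>+x. ennreal (1 - r / 2) + ennreal (r * sqrt (1 - T) / 2) * ennreal (exp (a * T * x\<^sup>2 / 2)) \<partial>gauss)"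
      unfolding e using r T by (intro nn_integral_cong) (simp add: ennreal_mult'[symmetric] ennreal_plus)
    also have "\<dots> = ennreal (1 - r / 2) + ennreal (r * sqrt (1 - T) / 2) * ennreal (1 / sqrt (1 - a * T))"
      using gauss_exp_square[OF a(3)]
      by (subst nn_integral_add) (auto simp: nn_integral_cmult gauss.emeasure_space_1[simplified])
    also have "\<dots> = ennreal (1 - r / 2 + r * sqrt (1 - T) / 2 * (1 / sqrt (1 - a * T)))"
      using r T a by (simp add: ennreal_mult'[symmetric] ennreal_plus)
    also have "1 - r / 2 + r * sqrt (1 - T) / 2 * (1 / sqrt (1 - a * T)) = 1 + (sqrt ((1 - T) / (1 - a * T)) - 1) * r / 2"
      by (simp add: real_sqrt_divide field_simps)
    finally show ?thesis .
  qed
  have "?L + ennreal (\<delta>\<^sup>2 / 8 * std_normal_density (1/2))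
    \<le> ?L + ennreal (\<delta>\<^sup>2 / 8) * emeasure gauss ?J"
    using gauss_interval_mass by (subst ennreal_mult') (auto intro!: add_left_mono mult_left_mono)
  also have "\<dots> = (\<integral>\<^sup>+x. ennreal (sqrt (tilted a T r x)) + ennreal (\<delta>\<^sup>2 / 8) * indicator ?J x \<partial>gauss)"
    using mV by (subst nn_integral_add) (auto simp: nn_integral_cmult_indicator)
  also have "\<dots> \<le> gauss_mean (\<lambda>x. (1 + tilted a T r x) / 2)"
  proof (rule nn_integral_mono)
    fix x
    show "ennreal (sqrt (tilted a T r x)) + ennreal (\<delta>\<^sup>2 / 8) * indicator ?J x \<le> ennreal ((1 + tilted a T r x) / 2)"
    proof (cases "x \<in> ?J")
      case True
      then have "\<bar>x\<bar> \<le> 1/2" by auto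
      then have "sqrt (tilted a T r x) + \<delta>\<^sup>2 / 8 \<le> (1 + tilted a T r x) / 2"
        using tilted_le_near_zero[OF r T a(1,2)] V0 \<delta> unfolding \<delta>_def[symmetric]
        by (intro sqrt_le_minus_deviation)
      then have "ennreal (sqrt (tilted a T r x) + \<delta>\<^sup>2 / 8) \<le> ennreal ((1 + tilted a T r x) / 2)" by (rule ennreal_leI)
      then show ?thesis using True V0[of x] by (simp add: ennreal_plus)
    next
      case False
      then show ?thesis using V0[of x] sqrt_le_half[of "tilted a T r x"] by (auto intro: ennreal_leI)
    qed
  qed
  finally have le: "?L + ennreal (\<delta>\<^sup>2 / 8 * std_normal_density (1/2))
    \<le> ennreal (1 + (sqrt ((1 - T) / (1 - a * T)) - 1) * r / 2)" unfolding mean .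
  let ?d = "\<delta>\<^sup>2 / 8 * std_normal_density (1/2)"
  have d0: "?d \<ge> 0" by simp
  have "?L = ?L + ennreal ?d - ennreal ?d" by simp
  also have "\<dots> \<le> ennreal (1 + (sqrt ((1 - T) / (1 - a * T)) - 1) * r / 2) - ennreal ?d"
    using le by (rule ennreal_minus_mono) simp
  also have "\<dots> = ennreal (1 + (sqrt ((1 - T) / (1 - a * T)) - 1) * r / 2 - ?d)"
    using d0 by (rule ennreal_minus)
  finally show ?thesis .
qed

section \<open>The penalty in units of \<open>\<sigma>\<^sup>2\<close>, and the two exponential
  bounds\<close>

definition npen :: "nat \<Rightarrow> real \<Rightarrow> nat pmf \<Rightarrow> nat \<Rightarrow> real" where
  "npen n \<gamma> prior k = 2 * (1 + 1 / \<gamma>) *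
     ln (real (n choose k) * inverse (pmf prior k) * (1 + \<gamma>) powr (real k / 2))"

lemma penalty_eq_npen: "penalty n \<sigma> \<gamma> prior k = \<sigma>\<^sup>2 * npen n \<gamma> prior k"
  by (simp add: penalty_def npen_def)

lemma sqrt_prod: "sqrt (\<Prod>i\<in>A. f i) = (\<Prod>i\<in>A. sqrt (f i))"
  by (induction A rule: infinite_finite_induct) (auto simp: real_sqrt_mult)

lemma measurable_noise_component [measurable]:
  "i \<in> {1..n} \<Longrightarrow> (\<lambda>z. z i) \<in> borel_measurable (noise_law n)"
  using measurable_vec_component[of i n] by (simp cong: measurable_cong_sets add: sets_noise_law)

lemma measurable_sum_squares:
  assumes "M \<subseteq> {1..n}"
  shows "(\<lambda>z. \<Sum>i\<in>M. (z i)\<^sup>2) \<in> borel_measurable (noise_law n)"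
  using assms by (intro borel_measurable_sum borel_measurable_power measurable_noise_component) auto

context
  fixes n :: nat and prior :: "nat pmf" and \<gamma> T :: real
  assumes n: "n \<ge> 1" and prior: "set_pmf prior = {0..n}" and \<gamma>: "\<gamma> > 0"
    and T: "T = \<gamma> / (1 + \<gamma>)"
begin

lemma T_bounds: "0 < T" "T < 1" "1 - T = 1 / (1 + \<gamma>)" "T * (1 + 1 / \<gamma>) = 1"
proof -
  have "1 + 1 / \<gamma> = (1 + \<gamma>) / \<gamma>" using \<gamma> by (simp add: field_simps)
  then show "T * (1 + 1 / \<gamma>) = 1" using \<gamma> by (simp add: T)
  show "0 < T" "T < 1" "1 - T = 1 / (1 + \<gamma>)" using \<gamma> by (auto simp: T field_simps)
qed

lemma prior_pos: "k \<le> n \<Longrightarrow> pmf prior k > 0"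
  using prior by (intro pmf_positive) auto

lemma prior_sum: "(\<Sum>k=1..n. pmf prior k) = 1 - pmf prior 0"
proof -
  have "(\<Sum>k\<in>{0..n}. pmf prior k) = 1"
    using prior by (intro sum_pmf_eq_1) auto
  then show ?thesis by (simp add: sum.atLeast_Suc_atMost[of 0 n] One_nat_def)
qed

text \<open>\<open>T\<close> is the reciprocal of \<open>1 + 1 / \<gamma>\<close>, so the prefactor
  of the penalty cancels. At \<open>s = 1\<close> the result is the prior mass shared equally among
  the sets of size \<open>k\<close>, times the normalization of the likelihood ratio on
  \<open>k\<close> coordinates.\<close>

lemma exp_npen:
  assumes "k \<le> n"
  shows "exp (- (s * T / 2 * npen n \<gamma> prior k))
    = (real (n choose k) * inverse (pmf prior k) * (1 + \<gamma>) powr (real k / 2)) powr (- s)"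
proof -
  define Q where "Q = real (n choose k) * inverse (pmf prior k) * (1 + \<gamma>) powr (real k / 2)"
  have "Q > 0" unfolding Q_def using assms prior_pos[OF assms] \<gamma> by (intro mult_pos_pos) auto
  moreover have "s * T / 2 * npen n \<gamma> prior k = s * (T * (1 + 1 / \<gamma>)) * ln Q"
    unfolding npen_def Q_def by simp
  then have "s * T / 2 * npen n \<gamma> prior k = s * ln Q" using T_bounds(4) by simp
  ultimately show ?thesis unfolding Q_def[symmetric] by (simp add: powr_def)
qed

lemma npen_zero_nonneg: "npen n \<gamma> prior 0 \<ge> 0"
proof -
  have "1 \<le> inverse (pmf prior 0)" using prior_pos[of 0] pmf_le_1[of prior 0] by (simp add: one_le_inverse_iff)
  then show ?thesis unfolding npen_def using \<gamma> by (intro mult_nonneg_nonneg ln_ge_zero) auto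
qed

text \<open>A Chernoff bound slightly above the critical exponent \<open>T / 2\<close>. Writing
  \<open>k\<close> for the size, the Gaussian moment costs at most \<open>d powr (- k / 2)\<close>.
  The surplus \<open>e\<close> in the penalty brings
  \<open>(n choose k) powr (- e) \<le> (k / n) powr (e * k)\<close>, and the size limit makes this
  at most \<open>d powr (k / 2)\<close>, which cancels the cost exactly. What is left sums over all
  sets of size \<open>k\<close> to the prior mass of \<open>k\<close>.\<close>

lemma chernoff_small_subset:
  assumes e: "e > 0" and a: "a * (1 + e) * T \<le> 1 - d" and d: "d > 0"
    and M: "M \<subseteq> {1..n}" "1 \<le> card M" "real (card M) / real n \<le> d powr (1 / (2 * e))"
  shows "noise_mean n (\<lambda>z. exp ((1 + e) * T / 2 * (a * (\<Sum>i\<in>M. (z i)\<^sup>2) - npen n \<gamma> prior (card M))))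
    \<le> ennreal (pmf prior (card M) / real (n choose card M))"
proof -
  define k where "k = card M"
  have k: "1 \<le> k" "k \<le> n" using M card_mono[OF _ M(1)] by (auto simp: k_def)
  let ?C = "real (n choose k)" and ?p = "pmf prior k" and ?t = "a * (1 + e) * T"
  let ?P = "exp (- ((1 + e) * T / 2 * npen n \<gamma> prior k))"
  have C: "?C \<ge> 1" using zero_less_binomial[OF k(2)] by linarith
  have p: "?p > 0" "?p \<le> 1" using prior_pos[OF k(2)] by (auto simp: pmf_le_1)
  have t: "?t < 1" using a d by simp
  have pen: "?P \<le> ?p / ?C * ?C powr (- e)"
  proof -
    have "?C * inverse ?p * 1 \<le> ?C * inverse ?p * (1 + \<gamma>) powr (real k / 2)"
      using \<gamma> p C by (intro mult_left_mono ge_one_powr_ge_zero) auto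
    then have "?P \<le> (?C * inverse ?p) powr (- (1 + e))"
      unfolding exp_npen[OF k(2)] using p C e k
      by (intro powr_mono2') (auto intro!: mult_pos_pos)
    also have "\<dots> = (?p / ?C) powr (1 + e)"
    proof -
      have "inverse x powr (- t) = x powr t" if "x > 0" for x t :: real
        using that by (simp add: powr_def ln_inverse)
      from this[of "?p / ?C" "1 + e"] show ?thesis using p C k by (simp add: field_simps)
    qed
    also have "\<dots> = ?p / ?C * ((?p / ?C) powr e)"
      using p C by (simp add: powr_add)
    also have "\<dots> \<le> ?p / ?C * ((1 / ?C) powr e)"
      using p C e by (intro mult_left_mono powr_mono2 divide_right_mono) auto
    also have "(1 / ?C) powr e = ?C powr (- e)" using C by (simp add: powr_minus_divide powr_divide)
    finally show ?thesis .
  qed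
  have C_pow: "?C powr (- e) \<le> (d powr (1/2)) ^ k"
  proof -
    have "(real n / real k) ^ k \<le> ?C" by (rule binomial_ge_n_over_k_pow_k[OF k(2)])
    then have "?C powr (- e) \<le> ((real n / real k) ^ k) powr (- e)"
      using k e by (intro powr_mono2') auto
    also have "\<dots> = ((real k / real n) powr e) ^ k"
      using k by (simp add: powr_realpow[symmetric] powr_powr powr_minus powr_divide field_simps)
    also have "\<dots> \<le> ((d powr (1 / (2 * e))) powr e) ^ k"
      using M(3) e by (intro power_mono powr_mono2) (auto simp: k_def)
    also have "(d powr (1 / (2 * e))) powr e = d powr (1/2)" using e by (simp add: powr_powr)
    finally show ?thesis .
  qed
  have d1: "(1 / sqrt (1 - ?t)) ^ k \<le> (1 / d powr (1/2)) ^ k"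
    using a d by (intro power_mono frac_le) (auto simp: powr_half_sqrt)
  have "noise_mean n (\<lambda>z. exp ((1 + e) * T / 2 * (a * (\<Sum>i\<in>M. (z i)\<^sup>2) - npen n \<gamma> prior k)))
    = (\<integral>\<^sup>+z. ennreal (?P)
        * ennreal (exp (?t / 2 * (\<Sum>i\<in>M. (z i)\<^sup>2))) \<partial>noise_law n)"
    by (intro nn_integral_cong, subst ennreal_mult'[symmetric])
      (auto simp: exp_add[symmetric] algebra_simps add_divide_distrib diff_divide_distrib)
  also have "\<dots> = ennreal (?P) * ennreal ((1 / sqrt (1 - ?t)) ^ k)"
  proof -
    note [measurable] = measurable_sum_squares[OF M(1)]
    show ?thesis
      unfolding k_def noise_exp_sum_squares[OF t M(1), symmetric] by (rule nn_integral_cmult) measurable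
  qed
  also have "\<dots> = ennreal (?P * (1 / sqrt (1 - ?t)) ^ k)"
    by (simp add: ennreal_mult')
  also have "\<dots> \<le> ennreal (?p / ?C * (d powr (1/2)) ^ k * (1 / d powr (1/2)) ^ k)"
  proof (intro ennreal_leI mult_mono d1)
    have "?P \<le> ?p / ?C * ?C powr (- e)" by (rule pen)
    also have "\<dots> \<le> ?p / ?C * (d powr (1/2)) ^ k" using C_pow p by (intro mult_left_mono) auto
    finally show "?P \<le> ?p / ?C * (d powr (1/2)) ^ k" .
  qed (use t p in auto)
  also have "?p / ?C * (d powr (1/2)) ^ k * (1 / d powr (1/2)) ^ k = ?p / ?C"
    using d by (simp add: power_mult_distrib[symmetric])
  finally show ?thesis by (simp add: k_def)
qed

text \<open>The exponent \<open>T / 4\<close> is half the critical one, so the left side is the root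
  of \<open>A / Q\<close>. By the entropy bound,
  \<open>1 / (n choose k) \<le> (n + 1) * r ^ k * (1 - r) ^ (n - k)\<close>, and the right side
  turns the likelihood ratio on \<open>M\<close> into one term of the expansion of a product of
  mixtures. The bound depends on \<open>M\<close> only through its size, so a single function serves
  all sets of that size.\<close>

lemma tilted_product_bound:
  assumes M: "M \<subseteq> {1..n}" "1 \<le> card M"
  defines "r \<equiv> real (card M) / real n"
  shows "exp (T / 4 * (a * (\<Sum>i\<in>M. (z i)\<^sup>2) - npen n \<gamma> prior (card M)))
    \<le> sqrt (real n + 1) * (\<Prod>i=1..n. sqrt (tilted a T r (z i)))"
proof -
  define k where "k = card M"
  have fin: "finite M" using M(1) finite_subset by blast
  have k: "1 \<le> k" "k \<le> n" using M card_mono[OF _ M(1)] by (auto simp: k_def)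
  have r: "0 \<le> r" "r \<le> 1" using k n by (auto simp: r_def k_def[symmetric])
  let ?C = "real (n choose k)" and ?p = "pmf prior k"
  have C: "?C \<ge> 1" using zero_less_binomial[OF k(2)] by linarith
  have p: "?p > 0" "?p \<le> 1" using prior_pos[OF k(2)] by (auto simp: pmf_le_1)
  define A where "A = exp (a * T / 2 * (\<Sum>i\<in>M. (z i)\<^sup>2))"
  define Q where "Q = ?C * inverse ?p * (1 + \<gamma>) powr (real k / 2)"
  define P where "P = (\<Prod>i=1..n. tilted a T r (z i))"
  have Q: "Q > 0" using p C \<gamma> k unfolding Q_def by (intro mult_pos_pos) auto
  have A: "A > 0" by (simp add: A_def)
  have s1T: "sqrt (1 - T) ^ k = inverse ((1 + \<gamma>) powr (real k / 2))"
    using \<gamma> unfolding T_bounds(3)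
    by (simp add: powr_half_sqrt[symmetric] powr_realpow[symmetric] powr_powr powr_divide inverse_eq_divide)
  have lhs: "exp (T / 4 * (a * (\<Sum>i\<in>M. (z i)\<^sup>2) - npen n \<gamma> prior k)) = sqrt (A / Q)"
  proof -
    have "exp (T / 4 * (a * (\<Sum>i\<in>M. (z i)\<^sup>2) - npen n \<gamma> prior k))
      = exp (1/2 * (a * T / 2 * (\<Sum>i\<in>M. (z i)\<^sup>2))) * exp (- ((1/2) * T / 2 * npen n \<gamma> prior k))"
      by (simp add: exp_add[symmetric] algebra_simps diff_divide_distrib)
    also have "exp (- ((1/2) * T / 2 * npen n \<gamma> prior k)) = Q powr (- (1/2))"
      unfolding exp_npen[OF k(2)] Q_def ..
    also have "\<dots> = 1 / sqrt Q" using Q by (simp add: powr_minus powr_half_sqrt inverse_eq_divide)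
    also have "exp (1/2 * (a * T / 2 * (\<Sum>i\<in>M. (z i)\<^sup>2))) = sqrt A"
      unfolding A_def by (simp add: powr_half_sqrt[symmetric] powr_def)
    finally show ?thesis by (simp add: real_sqrt_divide)
  qed
  have "A * (r ^ k * (1 - r) ^ (n - k) * sqrt (1 - T) ^ k)
    = (\<Prod>i\<in>M. r * (exp (a * T * (z i)\<^sup>2 / 2) * sqrt (1 - T))) * (\<Prod>i\<in>{1..n} - M. 1 - r)"
  proof -
    have "A = (\<Prod>i\<in>M. exp (a * T * (z i)\<^sup>2 / 2))"
      unfolding A_def using fin by (simp add: exp_sum[symmetric] sum_distrib_left sum_divide_distrib)
    moreover have "card ({1..n} - M) = n - k" using M(1) fin by (simp add: card_Diff_subset k_def)
    ultimately show ?thesis by (simp add: prod.distrib k_def ac_simps)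
  qed
  \<comment> \<open>Each factor is one of the two nonnegative summands of \<open>tilted\<close>: the
    likelihood ratio inside \<open>M\<close>, the constant outside.\<close>
  also have "\<dots> \<le> (\<Prod>i\<in>M. tilted a T r (z i)) * (\<Prod>i\<in>{1..n} - M. tilted a T r (z i))"
    using r T_bounds(1,2)
    by (intro mult_mono prod_mono prod_nonneg) (auto simp: tilted_def intro!: mult_nonneg_nonneg)
  also have "\<dots> = P" unfolding P_def using M(1) by (subst prod.subset_diff[of M "{1..n}"]) (auto simp: mult.commute)
  finally have AP: "A * (r ^ k * (1 - r) ^ (n - k) * sqrt (1 - T) ^ k) \<le> P" .
  have ent: "1 \<le> (real n + 1) * (?C * r ^ k * (1 - r) ^ (n - k))"
    using binomial_entropy_bound[OF k(2)] n by (simp add: r_def k_def[symmetric] field_simps)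
  have "A / Q = A * sqrt (1 - T) ^ k * ?p / ?C"
    unfolding s1T Q_def by (simp add: field_simps)
  also have "\<dots> \<le> A * sqrt (1 - T) ^ k * 1 / ?C"
    using A p C T_bounds(1,2) by (intro divide_right_mono mult_left_mono) auto
  also have "\<dots> \<le> A * sqrt (1 - T) ^ k / ?C * ((real n + 1) * (?C * r ^ k * (1 - r) ^ (n - k)))"
    using mult_left_mono[OF ent, of "A * sqrt (1 - T) ^ k / ?C"] A C T_bounds(1,2) by simp
  also have "\<dots> = (real n + 1) * (A * (r ^ k * (1 - r) ^ (n - k) * sqrt (1 - T) ^ k))"
    using C k by simp
  also have "\<dots> \<le> (real n + 1) * P" using AP by (intro mult_left_mono) auto
  finally have "sqrt (A / Q) \<le> sqrt ((real n + 1) * P)" by simp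
  also have "\<dots> = sqrt (real n + 1) * (\<Prod>i=1..n. sqrt (tilted a T r (z i)))"
    unfolding P_def by (simp add: real_sqrt_mult sqrt_prod)
  finally show ?thesis using lhs by (simp add: k_def)
qed

end

section \<open>A measurable majorant of the noise excess\<close>

lemma sum_subsets_by_card:
  fixes f :: "nat \<Rightarrow> real"
  shows "(\<Sum>M\<in>{M. M \<subseteq> {1..n} \<and> 1 \<le> card M}. f (card M)) = (\<Sum>k=1..n. real (n choose k) * f k)"
proof -
  let ?S = "{M. M \<subseteq> {1..n} \<and> 1 \<le> card M}"
  have fin: "finite ?S" by (rule finite_subset[of _ "Pow {1..n}"]) auto
  have im: "card ` ?S \<subseteq> {1..n}" using card_mono[of "{1..n}"] by fastforce
  have "(\<Sum>M\<in>?S. f (card M)) = (\<Sum>k\<in>{1..n}. \<Sum>M\<in>{M \<in> ?S. card M = k}. f (card M))"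
    by (rule sum.group[symmetric]) (use fin im in auto)
  also have "\<dots> = (\<Sum>k=1..n. real (n choose k) * f k)"
  proof (rule sum.cong)
    fix k assume k: "k \<in> {1..n}"
    have "{M \<in> ?S. card M = k} = {M. M \<subseteq> {1..n} \<and> card M = k}" using k by auto
    then have "card {M \<in> ?S. card M = k} = n choose k" using n_subsets[of "{1..n}" k] by simp
    moreover have "(\<Sum>M\<in>{M \<in> ?S. card M = k}. f (card M)) = (\<Sum>M\<in>{M \<in> ?S. card M = k}. f k)"
      by (rule sum.cong) auto
    ultimately show "(\<Sum>M\<in>{M \<in> ?S. card M = k}. f (card M)) = real (n choose k) * f k" by simp
  qed simp
  finally show ?thesis .
qed

lemma le_exp_scaled: "th > 0 \<Longrightarrow> x \<le> exp (th * x) / th" for x th :: real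
proof -
  assume "th > 0"
  moreover have "th * x \<le> exp (th * x)" using exp_ge_add_one_self[of "th * x"] by linarith
  ultimately show ?thesis by (simp add: pos_le_divide_eq mult.commute)
qed

text \<open>Both terms use \<open>x \<le> exp (th x) / th\<close> to dominate the positive part of the noise excess.\<close>

definition small_term ::
  "nat \<Rightarrow> real \<Rightarrow> nat pmf \<Rightarrow> real \<Rightarrow> real \<Rightarrow> real \<Rightarrow> real \<Rightarrow> nat set \<Rightarrow> (nat \<Rightarrow> real) \<Rightarrow> real" where
  "small_term n \<gamma> prior a e T eps M z =
     (if real (card M) / real n \<le> eps
      then exp ((1 + e) * T / 2 * (a * (\<Sum>i\<in>M. (z i)\<^sup>2) - npen n \<gamma> prior (card M))) / ((1 + e) * T / 2)
      else 0)"

definition large_term :: "nat \<Rightarrow> real \<Rightarrow> real \<Rightarrow> real \<Rightarrow> nat \<Rightarrow> (nat \<Rightarrow> real) \<Rightarrow> real" where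
  "large_term n a T eps k z =
     (if eps < real k / real n
      then 4 / T * (sqrt (real n + 1) * (\<Prod>i=1..n. sqrt (tilted a T (real k / real n) (z i))))
      else 0)"

text \<open>A sum replaces the supremum over sets, so that measurability and integration go term by
  term. Small sets have one term each; large sets share one term per cardinality.\<close>

definition noise_bound ::
  "nat \<Rightarrow> real \<Rightarrow> nat pmf \<Rightarrow> real \<Rightarrow> real \<Rightarrow> real \<Rightarrow> real \<Rightarrow> (nat \<Rightarrow> real) \<Rightarrow> real" where
  "noise_bound n \<gamma> prior a e T eps z =
     (\<Sum>M\<in>{M. M \<subseteq> {1..n} \<and> 1 \<le> card M}. small_term n \<gamma> prior a e T eps M z)
     + (\<Sum>k=1..n. large_term n a T eps k z)"

lemma small_term_nonneg: "0 < T \<Longrightarrow> e > 0 \<Longrightarrow> 0 \<le> small_term n \<gamma> prior a e T eps M z"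
  by (simp add: small_term_def)

lemma large_term_nonneg:
  assumes "k \<in> {1..n}" "0 < T" "T < 1"
  shows "0 \<le> large_term n a T eps k z"
proof -
  have "0 \<le> (\<Prod>i=1..n. sqrt (tilted a T (real k / real n) (z i)))"
    using assms by (intro prod_nonneg) (auto intro!: tilted_nonneg simp: divide_le_eq)
  then show ?thesis using assms(2) by (simp add: large_term_def)
qed

lemma noise_bound_nonneg:
  assumes "0 < T" "T < 1" "e > 0"
  shows "0 \<le> noise_bound n \<gamma> prior a e T eps z"
  unfolding noise_bound_def using assms
  by (intro add_nonneg_nonneg sum_nonneg small_term_nonneg large_term_nonneg)

lemma measurable_small_term:
  assumes "M \<subseteq> {1..n}"
  shows "small_term n \<gamma> prior a e T eps M \<in> borel_measurable (noise_law n)"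
proof -
  note [measurable] = measurable_sum_squares[OF assms]
  show ?thesis unfolding small_term_def[abs_def] by measurable
qed

lemma measurable_large_term: "large_term n a T eps k \<in> borel_measurable (noise_law n)"
  unfolding large_term_def[abs_def] tilted_def
  by (cases "eps < real k / real n") (simp_all only: if_True if_False, measurable)

lemma measurable_noise_bound: "noise_bound n \<gamma> prior a e T eps \<in> borel_measurable (vec_space n)"
proof -
  have "noise_bound n \<gamma> prior a e T eps \<in> borel_measurable (noise_law n)"
    unfolding noise_bound_def[abs_def]
    by (intro borel_measurable_add borel_measurable_sum measurable_small_term measurable_large_term) auto
  then show ?thesis by (simp cong: measurable_cong_sets add: sets_noise_law)
qed

lemma noise_bound_dominates:
  assumes "n \<ge> 1" "set_pmf prior = {0..n}" "\<gamma> > 0" "T = \<gamma> / (1 + \<gamma>)" "e > 0" and M: "M \<subseteq> {1..n}"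
  shows "a * (\<Sum>i\<in>M. (z i)\<^sup>2) - npen n \<gamma> prior (card M) \<le> noise_bound n \<gamma> prior a e T eps z"
proof (cases "card M = 0")
  case True
  then have "M = {}" using M finite_subset by (metis card_eq_0_iff finite_atLeastAtMost)
  then show ?thesis
    using npen_zero_nonneg[OF assms(1-4)] noise_bound_nonneg[OF T_bounds(1,2)[OF assms(1-4)] assms(5), of n \<gamma> prior a eps z]
    by simp
next
  case False
  let ?x = "a * (\<Sum>i\<in>M. (z i)\<^sup>2) - npen n \<gamma> prior (card M)"
  note T = T_bounds(1,2)[OF assms(1-4)]
  have cM: "card M \<in> {1..n}" using False card_mono[OF _ M] by auto
  let ?S = "{M. M \<subseteq> {1..n} \<and> 1 \<le> card M}"
  have finS: "finite ?S" by (rule finite_subset[of _ "Pow {1..n}"]) auto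
  let ?f = "\<lambda>M. small_term n \<gamma> prior a e T eps M z" and ?g = "\<lambda>k. large_term n a T eps k z"
  note f0 = small_term_nonneg[OF T(1) assms(5)] and g0 = large_term_nonneg[OF _ T]
  have sums: "0 \<le> sum ?f ?S" "0 \<le> sum ?g {1..n}" by (intro sum_nonneg f0 g0; assumption)+
  show ?thesis
  proof (cases "real (card M) / real n \<le> eps")
    case True
    have "?x \<le> ?f M"
      using True le_exp_scaled[of "(1 + e) * T / 2" ?x] T assms(5) by (simp add: small_term_def)
    also have "\<dots> \<le> sum ?f ?S" using M cM f0 finS by (intro member_le_sum) auto
    finally show ?thesis unfolding noise_bound_def using sums by linarith
  next
    case False
    have "?x \<le> exp (T / 4 * ?x) / (T / 4)" using T by (intro le_exp_scaled) simp
    also have "\<dots> \<le> (sqrt (real n + 1) * (\<Prod>i=1..n. sqrt (tilted a T (real (card M) / real n) (z i)))) / (T / 4)"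
      using tilted_product_bound[OF assms(1-4) M, of a z] cM T by (intro divide_right_mono) auto
    also have "\<dots> = ?g (card M)" using False by (simp add: large_term_def)
    also have "\<dots> \<le> sum ?g {1..n}" using cM g0 by (intro member_le_sum) auto
    finally show ?thesis unfolding noise_bound_def using sums by linarith
  qed
qed

lemma ennreal_two_sums:
  fixes f :: "'b \<Rightarrow> real" and g :: "'c \<Rightarrow> real"
  assumes "\<And>i. i \<in> A \<Longrightarrow> 0 \<le> f i" "\<And>j. j \<in> B \<Longrightarrow> 0 \<le> g j"
  shows "(\<Sum>i\<in>A. ennreal (f i)) + (\<Sum>j\<in>B. ennreal (g j)) = ennreal ((\<Sum>i\<in>A. f i) + (\<Sum>j\<in>B. g j))"
  using assms by (simp add: sum_ennreal ennreal_plus sum_nonneg)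

lemma nn_integral_two_sums:
  fixes f :: "'b \<Rightarrow> 'a \<Rightarrow> real" and g :: "'c \<Rightarrow> 'a \<Rightarrow> real"
  assumes "\<And>i z. i \<in> A \<Longrightarrow> 0 \<le> f i z" "\<And>j z. j \<in> B \<Longrightarrow> 0 \<le> g j z"
    and "\<And>i. i \<in> A \<Longrightarrow> f i \<in> borel_measurable N" "\<And>j. j \<in> B \<Longrightarrow> g j \<in> borel_measurable N"
  shows "(\<integral>\<^sup>+z. ennreal ((\<Sum>i\<in>A. f i z) + (\<Sum>j\<in>B. g j z)) \<partial>N)
    = (\<Sum>i\<in>A. \<integral>\<^sup>+z. ennreal (f i z) \<partial>N) + (\<Sum>j\<in>B. \<integral>\<^sup>+z. ennreal (g j z) \<partial>N)"
proof -
  have "(\<integral>\<^sup>+z. ennreal ((\<Sum>i\<in>A. f i z) + (\<Sum>j\<in>B. g j z)) \<partial>N)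
    = (\<integral>\<^sup>+z. (\<Sum>i\<in>A. ennreal (f i z)) + (\<Sum>j\<in>B. ennreal (g j z)) \<partial>N)"
    using assms(1,2) by (intro nn_integral_cong) (simp add: sum_ennreal ennreal_plus sum_nonneg)
  also have "\<dots> = (\<integral>\<^sup>+z. (\<Sum>i\<in>A. ennreal (f i z)) \<partial>N) + (\<integral>\<^sup>+z. (\<Sum>j\<in>B. ennreal (g j z)) \<partial>N)"
    using assms(3,4) by (intro nn_integral_add borel_measurable_sum measurable_compose[OF _ measurable_ennreal])
  finally show ?thesis
    using assms(3,4) by (simp add: nn_integral_sum measurable_compose[OF _ measurable_ennreal])
qed

text \<open>In the first sum, \<open>n choose k\<close> sets carry
  \<open>pmf prior k / (n choose k)\<close> each, which adds up to the prior mass off zero. In the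
  second, independence turns the product into the \<open>n\<close>-th power of a one-dimensional
  mean that is at most \<open>rho\<close>.\<close>

lemma expectation_noise_bound_le:
  assumes ass: "n \<ge> 1" "set_pmf prior = {0..n}" "\<gamma> > 0" "T = \<gamma> / (1 + \<gamma>)"
    and e: "e > 0" and a: "1 \<le> a" "a \<le> 2" "a * (1 + e) * T \<le> 1 - d" and d: "d > 0"
    and eps: "eps = d powr (1 / (2 * e))"
    and rho: "0 \<le> rho" "\<And>r. eps < r \<Longrightarrow> r \<le> 1 \<Longrightarrow> gauss_mean (\<lambda>x. sqrt (tilted a T r x)) \<le> ennreal rho"
  shows "noise_mean n (\<lambda>z. noise_bound n \<gamma> prior a e T eps z)
    \<le> ennreal (4 / T * ((1 - pmf prior 0) + (real n + 1)\<^sup>2 * rho ^ n))"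
proof -
  note T = T_bounds(1,2)[OF ass]
  let ?S = "{M. M \<subseteq> {1..n} \<and> 1 \<le> card M}"
  let ?th = "(1 + e) * T / 2"
  let ?F = "\<lambda>k. 1 / ?th * (pmf prior k / real (n choose k))" and ?B = "4 / T * ((real n + 1) * rho ^ n)"
  have th: "?th > 0" using T e by simp
  let ?f = "small_term n \<gamma> prior a e T eps" and ?g = "large_term n a T eps"
  have If: "noise_mean n (?f M) \<le> ennreal (?F (card M))"
    if M: "M \<in> ?S" for M
  proof (cases "real (card M) / real n \<le> eps")
    case True
    from M have M': "M \<subseteq> {1..n}" "1 \<le> card M" by auto
    let ?E = "\<lambda>z. exp (?th * (a * (\<Sum>i\<in>M. (z i)\<^sup>2) - npen n \<gamma> prior (card M)))"
    note [measurable] = measurable_sum_squares[OF M'(1)]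
    have "noise_mean n (?f M) = (\<integral>\<^sup>+z. ennreal (1 / ?th) * ennreal (?E z) \<partial>noise_law n)"
      using True th by (intro nn_integral_cong, subst ennreal_mult'[symmetric]) (auto simp: small_term_def)
    also have "\<dots> = ennreal (1 / ?th) * noise_mean n ?E"
      by (rule nn_integral_cmult) measurable
    also have "\<dots> \<le> ennreal (1 / ?th) * ennreal (pmf prior (card M) / real (n choose card M))"
      using chernoff_small_subset[OF ass e a(3) d M' True[unfolded eps]] by (rule mult_left_mono) simp
    finally show ?thesis using th by (simp add: ennreal_mult'[symmetric])
  next
    case False
    then show ?thesis by (simp add: small_term_def)
  qed
  have Ig: "noise_mean n (?g k) \<le> ennreal ?B"
    if k: "k \<in> {1..n}" for k
  proof (cases "eps < real k / real n")
    case True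
    let ?r = "real k / real n"
    have r: "0 \<le> ?r" "?r \<le> 1" using k by (auto simp: divide_le_eq)
    have t0: "0 \<le> tilted a T ?r x" for x using tilted_nonneg[OF r] T by simp
    have "noise_mean n (?g k)
      = (\<integral>\<^sup>+z. ennreal (4 / T * sqrt (real n + 1)) * (\<Prod>i=1..n. ennreal (sqrt (tilted a T ?r (z i)))) \<partial>noise_law n)"
      using True T t0
      by (intro nn_integral_cong, subst prod_ennreal) (auto simp: large_term_def ennreal_mult'[symmetric] ac_simps)
    also have "\<dots> = ennreal (4 / T * sqrt (real n + 1)) * (\<integral>\<^sup>+z. (\<Prod>i=1..n. ennreal (sqrt (tilted a T ?r (z i)))) \<partial>noise_law n)"
      unfolding tilted_def by (rule nn_integral_cmult) measurable
    also have "(\<integral>\<^sup>+z. (\<Prod>i=1..n. ennreal (sqrt (tilted a T ?r (z i)))) \<partial>noise_law n)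
      = gauss_mean (\<lambda>x. sqrt (tilted a T ?r x)) ^ n"
      unfolding tilted_def by (subst nn_integral_noise_prod) auto
    also have "ennreal (4 / T * sqrt (real n + 1)) * gauss_mean (\<lambda>x. sqrt (tilted a T ?r x)) ^ n
      \<le> ennreal (4 / T * (real n + 1)) * ennreal rho ^ n"
    proof (intro mult_mono power_mono rho(2) True r ennreal_leI mult_left_mono)
      have "sqrt (real n + 1) \<le> sqrt ((real n + 1)\<^sup>2)"
        by (intro real_sqrt_le_mono) (simp add: power2_eq_square)
      then show "sqrt (real n + 1) \<le> real n + 1" by simp
    qed (use T in auto)
    also have "\<dots> = ennreal ?B"
      using rho(1) T by (simp add: ennreal_power ennreal_mult'[symmetric] ac_simps)
    finally show ?thesis .
  next
    case False
    then show ?thesis using T rho(1) by (simp add: large_term_def)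
  qed
  have p0: "0 \<le> 1 - pmf prior 0" by (simp add: pmf_le_1)
  have "noise_mean n (\<lambda>z. noise_bound n \<gamma> prior a e T eps z)
    = (\<Sum>M\<in>?S. \<integral>\<^sup>+z. ennreal (?f M z) \<partial>noise_law n) + (\<Sum>k=1..n. \<integral>\<^sup>+z. ennreal (?g k z) \<partial>noise_law n)"
    unfolding noise_bound_def by (rule nn_integral_two_sums)
      (use small_term_nonneg[OF T(1) e] large_term_nonneg[OF _ T] measurable_small_term measurable_large_term in auto)
  also have "\<dots> \<le> (\<Sum>M\<in>?S. ennreal (?F (card M)))
     + (\<Sum>k=1..n. ennreal (?B))"
    using If Ig by (intro add_mono sum_mono) auto
  also have "\<dots> = ennreal ((\<Sum>M\<in>?S. ?F (card M))
     + (\<Sum>k=1..n. ?B))"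
  proof (rule ennreal_two_sums)
    have nn: "0 \<le> ?F (card M)" "0 \<le> ?B" for M
      using T th rho(1) by auto
    show "0 \<le> ?F (card M)" for M by (rule nn)
    show "0 \<le> ?B" by (rule nn)
  qed
  also have "\<dots> \<le> ennreal (4 / T * ((1 - pmf prior 0) + (real n + 1)\<^sup>2 * rho ^ n))"
  proof (rule ennreal_leI)
    have "(\<Sum>M\<in>?S. ?F (card M))
      = (\<Sum>k=1..n. real (n choose k) * (?F k))"
      by (rule sum_subsets_by_card)
    also have "\<dots> = (\<Sum>k=1..n. 1 / ?th * pmf prior k)"
      by (intro sum.cong) (auto simp: zero_less_binomial_iff)
    also have "\<dots> = 1 / ?th * (1 - pmf prior 0)"
      by (simp only: sum_distrib_left[symmetric] prior_sum[OF ass])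
    also have "\<dots> \<le> 4 / T * (1 - pmf prior 0)"
    proof (rule mult_right_mono[OF _ p0])
      have "T / 4 \<le> T / 2 + e * T / 2" using T mult_pos_pos[OF e T(1)] by linarith
      then have "1 / ?th \<le> 1 / (T / 4)" using T e by (intro frac_le) (auto simp: field_simps)
      then show "1 / ?th \<le> 4 / T" by simp
    qed
    finally have 1: "(\<Sum>M\<in>?S. ?F (card M)) \<le> 4 / T * (1 - pmf prior 0)" .
    have "(\<Sum>k=1..n. ?B) = 4 / T * (real n * (real n + 1) * rho ^ n)" by simp
    also have "\<dots> \<le> 4 / T * ((real n + 1)\<^sup>2 * rho ^ n)"
      using T rho(1) by (intro mult_left_mono mult_right_mono) (auto simp: power2_eq_square)
    finally show "(\<Sum>M\<in>?S. ?F (card M))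
      + (\<Sum>k=1..n. ?B) \<le> 4 / T * ((1 - pmf prior 0) + (real n + 1)\<^sup>2 * rho ^ n)"
      using 1 by (simp add: distrib_left)
  qed
  finally show ?thesis .
qed

text \<open>One \<open>H\<close> bounds all sets \<open>M\<close> for every \<open>z\<close>, so the
  data-dependent kept set may be inserted for \<open>M\<close>.\<close>

definition noise_envelope ::
  "nat \<Rightarrow> real \<Rightarrow> nat pmf \<Rightarrow> real \<Rightarrow> ((nat \<Rightarrow> real) \<Rightarrow> real) \<Rightarrow> bool" where
  "noise_envelope n \<gamma> prior a H \<longleftrightarrow> H \<in> borel_measurable (vec_space n) \<and> (\<forall>z. 0 \<le> H z)
     \<and> (\<forall>z M. M \<subseteq> {1..n} \<longrightarrow> a * (\<Sum>i\<in>M. (z i)\<^sup>2) - npen n \<gamma> prior (card M) \<le> H z)"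

text \<open>The constants are chosen before \<open>n\<close>, \<open>\<gamma>\<close> and the prior.
  Since \<open>T\<close> is increasing in \<open>\<gamma>\<close>, it stays in
  \<open>[T1, T2]\<close>; \<open>T2\<close> limits the exponential moments and \<open>T1\<close>
  the concavity gain.\<close>

lemma noise_control:
  fixes g1 g2 :: real
  assumes g: "0 < g1" "0 < g2"
  obtains a C rho where "1 < a" "a \<le> 2" "0 < C" "0 < rho" "rho < 1"
    and "\<And>n \<gamma> prior. \<lbrakk>n \<ge> 1; set_pmf prior = {0..n}; g1 \<le> \<gamma>; \<gamma> \<le> g2\<rbrakk> \<Longrightarrow>
      \<exists>H. noise_envelope n \<gamma> prior a H
        \<and> noise_mean n H \<le> ennreal (C * ((1 - pmf prior 0) + (real n + 1)\<^sup>2 * rho ^ n))"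
proof -
  define T1 where "T1 = g1 / (1 + g1)"
  define T2 where "T2 = g2 / (1 + g2)"
  \<comment> \<open>With \<open>4 * e = 1 - T2\<close> one gets
    \<open>(1 + e)\<^sup>2 * T2 \<le> T2 + 3 * e < 1\<close>, hence \<open>d > 0\<close>;
    \<open>eps\<close> is then the size limit of \<open>chernoff_small_subset\<close>.\<close>
  define e where "e = (1 - T2) / 4"
  define d where "d = 1 - (1 + e)\<^sup>2 * T2"
  define eps where "eps = d powr (1 / (2 * e))"
  \<comment> \<open>The deviation of \<open>tilted_le_near_zero\<close> in the worst case
    \<open>r = eps\<close>, \<open>T = T1\<close>; \<open>q\<close> is the resulting gain.\<close>
  define \<delta> where "\<delta> = eps * (1 - (1 - T1) powr (1/4))"
  define q where "q = \<delta>\<^sup>2 / 8 * std_normal_density (1/2)"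
  \<comment> \<open>\<open>a \<le> 1 + e\<close> serves the small sets. For the large ones
    \<open>a - 1 \<le> d * q\<close> keeps the excess caused by \<open>a > 1\<close> below
    \<open>q / 2\<close>, half of the gain, which leaves \<open>1 - q / 2\<close>. The maximum with
    \<open>1/2\<close> keeps \<open>rho\<close> positive.\<close>
  define a where "a = 1 + min e (d * q)"
  define rho where "rho = max (1/2) (1 - q / 2)"
  have T1: "0 < T1" "T1 < 1" and T2: "0 < T2" "T2 < 1" using g by (auto simp: T1_def T2_def)
  have e: "0 < e" "e \<le> 1" using T2 by (auto simp: e_def)
  have d: "0 < d"
  proof -
    have "(1 + e)\<^sup>2 \<le> 1 + 3 * e"
      using e mult_left_mono[of e 1 e] by (simp add: power2_eq_square algebra_simps)
    then have "(1 + e)\<^sup>2 * T2 \<le> (1 + 3 * e) * T2" using T2 by (intro mult_right_mono) auto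
    also have "\<dots> = T2 + 3 * e * T2" by (simp add: algebra_simps)
    also have "\<dots> \<le> T2 + 3 * e * 1" using T2 e by (intro add_left_mono mult_left_mono) auto
    also have "\<dots> < 1" using T2 by (simp add: e_def field_simps)
    finally show ?thesis by (simp add: d_def)
  qed
  have eps: "0 < eps" using d by (simp add: eps_def)
  have "(1 - T1) powr (1/4) < 1 powr (1/4)" using T1 by (intro powr_less_mono2) auto
  then have s1: "0 < 1 - (1 - T1) powr (1/4)" by simp
  then have \<delta>: "0 < \<delta>" using eps by (simp add: \<delta>_def)
  then have q: "0 < q" by (auto simp: q_def intro!: mult_pos_pos normal_density_pos)
  have a: "1 < a" "a \<le> 1 + e" "a - 1 \<le> d * q" using e d q by (auto simp: a_def)
  have rho: "0 < rho" "rho < 1" "1 - q / 2 \<le> rho" using q by (auto simp: rho_def)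
  show ?thesis
  proof (rule that[of a "4 / T1" rho])
    show "1 < a" "a \<le> 2" "0 < 4 / T1" "0 < rho" "rho < 1" using a e T1 rho by auto
    fix n :: nat and \<gamma> :: real and prior :: "nat pmf"
    assume n: "n \<ge> 1" and prior: "set_pmf prior = {0..n}" and \<gamma>: "g1 \<le> \<gamma>" "\<gamma> \<le> g2"
    define T where "T = \<gamma> / (1 + \<gamma>)"
    have \<gamma>0: "0 < \<gamma>" using \<gamma> g by simp
    note ass = n prior \<gamma>0 T_def
    note Tb = T_bounds(1,2)[OF ass]
    have T1T: "T1 \<le> T" and TT2: "T \<le> T2"
      using \<gamma> g \<gamma>0 by (auto simp: T1_def T2_def T_def field_simps)
    have aT: "a * (1 + e) * T \<le> 1 - d"
    proof -
      have "a * (1 + e) * T \<le> (1 + e) * (1 + e) * T2"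
        using a e TT2 Tb by (intro mult_mono) auto
      then show ?thesis by (simp add: d_def power2_eq_square)
    qed
    have aT': "a * T \<le> 1 - d"
    proof -
      have "a * 1 * T \<le> a * (1 + e) * T" using a e Tb by (intro mult_right_mono mult_left_mono) auto
      then show ?thesis using aT by simp
    qed
    have rho_bound: "gauss_mean (\<lambda>x. sqrt (tilted a T r x)) \<le> ennreal rho" if r: "eps < r" "r \<le> 1" for r
    proof -
      define u where "u = (1 - T) / (1 - a * T)"
      have r0: "0 \<le> r" using r eps by simp
      have den: "0 < 1 - a * T" using aT' d by simp
      have u_eq: "u = 1 + (a - 1) * T / (1 - a * T)" using den by (simp add: u_def field_simps)
      have "(a - 1) * T / (1 - a * T) \<le> (a - 1) * 1 / d"
        using a Tb aT' d by (intro frac_le mult_left_mono) auto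
      also have "\<dots> \<le> q" using a(3) d by (simp add: divide_le_eq mult.commute)
      finally have uq: "u \<le> 1 + q" by (simp add: u_eq)
      have u1: "1 \<le> u" using a Tb den by (simp add: u_eq)
      then have "sqrt u \<le> sqrt (u\<^sup>2)" by (intro real_sqrt_le_mono) (simp add: power2_eq_square)
      then have su: "sqrt u \<le> u" using u1 by simp
      have "(sqrt u - 1) * r \<le> (sqrt u - 1) * 1" using r u1 by (intro mult_left_mono) auto
      also have "\<dots> \<le> q" using su uq by simp
      finally have 1: "(sqrt u - 1) * r / 2 \<le> q / 2" by simp
      have "(1 - T) powr (1/4) \<le> (1 - T1) powr (1/4)" using T1T Tb by (intro powr_mono2) auto
      then have "\<delta> \<le> r * (1 - (1 - T) powr (1/4))"
        unfolding \<delta>_def using r eps s1 by (intro mult_mono) auto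
      then have "\<delta>\<^sup>2 \<le> (r * (1 - (1 - T) powr (1/4)))\<^sup>2" using \<delta> by (intro power_mono) auto
      then have 2: "q \<le> (r * (1 - (1 - T) powr (1/4)))\<^sup>2 / 8 * std_normal_density (1/2)"
        unfolding q_def by (intro mult_right_mono) auto
      have "gauss_mean (\<lambda>x. sqrt (tilted a T r x))
        \<le> ennreal (1 + (sqrt u - 1) * r / 2 - (r * (1 - (1 - T) powr (1/4)))\<^sup>2 / 8 * std_normal_density (1/2))"
        unfolding u_def using gauss_sqrt_tilted_le[OF r0 r(2) Tb, of a] a e den by simp
      also have "\<dots> \<le> ennreal rho" using 1 2 rho(3) by (intro ennreal_leI) linarith
      finally show ?thesis .
    qed
    let ?H = "noise_bound n \<gamma> prior a e T eps"
    have "noise_mean n ?H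
      \<le> ennreal (4 / T * ((1 - pmf prior 0) + (real n + 1)\<^sup>2 * rho ^ n))"
      using a e rho by (intro expectation_noise_bound_le[OF ass e(1) _ _ aT d eps_def _ rho_bound]) auto
    also have "\<dots> \<le> ennreal (4 / T1 * ((1 - pmf prior 0) + (real n + 1)\<^sup>2 * rho ^ n))"
      using T1T T1 Tb rho by (intro ennreal_leI mult_right_mono divide_left_mono) (auto simp: pmf_le_1)
    finally show "\<exists>H. noise_envelope n \<gamma> prior a H
        \<and> noise_mean n H \<le> ennreal (4 / T1 * ((1 - pmf prior 0) + (real n + 1)\<^sup>2 * rho ^ n))"
      using noise_bound_nonneg[OF Tb e(1)] noise_bound_dominates[OF ass e(1)] measurable_noise_bound
      unfolding noise_envelope_def by (intro exI[of _ ?H]) blast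
  qed
qed

section \<open>Risk of the MAP estimator\<close>

text \<open>Indices are sorted instead of values, so the order statistics become absolute values
  along a permutation.\<close>

lemma ord_abs_permutation:
  "\<exists>s. bij_betw s {1..n} {1..n} \<and> (\<forall>i\<in>{1..n}. ord_abs n y i = \<bar>y (s i)\<bar>)
    \<and> (\<forall>i j. 1 \<le> i \<longrightarrow> i \<le> j \<longrightarrow> j \<le> n \<longrightarrow> \<bar>y (s j)\<bar> \<le> \<bar>y (s i)\<bar>)"
proof -
  define f where "f j = \<bar>y j\<bar>" for j
  define S where "S = sort_key f [1..<Suc n]"
  define J where "J = rev S"
  have "sort (map f [1..<Suc n]) = map f S"
    unfolding S_def by (rule properties_for_sort) auto
  then have ord: "ord_abs n y i = (map f J) ! (i - 1)" for i
    unfolding ord_abs_def J_def f_def[abs_def, symmetric] by (simp add: rev_map)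
  have len: "length J = n" by (simp add: J_def S_def)
  have dist: "distinct J" by (simp add: J_def S_def)
  have set: "set J = {1..n}" by (auto simp: J_def S_def)
  have sorted: "sorted (rev (map f J))" unfolding J_def S_def by (simp add: rev_map)
  \<comment> \<open>Ranks start at 1, list positions at 0.\<close>
  define s where "s i = J ! (i - 1)" for i
  show ?thesis
  proof (intro exI[of _ s] conjI ballI allI impI)
    have inj: "inj_on s {1..n}"
      using dist len by (auto simp: inj_on_def s_def nth_eq_iff_index_eq)
    have "s i \<in> {1..n}" if "i \<in> {1..n}" for i
      unfolding s_def set[symmetric] using that len by (intro nth_mem) auto
    then have "s ` {1..n} \<subseteq> {1..n}" by blast
    then have "s ` {1..n} = {1..n}" using inj by (intro card_subset_eq) (auto simp: card_image)
    then show "bij_betw s {1..n} {1..n}" using inj by (simp add: bij_betw_def)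
    show "ord_abs n y i = \<bar>y (s i)\<bar>" if "i \<in> {1..n}" for i
    proof -
      have "i - 1 < length J" using that len by auto
      then show ?thesis by (simp add: ord s_def f_def)
    qed
    show "\<bar>y (s j)\<bar> \<le> \<bar>y (s i)\<bar>" if "1 \<le> i" "i \<le> j" "j \<le> n" for i j
    proof -
      have "i - 1 \<le> j - 1" "j - 1 < length J" "i - 1 < length J" using that len by auto
      then show ?thesis using sorted_rev_nth_mono[OF sorted, of "i - 1" "j - 1"] by (simp add: s_def f_def)
    qed
  qed
qed

text \<open>\<open>D - B\<close> and \<open>B - D\<close> have equally many elements, and
  \<open>v\<close> separates their values.\<close>

lemma sum_le_of_threshold:
  fixes g :: "'a \<Rightarrow> real"
  assumes fin: "finite B" "finite D" and "card B = card D"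
    and D: "\<And>d. d \<in> D - B \<Longrightarrow> g d \<le> v" and B: "\<And>b. b \<in> B - D \<Longrightarrow> v \<le> g b"
  shows "sum g D \<le> sum g B"
proof -
  have "card (D - B) = card (B - D)"
    using assms(3) card_Int_Diff[OF fin(1), of D] card_Int_Diff[OF fin(2), of B] by (simp add: Int_commute)
  have "sum g D = sum g (D \<inter> B) + sum g (D - B)" using fin by (simp add: sum.Int_Diff[of D g B])
  also have "sum g (D - B) \<le> real (card (D - B)) * v" using D by (rule sum_bounded_above)
  also have "real (card (D - B)) * v = real (card (B - D)) * v" using \<open>card (D - B) = _\<close> by simp
  also have "\<dots> \<le> sum g (B - D)" using B by (rule sum_bounded_below)
  also have "sum g (D \<inter> B) + sum g (B - D) = sum g B"
    using fin by (simp add: sum.Int_Diff[of B g D] Int_commute)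
  finally show ?thesis by simp
qed

text \<open>The coordinates where the estimator copies the data. The guard
  \<open>k \<noteq> 0\<close> matters: \<open>ord_abs n y 0\<close> reads list position
  \<open>0 - 1 = 0\<close>, the largest entry, so the maximal coordinate would otherwise be
  kept.\<close>

definition kept :: "nat \<Rightarrow> (nat \<Rightarrow> real) \<Rightarrow> nat \<Rightarrow> nat set" where
  "kept n y k = {i \<in> {1..n}. k \<noteq> 0 \<and> ord_abs n y k \<le> \<bar>y i\<bar>}"

text \<open>Among sets of one size the penalty is constant and the residual is least when the
  largest entries are kept. Minimizing over sizes is therefore minimizing over all subsets.\<close>

lemma kept_minimal:
  assumes "is_arg_min (map_criterion n \<sigma> \<gamma> prior y) (\<lambda>k. k \<in> {0..n}) k"
    and inj: "inj_on (\<lambda>i. \<bar>y i\<bar>) {1..n}" and M: "M \<subseteq> {1..n}"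
  shows "(\<Sum>i\<in>{1..n} - kept n y k. (y i)\<^sup>2) + penalty n \<sigma> \<gamma> prior (card (kept n y k))
    \<le> (\<Sum>i\<in>{1..n} - M. (y i)\<^sup>2) + penalty n \<sigma> \<gamma> prior (card M)"
proof -
  obtain s where s: "bij_betw s {1..n} {1..n}"
    and ord: "\<And>i. i \<in> {1..n} \<Longrightarrow> ord_abs n y i = \<bar>y (s i)\<bar>"
    and mono: "\<And>i j. 1 \<le> i \<Longrightarrow> i \<le> j \<Longrightarrow> j \<le> n \<Longrightarrow> \<bar>y (s j)\<bar> \<le> \<bar>y (s i)\<bar>"
    using ord_abs_permutation[of n y] by blast
  have k: "k \<le> n" using assms(1) by (simp add: is_arg_min_def)
  have s_inj: "inj_on s {1..n}" and s_img: "s ` {1..n} = {1..n}" using s by (auto simp: bij_betw_def)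
  have split: "{1..n} - s ` {1..k} = s ` {k+1..n}" if "k \<le> n" for k
  proof -
    have "{1..n} - s ` {1..k} = s ` {1..n} - s ` {1..k}" by (simp only: s_img)
    also have "\<dots> = s ` ({1..n} - {1..k})" using that by (intro inj_on_image_set_diff[OF s_inj, symmetric]) auto
    also have "{1..n} - {1..k} = {k+1..n}" by auto
    finally show ?thesis .
  qed
  have tail: "(\<Sum>i=k+1..n. (ord_abs n y i)\<^sup>2) = (\<Sum>i\<in>s ` {k+1..n}. (y i)\<^sup>2)" for k
  proof -
    have "inj_on s {k+1..n}" by (rule inj_on_subset[OF s_inj]) auto
    then show ?thesis using ord by (subst sum.reindex) (auto intro!: sum.cong)
  qed
  have kept: "kept n y k = s ` {1..k}"
  proof (cases "k = 0")
    case True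
    then show ?thesis by (simp add: kept_def)
  next
    case False
    have *: "\<bar>y (s k)\<bar> \<le> \<bar>y (s j)\<bar> \<longleftrightarrow> j \<le> k" if j: "j \<in> {1..n}" for j
    proof
      assume le: "\<bar>y (s k)\<bar> \<le> \<bar>y (s j)\<bar>"
      show "j \<le> k"
      proof (rule ccontr)
        assume "\<not> j \<le> k"
        then have "\<bar>y (s j)\<bar> = \<bar>y (s k)\<bar>" using mono[of k j] False j le by simp
        moreover have "s j \<in> {1..n}" "s k \<in> {1..n}" using s_img j k False by auto
        ultimately have "s j = s k" using inj unfolding inj_on_def by blast
        moreover have "k \<in> {1..n}" using k False by simp
        ultimately have "j = k" using s_inj j unfolding inj_on_def by blast
        then show False using \<open>\<not> j \<le> k\<close> by simp
      qed
    next
      assume "j \<le> k" then show "\<bar>y (s k)\<bar> \<le> \<bar>y (s j)\<bar>" using mono[of j k] j k by simp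
    qed
    have "kept n y k = {i \<in> s ` {1..n}. \<bar>y (s k)\<bar> \<le> \<bar>y i\<bar>}"
      unfolding kept_def s_img using False ord[of k] k by auto
    also have "\<dots> = s ` {1..k}" using * k by auto
    finally show ?thesis .
  qed
  have card_kept: "card (kept n y k) = k"
    unfolding kept using k by (subst card_image) (auto intro: inj_on_subset[OF s_inj])
  have cM: "card M \<le> n" using card_mono[OF _ M] by simp
  have "(\<Sum>i\<in>s ` {card M+1..n}. (y i)\<^sup>2) \<le> (\<Sum>i\<in>{1..n} - M. (y i)\<^sup>2)"
  \<comment> \<open>The separating value is the entry of rank \<open>card M\<close>, which exists
    only from rank 1 on.\<close>
  proof (cases "card M = 0")
    case True
    then have "M = {}" using M finite_subset by (metis card_eq_0_iff finite_atLeastAtMost)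
    then show ?thesis using s_img by simp
  next
    case False
    show ?thesis
    proof (rule sum_le_of_threshold[where v = "(y (s (card M)))\<^sup>2"])
      have "card (s ` {card M+1..n}) = n - card M"
        by (subst card_image) (auto intro: inj_on_subset[OF s_inj])
      moreover have "card ({1..n} - M) = n - card M"
        using M finite_subset[OF M] by (simp add: card_Diff_subset)
      ultimately show "card ({1..n} - M) = card (s ` {card M+1..n})" by simp
      show "(y d)\<^sup>2 \<le> (y (s (card M)))\<^sup>2" if "d \<in> s ` {card M+1..n} - ({1..n} - M)" for d
        using that mono[of "card M"] False by (auto simp: abs_le_square_iff[symmetric])
      fix b assume b: "b \<in> {1..n} - M - s ` {card M+1..n}"
      then have "b \<in> {1..n} - ({1..n} - s ` {1..card M})" using split[OF cM] by auto
      then show "(y (s (card M)))\<^sup>2 \<le> (y b)\<^sup>2"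
        using mono[of _ "card M"] cM by (auto simp: abs_le_square_iff[symmetric])
    qed auto
  qed
  moreover have "map_criterion n \<sigma> \<gamma> prior y k \<le> map_criterion n \<sigma> \<gamma> prior y (card M)"
    using assms(1) cM by (auto simp: is_arg_min_def not_less)
  ultimately show ?thesis
    unfolding card_kept unfolding map_criterion_def tail kept split[OF k] by simp
qed

lemma map_estimator_loss:
  "(\<Sum>i=1..n. (map_estimator n khat y i - \<mu> i)\<^sup>2)
    = (\<Sum>i\<in>kept n y (khat y). (y i - \<mu> i)\<^sup>2) + (\<Sum>i\<in>{1..n} - kept n y (khat y). (\<mu> i)\<^sup>2)"
proof -
  let ?K = "kept n y (khat y)"
  have K: "?K \<subseteq> {1..n}" by (auto simp: kept_def)
  have "(\<Sum>i=1..n. (map_estimator n khat y i - \<mu> i)\<^sup>2)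
    = (\<Sum>i=1..n. if i \<in> ?K then (y i - \<mu> i)\<^sup>2 else (\<mu> i)\<^sup>2)"
    by (intro sum.cong) (auto simp: map_estimator_def kept_def)
  also have "\<dots> = (\<Sum>i\<in>{1..n} \<inter> ?K. (y i - \<mu> i)\<^sup>2) + (\<Sum>i\<in>{1..n} \<inter> - ?K. (\<mu> i)\<^sup>2)"
    by (simp add: sum.If_cases)
  finally show ?thesis using K by (simp add: Int_absorb1 Diff_eq)
qed

text \<open>The common part \<open>I - K - M\<close> cancels. On \<open>M - K\<close> the signal
  survives through \<open>\<mu>\<^sup>2 / 2 - w\<^sup>2 \<le> (\<mu> + w)\<^sup>2\<close>; on
  \<open>K - M\<close> the cross term is absorbed by \<open>(\<mu> + w)\<^sup>2 \<le> (1 + eps) *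
  w\<^sup>2 + (1 + 1 / eps) * \<mu>\<^sup>2\<close>. One \<open>eps\<close> in the factor
  \<open>1 + 2 * eps\<close> pays for the latter; the other remains on the left as
  \<open>eps\<close> times the loss on \<open>K\<close>, whence the factor
  \<open>1 / eps\<close>.\<close>

lemma penalized_loss_bound:
  fixes \<mu> w :: "'a \<Rightarrow> real"
  assumes fin: "finite I" and K: "K \<subseteq> I" and M: "M \<subseteq> I" and eps: "0 < eps" "eps \<le> 1/2"
    and min: "(\<Sum>i\<in>I - K. (\<mu> i + w i)\<^sup>2) + PK \<le> (\<Sum>i\<in>I - M. (\<mu> i + w i)\<^sup>2) + PM"
    and N: "(1 + 2 * eps) * (\<Sum>i\<in>K. (w i)\<^sup>2) - PK \<le> N"
  shows "(\<Sum>i\<in>K. (w i)\<^sup>2) + (\<Sum>i\<in>I - K. (\<mu> i)\<^sup>2)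
    \<le> 1 / eps * (N + (\<Sum>i\<in>M. (w i)\<^sup>2) + (2 + 1 / eps) * (\<Sum>i\<in>I - M. (\<mu> i)\<^sup>2) + PM)"
proof -
  let ?W = "\<lambda>A. \<Sum>i\<in>A. (w i)\<^sup>2" and ?U = "\<lambda>A. \<Sum>i\<in>A. (\<mu> i)\<^sup>2" and ?Y = "\<lambda>A. \<Sum>i\<in>A. (\<mu> i + w i)\<^sup>2"
  have finK: "finite K" and finM: "finite M" using K M fin finite_subset by blast+
  have "?Y (I - K) = ?Y (M - K) + ?Y (I - K - M)"
    using K M fin by (subst sum.union_disjoint[symmetric]) (auto intro!: sum.cong intro: finite_subset)
  moreover have "?Y (I - M) = ?Y (K - M) + ?Y (I - K - M)"
    using K M fin by (subst sum.union_disjoint[symmetric]) (auto intro!: sum.cong intro: finite_subset)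
  ultimately have 1: "?Y (M - K) + PK \<le> ?Y (K - M) + PM" using min by simp
  have 2: "1/2 * ?U (M - K) - ?W M \<le> ?Y (M - K)"
  proof -
    have "1/2 * (\<mu> i)\<^sup>2 - (w i)\<^sup>2 \<le> (\<mu> i + w i)\<^sup>2" for i
    proof -
      have "(\<mu> i + w i)\<^sup>2 - (1/2 * (\<mu> i)\<^sup>2 - (w i)\<^sup>2) = 1/2 * (\<mu> i + 2 * w i)\<^sup>2"
        by (simp add: power2_eq_square algebra_simps)
      also have "\<dots> \<ge> 0" by simp
      finally show ?thesis by simp
    qed
    then have "(\<Sum>i\<in>M - K. 1/2 * (\<mu> i)\<^sup>2 - (w i)\<^sup>2) \<le> ?Y (M - K)" by (intro sum_mono)
    moreover have "?W (M - K) \<le> ?W M" using finM by (intro sum_mono2) auto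
    ultimately show ?thesis by (simp add: sum_subtractf sum_distrib_left)
  qed
  have 3: "?Y (K - M) \<le> (1 + eps) * ?W K + (1 + 1 / eps) * ?U (I - M)"
  proof -
    have "(\<mu> i + w i)\<^sup>2 \<le> (1 + eps) * (w i)\<^sup>2 + (1 + 1 / eps) * (\<mu> i)\<^sup>2" for i
    proof -
      have "(1 + eps) * (w i)\<^sup>2 + (1 + 1 / eps) * (\<mu> i)\<^sup>2 - (\<mu> i + w i)\<^sup>2 = (eps * w i - \<mu> i)\<^sup>2 / eps"
        using eps by (simp add: power2_eq_square field_simps)
      also have "\<dots> \<ge> 0" using eps by simp
      finally show ?thesis by simp
    qed
    then have "?Y (K - M) \<le> (\<Sum>i\<in>K - M. (1 + eps) * (w i)\<^sup>2 + (1 + 1 / eps) * (\<mu> i)\<^sup>2)" by (intro sum_mono)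
    also have "\<dots> = (1 + eps) * ?W (K - M) + (1 + 1 / eps) * ?U (K - M)"
      by (simp add: sum.distrib sum_distrib_left)
    also have "\<dots> \<le> (1 + eps) * ?W K + (1 + 1 / eps) * ?U (I - M)"
      using eps finK K fin by (intro add_mono mult_left_mono sum_mono2) auto
    finally show ?thesis .
  qed
  have 4: "?U (I - K) \<le> ?U (M - K) + ?U (I - M)"
  proof -
    have "?U (I - K) \<le> ?U ((M - K) \<union> (I - M))" using fin finM by (intro sum_mono2) auto
    also have "\<dots> = ?U (M - K) + ?U (I - M)" using fin finM by (intro sum.union_disjoint) auto
    finally show ?thesis .
  qed
  have U0: "0 \<le> ?U A" for A by (simp add: sum_nonneg)
  have "eps * (?W K + ?U (I - K)) \<le> eps * ?W K + eps * ?U (M - K) + eps * ?U (I - M)"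
    using mult_left_mono[OF 4, of eps] eps by (simp add: distrib_left)
  also have "\<dots> \<le> eps * ?W K + 1/2 * ?U (M - K) + 1 * ?U (I - M)"
    using mult_right_mono[of eps "1/2" "?U (M - K)"] mult_right_mono[of eps 1 "?U (I - M)"] eps U0 by simp
  also have "eps * ?W K + 1/2 * ?U (M - K) \<le> N + ?W M + (1 + 1 / eps) * ?U (I - M) + PM"
    using 1 2 3 N by (simp add: distrib_right)
  finally have "eps * (?W K + ?U (I - K)) \<le> N + ?W M + (2 + 1 / eps) * ?U (I - M) + PM"
    by (simp add: distrib_right)
  then show ?thesis using eps by (simp add: field_simps)
qed

text \<open>With ties the kept set could have more than \<open>khat y\<close> elements.\<close>

lemma AE_obs_law_no_ties:
  assumes "\<sigma> > 0"
  shows "AE y in obs_law n \<sigma> \<mu>. inj_on (\<lambda>i. \<bar>y i\<bar>) {1..n}"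
proof -
  have pair: "AE y in lebesgue_vec n. \<bar>y i\<bar> \<noteq> \<bar>y j\<bar>" if ij: "i \<in> {1..n}" "j \<in> {1..n}" "i \<noteq> j" for i j
  proof -
    let ?A = "{y \<in> space (lebesgue_vec n). \<bar>y i\<bar> = \<bar>y j\<bar>}"
    have meas: "?A \<in> sets (lebesgue_vec n)" using ij(1,2) by measurable
    define I where "I = {1..n} - {i}"
    have I: "insert i I = {1..n}" "finite I" "i \<notin> I" "j \<in> I" using ij by (auto simp: I_def)
    have "emeasure (lebesgue_vec n) ?A = (\<integral>\<^sup>+y. indicator ?A y \<partial>PiM (insert i I) (\<lambda>_. lborel))"
      using meas by (simp add: I(1))
    \<comment> \<open>Fubini: with the other coordinates fixed, a tie confines coordinate
      \<open>i\<close> to two points.\<close>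
    also have "\<dots> = (\<integral>\<^sup>+x. (\<integral>\<^sup>+t. indicator ?A (x(i := t)) \<partial>lborel) \<partial>PiM I (\<lambda>_. lborel))"
      by (rule lebvec.product_nn_integral_insert[OF I(2,3)]) (use meas in \<open>simp add: I(1)\<close>)
    also have "\<dots> = (\<integral>\<^sup>+x. 0 \<partial>PiM I (\<lambda>_. lborel :: real measure))"
    proof (rule nn_integral_cong)
      fix x
      have "(\<integral>\<^sup>+t. indicator ?A (x(i := t)) \<partial>lborel) \<le> (\<integral>\<^sup>+t. indicator {\<bar>x j\<bar>, - \<bar>x j\<bar>} t \<partial>lborel)"
      proof (rule nn_integral_mono)
        fix t :: real
        have "t \<in> {\<bar>x j\<bar>, - \<bar>x j\<bar>}" if "x(i := t) \<in> ?A"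
        proof -
          from that have "\<bar>t\<bar> = \<bar>x j\<bar>" using ij by simp
          then show ?thesis unfolding insert_iff by linarith
        qed
        then show "(indicator ?A (x(i := t)) :: ennreal) \<le> indicator {\<bar>x j\<bar>, - \<bar>x j\<bar>} t"
          by (cases "x(i := t) \<in> ?A") simp_all
      qed
      also have "\<dots> = emeasure lborel {\<bar>x j\<bar>, - \<bar>x j\<bar>}" by (intro nn_integral_indicator) auto
      also have "\<dots> = 0" by (rule emeasure_lborel_countable) auto
      finally show "(\<integral>\<^sup>+t. indicator ?A (x(i := t)) \<partial>lborel) = 0" by simp
    qed
    finally have "emeasure (lebesgue_vec n) ?A = 0" by simp
    then show ?thesis by (intro AE_I[OF _ _ meas]) auto
  qed
  have "AE y in lebesgue_vec n. \<forall>i\<in>{1..n}. \<forall>j\<in>{1..n}. i \<noteq> j \<longrightarrow> \<bar>y i\<bar> \<noteq> \<bar>y j\<bar>"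
  proof (rule AE_finite_allI[OF finite_atLeastAtMost], rule AE_finite_allI[OF finite_atLeastAtMost])
    fix i j assume "i \<in> {1..n}" "j \<in> {1..n}"
    then show "AE y in lebesgue_vec n. i \<noteq> j \<longrightarrow> \<bar>y i\<bar> \<noteq> \<bar>y j\<bar>"
      using pair[of i j] by (cases "i = j") simp_all
  qed
  then have AE: "AE y in lebesgue_vec n. inj_on (\<lambda>i. \<bar>y i\<bar>) {1..n}"
    by (rule AE_mp) (rule AE_I2, unfold inj_on_def, blast)
  show ?thesis
  proof -
    have meas: "(\<lambda>y. ennreal (gauss_dens n \<sigma> \<mu> y)) \<in> borel_measurable (lebesgue_vec n)" by measurable
    show ?thesis
      unfolding obs_law_eq_density[OF assms] AE_density[OF meas]
      using AE by (rule AE_mp) (rule AE_I2, blast)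
  qed
qed

section \<open>Oracle inequality for the risk\<close>

lemma npen_expand:
  assumes "n \<ge> 1" "set_pmf prior = {0..n}" "\<gamma> > 0" "k \<le> n"
  shows "npen n \<gamma> prior k
    = 2 * (1 + 1 / \<gamma>) * (ln (real (n choose k)) - ln (pmf prior k) + real k / 2 * ln (1 + \<gamma>))"
proof -
  have "pmf prior k > 0" using assms by (intro pmf_positive) auto
  moreover have "real (n choose k) > 0" using assms by simp
  ultimately show ?thesis
    unfolding npen_def using assms(3) by (simp add: ln_mult ln_inverse ln_powr)
qed

text \<open>The bounds depend on \<open>\<gamma>\<close> only through \<open>g1\<close> and
  \<open>g2\<close>. The third claim allows the noise energy on \<open>M\<close>, of order
  \<open>card M\<close>, to be absorbed into the complexity term.\<close>

lemma npen_bounds: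
  assumes "n \<ge> 1" "set_pmf prior = {0..n}" "0 < g1" "g1 \<le> \<gamma>" "\<gamma> \<le> g2" "k \<le> n"
  shows "0 \<le> npen n \<gamma> prior k"
    and "npen n \<gamma> prior k
      \<le> 2 * (1 + 1 / g1) * (1 + ln (1 + g2)) * (ln (real (n choose k)) - ln (pmf prior k) + real k)"
    and "real k \<le> ln (real (n choose k)) - ln (pmf prior k) + real k"
proof -
  have \<gamma>: "\<gamma> > 0" using assms by simp
  have "pmf prior k > 0" using assms by (intro pmf_positive) auto
  then have p: "ln (pmf prior k) \<le> 0" by (simp add: pmf_le_1)
  have "real (n choose k) \<ge> 1" using zero_less_binomial[OF assms(6)] by linarith
  then have c: "0 \<le> ln (real (n choose k))" by simp
  show "real k \<le> ln (real (n choose k)) - ln (pmf prior k) + real k" using p c by simp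
  have l: "0 \<le> ln (1 + \<gamma>)" "ln (1 + \<gamma>) \<le> ln (1 + g2)" using \<gamma> assms by auto
  let ?S = "ln (real (n choose k)) - ln (pmf prior k) + real k / 2 * ln (1 + \<gamma>)"
  have S0: "0 \<le> ?S" using p c l by (intro add_nonneg_nonneg) auto
  note e = npen_expand[OF assms(1,2) \<gamma> assms(6)]
  show "0 \<le> npen n \<gamma> prior k" unfolding e using S0 \<gamma> by (intro mult_nonneg_nonneg) auto
  have "real k / 2 * ln (1 + \<gamma>) \<le> real k * ln (1 + g2)" using l by (intro mult_mono) auto
  moreover have "0 \<le> ln (1 + g2) * (ln (real (n choose k)) - ln (pmf prior k))"
    using l c p by (intro mult_nonneg_nonneg) auto
  ultimately have "?S \<le> (1 + ln (1 + g2)) * (ln (real (n choose k)) - ln (pmf prior k) + real k)"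
    by (simp add: algebra_simps)
  then have "2 * (1 + 1 / \<gamma>) * ?S
    \<le> 2 * (1 + 1 / g1) * ((1 + ln (1 + g2)) * (ln (real (n choose k)) - ln (pmf prior k) + real k))"
    using assms \<gamma> S0 by (intro mult_mono add_left_mono divide_left_mono) auto
  then show "npen n \<gamma> prior k
      \<le> 2 * (1 + 1 / g1) * (1 + ln (1 + g2)) * (ln (real (n choose k)) - ln (pmf prior k) + real k)"
    unfolding e by (simp only: mult.assoc)
qed

lemma nn_integral_noise_sum_le:
  assumes M: "M \<subseteq> {1..n}" and f: "f \<in> borel_measurable borel" "\<And>x. 0 \<le> f x" and If: "gauss_mean f \<le> ennreal b" "0 \<le> b"
    and c: "0 \<le> c" and F: "\<And>z. F z \<le> c + (\<Sum>i\<in>M. f (z i))"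
  shows "noise_mean n F \<le> ennreal (c + real (card M) * b)"
proof -
  interpret noise: prob_space "noise_law n" by (rule prob_space_noise_law)
  have m: "(\<lambda>z. ennreal (f (z i))) \<in> borel_measurable (noise_law n)" if "i \<in> M" for i
    using M that
    by (intro measurable_compose[OF measurable_compose[OF measurable_noise_component f(1)] measurable_ennreal]) auto
  have "noise_mean n F \<le> (\<integral>\<^sup>+z. ennreal c + (\<Sum>i\<in>M. ennreal (f (z i))) \<partial>noise_law n)"
  proof (rule nn_integral_mono)
    fix z
    have "ennreal (F z) \<le> ennreal (c + (\<Sum>i\<in>M. f (z i)))" by (intro ennreal_leI F)
    also have "\<dots> = ennreal c + (\<Sum>i\<in>M. ennreal (f (z i)))"
      using c f(2) by (simp add: ennreal_plus sum_nonneg sum_ennreal)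
    finally show "ennreal (F z) \<le> ennreal c + (\<Sum>i\<in>M. ennreal (f (z i)))" .
  qed
  also have "\<dots> = ennreal c + (\<Sum>i\<in>M. \<integral>\<^sup>+z. ennreal (f (z i)) \<partial>noise_law n)"
  proof -
    have "(\<lambda>z. \<Sum>i\<in>M. ennreal (f (z i))) \<in> borel_measurable (noise_law n)"
      by (rule borel_measurable_sum[OF m])
    then have "(\<integral>\<^sup>+z. ennreal c + (\<Sum>i\<in>M. ennreal (f (z i))) \<partial>noise_law n)
      = (\<integral>\<^sup>+z. ennreal c \<partial>noise_law n) + (\<integral>\<^sup>+z. (\<Sum>i\<in>M. ennreal (f (z i))) \<partial>noise_law n)"
      by (intro nn_integral_add) auto
    moreover have "(\<integral>\<^sup>+z. (\<Sum>i\<in>M. ennreal (f (z i))) \<partial>noise_law n)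
      = (\<Sum>i\<in>M. \<integral>\<^sup>+z. ennreal (f (z i)) \<partial>noise_law n)"
      by (rule nn_integral_sum) (rule m)
    ultimately show ?thesis by (simp add: noise.emeasure_space_1)
  qed
  also have "\<dots> \<le> ennreal c + (\<Sum>i\<in>M. ennreal b)"
  proof (intro add_left_mono sum_mono)
    fix i assume "i \<in> M"
    then have "noise_mean n (\<lambda>z. f (z i)) = gauss_mean f"
      using f(1) M by (intro nn_integral_noise_component) auto
    then show "noise_mean n (\<lambda>z. f (z i)) \<le> ennreal b" using If by simp
  qed
  also have "\<dots> = ennreal (c + real (card M) * b)"
    using c If(2) by (simp add: ennreal_plus ennreal_mult' ennreal_of_nat_eq_real_of_nat)
  finally show ?thesis .
qed

lemma noise_sum_squares_le:
  assumes "M \<subseteq> {1..n}"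
  shows "noise_mean n (\<lambda>z. \<Sum>i\<in>M. (z i)\<^sup>2) \<le> ennreal (8 * real (card M))"
  using nn_integral_noise_sum_le[OF assms, of "\<lambda>x. x\<^sup>2" 8 0 "\<lambda>z. \<Sum>i\<in>M. (z i)\<^sup>2"] gauss_square_le
  by (simp add: mult.commute)

text \<open>Since \<open>khat\<close> is arbitrary, the loss may be non-measurable; it is bounded
  almost surely by the measurable \<open>G (Z y)\<close> before any integral is computed.
  \<open>Z\<close> recovers the standardized noise from the data and so moves the integral to
  \<open>noise_law\<close>.\<close>

lemma map_risk_bound:
  assumes \<sigma>: "\<sigma> > 0" and sel: "is_map_selector n \<sigma> \<gamma> prior khat" and M: "M \<subseteq> {1..n}"
    and eps: "0 < eps" "eps \<le> 1/2"
    and env: "noise_envelope n \<gamma> prior (1 + 2 * eps) H"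
    and IH: "noise_mean n H \<le> ennreal h" "0 \<le> h"
    and pen: "0 \<le> npen n \<gamma> prior (card M)"
  shows "risk n \<sigma> (map_estimator n khat) \<mu>
    \<le> ennreal (1 / eps * (\<sigma>\<^sup>2 * h + \<sigma>\<^sup>2 * (8 * real (card M)) + ((2 + 1 / eps) * (\<Sum>i\<in>{1..n} - M. (\<mu> i)\<^sup>2)
        + \<sigma>\<^sup>2 * npen n \<gamma> prior (card M))))"
proof -
  have H: "H \<in> borel_measurable (vec_space n)" "\<And>z. 0 \<le> H z"
    "\<And>z M. M \<subseteq> {1..n} \<Longrightarrow> (1 + 2 * eps) * (\<Sum>i\<in>M. (z i)\<^sup>2) - npen n \<gamma> prior (card M) \<le> H z"
    using env unfolding noise_envelope_def by blast+
  define c where "c = (2 + 1 / eps) * (\<Sum>i\<in>{1..n} - M. (\<mu> i)\<^sup>2) + \<sigma>\<^sup>2 * npen n \<gamma> prior (card M)"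
  have c: "0 \<le> c" unfolding c_def using eps pen by (intro add_nonneg_nonneg mult_nonneg_nonneg sum_nonneg) auto
  define Z where "Z y = (\<lambda>i\<in>{1..n}. (y i - \<mu> i) / \<sigma>)" for y :: "nat \<Rightarrow> real"
  have mZ: "Z \<in> estimators n"
    unfolding Z_def[abs_def] vec_space_def by measurable
  let ?W = "\<lambda>z. \<Sum>i\<in>M. (z i :: real)\<^sup>2"
  define G where "G z = 1 / eps * (\<sigma>\<^sup>2 * H z + \<sigma>\<^sup>2 * ?W z + c)" for z
  have mW: "?W \<in> borel_measurable (vec_space n)"
    using measurable_sum_squares[OF M] by (simp cong: measurable_cong_sets add: sets_noise_law)
  have mG: "G \<in> borel_measurable (vec_space n)"
    unfolding G_def[abs_def] using H(1) mW by measurable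
  have "risk n \<sigma> (map_estimator n khat) \<mu> \<le> (\<integral>\<^sup>+y. ennreal (G (Z y)) \<partial>obs_law n \<sigma> \<mu>)"
    unfolding risk_def
  proof (rule nn_integral_mono_AE)
    have "AE y in obs_law n \<sigma> \<mu>. y \<in> space (vec_space n)"
      using AE_space[of "obs_law n \<sigma> \<mu>"] by (simp add: space_obs_law)
    with AE_obs_law_no_ties[OF \<sigma>, of n \<mu>]
    show "AE y in obs_law n \<sigma> \<mu>. ennreal (\<Sum>i=1..n. (map_estimator n khat y i - \<mu> i)\<^sup>2) \<le> ennreal (G (Z y))"
    proof eventually_elim
      fix y assume inj: "inj_on (\<lambda>i. \<bar>y i\<bar>) {1..n}" and y: "y \<in> space (vec_space n)"
      define K where "K = kept n y (khat y)"
      have K: "K \<subseteq> {1..n}" by (auto simp: K_def kept_def)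
      define w where "w i = y i - \<mu> i" for i
      have wZ: "(w i)\<^sup>2 = \<sigma>\<^sup>2 * (Z y i)\<^sup>2" if "i \<in> {1..n}" for i
        using that \<sigma> by (simp add: Z_def w_def power_divide)
      have wsum: "(\<Sum>i\<in>A. (w i)\<^sup>2) = \<sigma>\<^sup>2 * (\<Sum>i\<in>A. (Z y i)\<^sup>2)" if "A \<subseteq> {1..n}" for A
        unfolding sum_distrib_left using that wZ by (intro sum.cong) auto
      have "is_arg_min (map_criterion n \<sigma> \<gamma> prior y) (\<lambda>k. k \<in> {0..n}) (khat y)"
        using sel y by (auto simp: is_map_selector_def)
      from kept_minimal[OF this inj M]
      have min: "(\<Sum>i\<in>{1..n} - K. (\<mu> i + w i)\<^sup>2) + penalty n \<sigma> \<gamma> prior (card K)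
        \<le> (\<Sum>i\<in>{1..n} - M. (\<mu> i + w i)\<^sup>2) + penalty n \<sigma> \<gamma> prior (card M)"
        by (simp add: K_def w_def)
      have N: "(1 + 2 * eps) * (\<Sum>i\<in>K. (w i)\<^sup>2) - penalty n \<sigma> \<gamma> prior (card K) \<le> \<sigma>\<^sup>2 * H (Z y)"
        using mult_left_mono[OF H(3)[OF K, of "Z y"], of "\<sigma>\<^sup>2"]
        unfolding wsum[OF K] penalty_eq_npen by (simp add: algebra_simps)
      have "(\<Sum>i=1..n. (map_estimator n khat y i - \<mu> i)\<^sup>2) = (\<Sum>i\<in>K. (w i)\<^sup>2) + (\<Sum>i\<in>{1..n} - K. (\<mu> i)\<^sup>2)"
        unfolding map_estimator_loss K_def w_def ..
      also have "\<dots> \<le> 1 / eps * (\<sigma>\<^sup>2 * H (Z y) + (\<Sum>i\<in>M. (w i)\<^sup>2) + (2 + 1 / eps) * (\<Sum>i\<in>{1..n} - M. (\<mu> i)\<^sup>2)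
          + penalty n \<sigma> \<gamma> prior (card M))"
        by (rule penalized_loss_bound[OF _ K M eps min N]) simp
      also have "\<dots> = G (Z y)"
        unfolding G_def c_def wsum[OF M] penalty_eq_npen by (simp only: add.assoc)
      finally show "ennreal (\<Sum>i=1..n. (map_estimator n khat y i - \<mu> i)\<^sup>2) \<le> ennreal (G (Z y))"
        by (rule ennreal_leI)
    qed
  qed
  also have "\<dots> = noise_mean n (\<lambda>z. G (Z (\<lambda>i\<in>{1..n}. \<mu> i + \<sigma> * z i)))"
    unfolding obs_law_def using measurable_compose[OF mZ mG]
    by (intro nn_integral_distr measurable_affine_noise measurable_compose[OF _ measurable_ennreal])
      (simp only: measurable_distr_eq1)
  also have "\<dots> = noise_mean n G"
  proof (rule nn_integral_cong)
    fix z assume "z \<in> space (noise_law n)"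
    then have "z \<in> extensional {1..n}" by (auto simp: space_noise_law space_vec_space PiE_def)
    then have "Z (\<lambda>i\<in>{1..n}. \<mu> i + \<sigma> * z i) = z"
      unfolding Z_def using \<sigma> by (intro ext) (auto simp: extensional_def restrict_def)
    then show "ennreal (G (Z (\<lambda>i\<in>{1..n}. \<mu> i + \<sigma> * z i))) = ennreal (G z)" by simp
  qed
  also have "\<dots> = (\<integral>\<^sup>+z. ennreal (1 / eps) * (ennreal (\<sigma>\<^sup>2) * ennreal (H z) + ennreal (\<sigma>\<^sup>2) * ennreal (?W z) + ennreal c) \<partial>noise_law n)"
  proof (rule nn_integral_cong)
    fix z
    have "0 \<le> \<sigma>\<^sup>2 * H z" "0 \<le> \<sigma>\<^sup>2 * ?W z" using H(2)[of z] by (auto intro!: mult_nonneg_nonneg sum_nonneg)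
    then show "ennreal (G z) = ennreal (1 / eps) * (ennreal (\<sigma>\<^sup>2) * ennreal (H z) + ennreal (\<sigma>\<^sup>2) * ennreal (?W z) + ennreal c)"
      unfolding G_def using c eps H(2)[of z]
      by (simp add: ennreal_mult'[symmetric] ennreal_plus[symmetric] sum_nonneg del: ennreal_plus)
  qed
  also have "\<dots> = ennreal (1 / eps) * (ennreal (\<sigma>\<^sup>2) * noise_mean n H
      + ennreal (\<sigma>\<^sup>2) * noise_mean n ?W + ennreal c)"
  proof -
    have [measurable]: "H \<in> borel_measurable (noise_law n)" "?W \<in> borel_measurable (noise_law n)"
      using H(1) measurable_sum_squares[OF M] by (simp_all cong: measurable_cong_sets add: sets_noise_law)
    interpret noise: prob_space "noise_law n" by (rule prob_space_noise_law)
    show ?thesis by (simp add: nn_integral_cmult nn_integral_add noise.emeasure_space_1)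
  qed
  also have "\<dots> \<le> ennreal (1 / eps) * (ennreal (\<sigma>\<^sup>2) * ennreal h + ennreal (\<sigma>\<^sup>2) * ennreal (8 * real (card M)) + ennreal c)"
    by (intro mult_left_mono add_mono IH(1) noise_sum_squares_le M) auto
  also have "\<dots> = ennreal (1 / eps * (\<sigma>\<^sup>2 * h + \<sigma>\<^sup>2 * (8 * real (card M)) + c))"
    using c eps IH(2) by (simp add: ennreal_mult'[symmetric] ennreal_plus[symmetric] del: ennreal_plus)
  finally show ?thesis by (simp only: c_def)
qed

text \<open>Approximation error of \<open>M\<close>, then its complexity, then a remainder
  independent of \<open>M\<close>.\<close>

definition selection_risk ::
  "nat \<Rightarrow> real \<Rightarrow> nat pmf \<Rightarrow> real \<Rightarrow> nat set \<Rightarrow> (nat \<Rightarrow> real) \<Rightarrow> real" where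
  "selection_risk n \<sigma> prior rho M \<mu> = (\<Sum>i\<in>{1..n} - M. (\<mu> i)\<^sup>2)
     + \<sigma>\<^sup>2 * (ln (real (n choose card M)) - ln (pmf prior (card M)) + real (card M)
         + (1 - pmf prior 0) + (real n + 1)\<^sup>2 * rho ^ n)"

text \<open>\<open>A\<close> and \<open>rho\<close> depend on \<open>g1\<close> and
  \<open>g2\<close> only, while \<open>M\<close> may be chosen after \<open>\<mu>\<close>. Each case
  thus tailors the comparison set to the signal without affecting the constants.\<close>

lemma map_oracle_inequality:
  fixes g1 g2 :: real
  assumes g: "0 < g1" "0 < g2"
  obtains A rho where "0 < A" "0 < rho" "rho < 1"
    and "\<And>n \<gamma> prior \<sigma> khat M \<mu>. \<lbrakk>n \<ge> 1; set_pmf prior = {0..n}; g1 \<le> \<gamma>; \<gamma> \<le> g2; \<sigma> > 0;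
        is_map_selector n \<sigma> \<gamma> prior khat; M \<subseteq> {1..n}\<rbrakk> \<Longrightarrow>
      risk n \<sigma> (map_estimator n khat) \<mu> \<le> ennreal (A * selection_risk n \<sigma> prior rho M \<mu>)"
proof -
  obtain a C rho where a: "1 < a" "a \<le> 2" and C: "0 < C" and rho: "0 < rho" "rho < 1"
    and ctl: "\<And>n \<gamma> prior. \<lbrakk>n \<ge> 1; set_pmf prior = {0..n}; g1 \<le> \<gamma>; \<gamma> \<le> g2\<rbrakk> \<Longrightarrow>
      \<exists>H. noise_envelope n \<gamma> prior a H
        \<and> noise_mean n H \<le> ennreal (C * ((1 - pmf prior 0) + (real n + 1)\<^sup>2 * rho ^ n))"
    using noise_control[OF g] by metis
  define eps where "eps = (a - 1) / 2"
  have eps: "0 < eps" "eps \<le> 1/2" and a_eq: "a = 1 + 2 * eps" using a by (auto simp: eps_def field_simps)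
  define B where "B = 2 * (1 + 1 / g1) * (1 + ln (1 + g2))"
  have "0 < ln (1 + g2)" using g by simp
  then have B: "0 < B" unfolding B_def using g by (intro mult_pos_pos add_pos_pos) auto
  define A where "A = 1 / eps * (C + 8 + (2 + 1 / eps) + B)"
  have A: "0 < A" unfolding A_def using eps C B by (intro mult_pos_pos add_pos_pos) auto
  show ?thesis
  proof (rule that[OF A rho])
    fix n \<gamma> prior \<sigma> khat M and \<mu> :: "nat \<Rightarrow> real"
    assume n: "n \<ge> 1" and prior: "set_pmf prior = {0..n}" and \<gamma>: "g1 \<le> \<gamma>" "\<gamma> \<le> g2" and \<sigma>: "\<sigma> > 0"
      and sel: "is_map_selector n \<sigma> \<gamma> prior khat" and M: "M \<subseteq> {1..n}"
    obtain H where H: "noise_envelope n \<gamma> prior (1 + 2 * eps) H"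
      "noise_mean n H \<le> ennreal (C * ((1 - pmf prior 0) + (real n + 1)\<^sup>2 * rho ^ n))"
      using ctl[OF n prior \<gamma>] unfolding a_eq by blast
    let ?h = "(1 - pmf prior 0) + (real n + 1)\<^sup>2 * rho ^ n"
    have h0: "0 \<le> ?h" using rho by (intro add_nonneg_nonneg) (auto simp: pmf_le_1)
    have cM: "card M \<le> n" using card_mono[OF _ M] by simp
    note pen = npen_bounds[OF n prior g(1) \<gamma> cM]
    let ?L = "ln (real (n choose card M)) - ln (pmf prior (card M)) + real (card M)"
    let ?U = "\<Sum>i\<in>{1..n} - M. (\<mu> i)\<^sup>2"
    let ?X = "\<sigma>\<^sup>2 * (C * ?h) + \<sigma>\<^sup>2 * (8 * real (card M)) + ((2 + 1 / eps) * ?U + \<sigma>\<^sup>2 * npen n \<gamma> prior (card M))"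
    have k: "real (card M) \<le> ?L" and L0: "0 \<le> ?L" using pen(3) by linarith+
    have U0: "0 \<le> ?U" by (simp add: sum_nonneg)
    have "risk n \<sigma> (map_estimator n khat) \<mu>
      \<le> ennreal (1 / eps * ?X)"
      using h0 C by (intro map_risk_bound[OF \<sigma> sel M eps H _ pen(1)]) auto
    also have "\<dots> \<le> ennreal (A * (?U + \<sigma>\<^sup>2 * (?L + ?h)))"
    proof (rule ennreal_leI)
      define x where "x = \<sigma>\<^sup>2 * ?h"
      define l where "l = \<sigma>\<^sup>2 * ?L"
      define u where "u = ?U"
      have nn: "0 \<le> x" "0 \<le> l" "0 \<le> u" using h0 L0 U0 by (auto simp: x_def l_def u_def)
      have k': "\<sigma>\<^sup>2 * (8 * real (card M)) \<le> 8 * l"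
      proof -
        have "8 * (\<sigma>\<^sup>2 * real (card M)) \<le> 8 * l" unfolding l_def using k by (intro mult_left_mono) auto
        then show ?thesis by (simp only: mult.left_commute)
      qed
      have p': "\<sigma>\<^sup>2 * npen n \<gamma> prior (card M) \<le> B * l"
        using mult_left_mono[OF pen(2), of "\<sigma>\<^sup>2"] by (simp add: l_def B_def ac_simps)
      have "?X \<le> C * x + 8 * l + ((2 + 1 / eps) * u + B * l)"
        using k' p' by (simp add: x_def u_def)
      also have "\<dots> \<le> (C + 8 + (2 + 1 / eps) + B) * (u + (l + x))"
      proof -
        let ?D = "C + 8 + (2 + 1 / eps) + B"
        have "C * x \<le> ?D * x" "(8 + B) * l \<le> ?D * l" "(2 + 1 / eps) * u \<le> ?D * u"
          using nn C B eps by (auto intro!: mult_right_mono)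
        then show ?thesis by (simp add: distrib_left distrib_right)
      qed
      finally have "1 / eps * ?X
        \<le> 1 / eps * ((C + 8 + (2 + 1 / eps) + B) * (u + (l + x)))"
        using eps by (intro mult_left_mono) auto
      then show "1 / eps * ?X
        \<le> A * (?U + \<sigma>\<^sup>2 * (?L + ?h))"
        unfolding A_def x_def l_def u_def mult.assoc distrib_left[of "\<sigma>\<^sup>2" ?L ?h] .
    qed
    finally show "risk n \<sigma> (map_estimator n khat) \<mu> \<le> ennreal (A * selection_risk n \<sigma> prior rho M \<mu>)"
      by (simp only: selection_risk_def add.assoc)
  qed
qed

section \<open>Balls and simple estimators\<close>

lemma powr_le_powr_iff:
  fixes x y a :: real
  assumes "0 < a" "0 \<le> x" "0 \<le> y"
  shows "x powr a \<le> y powr a \<longleftrightarrow> x \<le> y"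
  using assms powr_mono2[of a x y] powr_less_mono2[of a y x] by fastforce

lemma mem_lp_ball_finite:
  assumes q: "0 < q" and "0 < \<sigma>" "0 < \<eta>"
  shows "\<mu> \<in> lp_ball n (ereal q) \<sigma> \<eta> \<longleftrightarrow>
    \<mu> \<in> {1..n} \<rightarrow>\<^sub>E UNIV \<and> (\<Sum>i=1..n. \<bar>\<mu> i\<bar> powr q) \<le> real n * (\<sigma> * \<eta>) powr q"
proof -
  let ?X = "\<Sum>i=1..n. \<bar>\<mu> i\<bar> powr q"
  have X: "0 \<le> ?X" by (intro sum_nonneg) auto
  have e: "real_of_ereal (1 / ereal q) = 1 / q" using q by (simp add: one_ereal_def)
  have "real n powr (1 / q) * \<sigma> * \<eta> = (real n * (\<sigma> * \<eta>) powr q) powr (1 / q)"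
    using assms by (simp add: powr_mult powr_powr)
  then have "lp_norm n (ereal q) \<mu> \<le> real n powr real_of_ereal (1 / ereal q) * \<sigma> * \<eta>
    \<longleftrightarrow> ?X powr (1 / q) \<le> (real n * (\<sigma> * \<eta>) powr q) powr (1 / q)"
    unfolding e by (simp add: lp_norm_def)
  also have "\<dots> \<longleftrightarrow> ?X \<le> real n * (\<sigma> * \<eta>) powr q"
    using q X by (intro powr_le_powr_iff) auto
  finally show ?thesis by (auto simp: lp_ball_def)
qed

lemma mem_lp_ball_infinite:
  assumes "n \<ge> 1"
  shows "\<mu> \<in> lp_ball n \<infinity> \<sigma> \<eta> \<longleftrightarrow> \<mu> \<in> {1..n} \<rightarrow>\<^sub>E UNIV \<and> (\<forall>i\<in>{1..n}. \<bar>\<mu> i\<bar> \<le> \<sigma> * \<eta>)"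
proof -
  have "Max ((\<lambda>i. \<bar>\<mu> i\<bar>) ` {1..n}) \<le> \<sigma> * \<eta> \<longleftrightarrow> (\<forall>i\<in>{1..n}. \<bar>\<mu> i\<bar> \<le> \<sigma> * \<eta>)"
    using assms by (subst Max_le_iff) auto
  then show ?thesis using assms by (auto simp: lp_ball_def lp_norm_def)
qed

lemma pos_ereal_cases:
  assumes "(0::ereal) < p"
  obtains "p = \<infinity>" | q where "p = ereal q" "0 < q"
  using assms by (cases p) auto

lemma cube_subset_lp_ball:
  assumes "0 < p" "n \<ge> 1" "0 < \<sigma>" "0 < \<eta>" and \<mu>: "\<mu> \<in> {1..n} \<rightarrow>\<^sub>E UNIV" "\<And>i. i \<in> {1..n} \<Longrightarrow> \<bar>\<mu> i\<bar> \<le> \<sigma> * \<eta>"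
  shows "\<mu> \<in> lp_ball n p \<sigma> \<eta>"
  using assms(1)
proof (cases rule: pos_ereal_cases)
  case 1
  then show ?thesis using assms by (simp add: mem_lp_ball_infinite)
next
  case (2 q)
  have "(\<Sum>i=1..n. \<bar>\<mu> i\<bar> powr q) \<le> (\<Sum>i=1..n. (\<sigma> * \<eta>) powr q)"
    using \<mu>(2) 2 by (intro sum_mono powr_mono2) auto
  then show ?thesis using 2 assms by (simp add: mem_lp_ball_finite)
qed

text \<open>The power mean inequality, obtained by applying Young's inequality with exponent
  \<open>2 / q\<close> to \<open>\<bar>x\<bar> powr q / s powr q\<close> in each coordinate and
  summing.\<close>

lemma lp_ball_l2_large:
  assumes "2 \<le> p" "n \<ge> 1" "0 < \<sigma>" "0 < \<eta>" and \<mu>: "\<mu> \<in> lp_ball n p \<sigma> \<eta>"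
  shows "(\<Sum>i=1..n. (\<mu> i)\<^sup>2) \<le> real n * (\<sigma> * \<eta>)\<^sup>2"
proof -
  have "0 < p" using assms(1) by (rule less_le_trans[rotated]) simp
  then show ?thesis
  proof (cases rule: pos_ereal_cases)
    case 1
    then have "\<bar>\<mu> i\<bar> \<le> \<bar>\<sigma> * \<eta>\<bar>" if "i \<in> {1..n}" for i
      using \<mu> that assms by (auto simp: mem_lp_ball_infinite)
    then have "(\<mu> i)\<^sup>2 \<le> (\<sigma> * \<eta>)\<^sup>2" if "i \<in> {1..n}" for i
      using that by (simp only: abs_le_square_iff)
    then have "(\<Sum>i=1..n. (\<mu> i)\<^sup>2) \<le> (\<Sum>i=1..n. (\<sigma> * \<eta>)\<^sup>2)" by (rule sum_mono)
    then show ?thesis by simp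
  next
    case (2 q)
    then have q: "2 \<le> q" using assms(1) by simp
    define s where "s = \<sigma> * \<eta>"
    have s: "0 < s" using assms by (simp add: s_def)
    have ball: "(\<Sum>i=1..n. \<bar>\<mu> i\<bar> powr q) \<le> real n * s powr q"
      using \<mu> 2 assms by (simp add: mem_lp_ball_finite s_def)
    have young: "x\<^sup>2 \<le> s\<^sup>2 * (2 / q * (\<bar>x\<bar> powr q / s powr q) + (1 - 2 / q))" for x
    proof (cases "x = 0")
      case True
      then show ?thesis using q s by simp
    next
      case False
      define u where "u = \<bar>x\<bar> powr q / s powr q"
      have u: "0 < u" using False s by (simp add: u_def)
      have "u powr (2 / q) * 1 powr (1 - 2 / q) \<le> 2 / q * u + (1 - 2 / q) * 1"
        using q u by (intro Youngs_inequality_0) auto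
      moreover have "u powr (2 / q) = x\<^sup>2 / s\<^sup>2"
        using False s q by (simp add: u_def powr_divide powr_powr powr_numeral)
      ultimately have "x\<^sup>2 / s\<^sup>2 \<le> 2 / q * u + (1 - 2 / q)" by simp
      then show ?thesis using s by (simp add: u_def divide_le_eq mult.commute)
    qed
    have "(\<Sum>i=1..n. (\<mu> i)\<^sup>2) \<le> (\<Sum>i=1..n. s\<^sup>2 * (2 / q * (\<bar>\<mu> i\<bar> powr q / s powr q) + (1 - 2 / q)))"
      by (intro sum_mono young)
    also have "\<dots> = s\<^sup>2 * (2 / q * ((\<Sum>i=1..n. \<bar>\<mu> i\<bar> powr q) / s powr q) + real n * (1 - 2 / q))"
      by (simp add: sum.distrib sum_distrib_left[symmetric] sum_divide_distrib[symmetric])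
    also have "\<dots> \<le> s\<^sup>2 * (2 / q * real n + real n * (1 - 2 / q))"
      using ball s q by (intro mult_left_mono add_right_mono) (auto simp: divide_le_eq)
    also have "\<dots> = real n * s\<^sup>2" by (simp add: algebra_simps)
    finally show ?thesis by (simp add: s_def)
  qed
qed

lemma square_eq_powr_split: "x\<^sup>2 = \<bar>x\<bar> powr q * \<bar>x\<bar> powr (2 - q)" for x :: real
  by (cases "x = 0") (simp_all add: powr_add[symmetric] powr_numeral)

text \<open>Interpolation: the square of the smaller of \<open>\<bar>x\<bar>\<close> and
  \<open>t\<close> is split into a \<open>q\<close>-th and a \<open>(2 - q)\<close>-th power, and
  each is bounded separately.\<close>

lemma truncated_square_le:
  fixes x t q :: real
  assumes "0 < t" "0 < q" "q \<le> 2"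
  shows "min (x\<^sup>2) (t\<^sup>2) \<le> \<bar>x\<bar> powr q * t powr (2 - q)"
proof (cases "\<bar>x\<bar> \<le> t")
  case True
  have "x\<^sup>2 \<le> \<bar>x\<bar> powr q * t powr (2 - q)"
    unfolding square_eq_powr_split[of x q] using True assms by (intro mult_left_mono powr_mono2) auto
  then show ?thesis by simp
next
  case False
  have "t\<^sup>2 = t powr q * t powr (2 - q)" using assms square_eq_powr_split[of t q] by simp
  also have "\<dots> \<le> \<bar>x\<bar> powr q * t powr (2 - q)" using False assms by (intro mult_right_mono powr_mono2) auto
  finally show ?thesis by simp
qed

lemma lp_ball_truncated_sum:
  assumes q: "0 < q" "q \<le> 2" and "0 < \<sigma>" "0 < \<eta>" "0 < t" and \<mu>: "\<mu> \<in> lp_ball n (ereal q) \<sigma> \<eta>"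
  shows "(\<Sum>i=1..n. min ((\<mu> i)\<^sup>2) ((\<sigma> * t)\<^sup>2)) \<le> \<sigma>\<^sup>2 * (real n * \<eta> powr q * t powr (2 - q))"
proof -
  have "(\<Sum>i=1..n. min ((\<mu> i)\<^sup>2) ((\<sigma> * t)\<^sup>2)) \<le> (\<Sum>i=1..n. \<bar>\<mu> i\<bar> powr q * (\<sigma> * t) powr (2 - q))"
    using assms by (intro sum_mono truncated_square_le) auto
  also have "\<dots> = (\<Sum>i=1..n. \<bar>\<mu> i\<bar> powr q) * (\<sigma> * t) powr (2 - q)" by (simp add: sum_distrib_right)
  also have "\<dots> \<le> (real n * (\<sigma> * \<eta>) powr q) * (\<sigma> * t) powr (2 - q)"
    using \<mu> assms by (intro mult_right_mono) (auto simp: mem_lp_ball_finite)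
  also have "\<dots> = (\<sigma> powr q * \<sigma> powr (2 - q)) * (real n * \<eta> powr q * t powr (2 - q))"
    using assms by (simp add: powr_mult)
  also have "\<sigma> powr q * \<sigma> powr (2 - q) = \<sigma>\<^sup>2" using assms square_eq_powr_split[of \<sigma> q] by simp
  finally show ?thesis .
qed

text \<open>A single coordinate carries at most the whole norm, so none exceeds
  \<open>\<sigma> * t\<close>. Truncation at this level changes nothing, and the truncated sum bound
  becomes \<open>\<sigma>\<^sup>2 * t\<^sup>2\<close>.\<close>

lemma lp_ball_l2_small:
  assumes q: "0 < q" "q \<le> 2" and \<sigma>: "0 < \<sigma>" and \<eta>: "0 < \<eta>" and n: "n \<ge> 1"
    and \<mu>: "\<mu> \<in> lp_ball n (ereal q) \<sigma> \<eta>"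
  shows "(\<Sum>i=1..n. (\<mu> i)\<^sup>2) \<le> \<sigma>\<^sup>2 * real n powr (2 / q) * \<eta>\<^sup>2"
proof -
  define t where "t = real n powr (1 / q) * \<eta>"
  have t: "0 < t" using \<eta> n by (simp add: t_def)
  have tq: "t powr q = real n * \<eta> powr q" using \<eta> q by (simp add: t_def powr_mult powr_powr)
  have "(\<mu> i)\<^sup>2 \<le> (\<sigma> * t)\<^sup>2" if "i \<in> {1..n}" for i
  proof -
    have "\<bar>\<mu> i\<bar> powr q \<le> (\<Sum>i=1..n. \<bar>\<mu> i\<bar> powr q)" using that by (intro member_le_sum) auto
    also have "\<dots> \<le> (\<sigma> * t) powr q"
      using \<mu> q \<sigma> \<eta> t by (simp add: mem_lp_ball_finite powr_mult tq ac_simps)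
    finally have "\<bar>\<mu> i\<bar> \<le> \<bar>\<sigma> * t\<bar>" using q \<sigma> t by (simp add: powr_le_powr_iff)
    then show ?thesis by (simp only: abs_le_square_iff)
  qed
  then have "(\<Sum>i=1..n. (\<mu> i)\<^sup>2) = (\<Sum>i=1..n. min ((\<mu> i)\<^sup>2) ((\<sigma> * t)\<^sup>2))"
    by (intro sum.cong) (auto simp: min_absorb1)
  also have "\<dots> \<le> \<sigma>\<^sup>2 * (t powr q * t powr (2 - q))"
    using lp_ball_truncated_sum[OF q \<sigma> \<eta> t \<mu>] by (simp only: tq)
  also have "t powr q * t powr (2 - q) = t\<^sup>2" using t square_eq_powr_split[of t q] by simp
  also have "(real n powr (1 / q))\<^sup>2 = real n powr (2 / q)"
    by (simp add: power2_eq_square powr_add[symmetric] add_divide_distrib[symmetric])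
  then have "t\<^sup>2 = real n powr (2 / q) * \<eta>\<^sup>2" by (simp add: t_def power_mult_distrib)
  finally show ?thesis by (simp only: mult.assoc)
qed

text \<open>Markov's inequality for the counting measure on coordinates.\<close>

lemma lp_ball_card_large:
  assumes q: "0 < q" and "0 < \<sigma>" "0 < \<eta>" "0 < t" and \<mu>: "\<mu> \<in> lp_ball n (ereal q) \<sigma> \<eta>"
  shows "real (card {i \<in> {1..n}. \<sigma> * t < \<bar>\<mu> i\<bar>}) \<le> real n * \<eta> powr q * t powr (- q)"
proof -
  let ?B = "{i \<in> {1..n}. \<sigma> * t < \<bar>\<mu> i\<bar>}"
  have "real (card ?B) * (\<sigma> * t) powr q = (\<Sum>i\<in>?B. (\<sigma> * t) powr q)" by simp
  also have "\<dots> \<le> (\<Sum>i\<in>?B. \<bar>\<mu> i\<bar> powr q)" using assms by (intro sum_mono powr_mono2) auto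
  also have "\<dots> \<le> (\<Sum>i=1..n. \<bar>\<mu> i\<bar> powr q)" by (intro sum_mono2) auto
  also have "\<dots> \<le> real n * (\<sigma> * \<eta>) powr q" using \<mu> assms by (simp add: mem_lp_ball_finite)
  finally have "(real (card ?B) * t powr q) * \<sigma> powr q \<le> (real n * \<eta> powr q) * \<sigma> powr q"
    using assms by (simp add: powr_mult ac_simps)
  then have "real (card ?B) * t powr q \<le> real n * \<eta> powr q" using assms by (simp add: mult_le_cancel_right)
  then show ?thesis using assms by (simp add: powr_minus_divide pos_le_divide_eq)
qed

lemma two_valued_mem_lp_ball:
  assumes q: "0 < q" and "0 < \<sigma>" "0 < \<eta>" "0 \<le> h" and M: "M \<subseteq> {1..n}" "card M \<le> k"
    and h: "real k * h powr q \<le> real n * (\<sigma> * \<eta>) powr q"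
  shows "two_valued n h M \<in> lp_ball n (ereal q) \<sigma> \<eta>"
proof -
  have "(\<Sum>i=1..n. \<bar>two_valued n h M i\<bar> powr q) = (\<Sum>i=1..n. if i \<in> M then h powr q else 0)"
    using assms by (intro sum.cong) (auto simp: two_valued_def)
  also have "\<dots> = real (card M) * h powr q" using M by (simp add: sum.If_cases Int_absorb1)
  also have "\<dots> \<le> real k * h powr q" using M by (intro mult_right_mono) auto
  finally show ?thesis using h assms by (simp add: mem_lp_ball_finite two_valued_def)
qed

lemma two_valued_mem_lp_ball_cube:
  assumes "0 < p" "n \<ge> 1" "0 < \<sigma>" "0 < \<eta>" "0 \<le> h" "h \<le> \<sigma> * \<eta>"
  shows "two_valued n h M \<in> lp_ball n p \<sigma> \<eta>"
  using assms by (intro cube_subset_lp_ball) (auto simp: two_valued_def)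

section \<open>Competing estimators for the minimax upper bounds\<close>

lemma risk_eq_noise:
  assumes est: "est \<in> estimators n"
  shows "risk n \<sigma> est \<mu>
    = noise_mean n (\<lambda>z. \<Sum>i=1..n. (est (\<lambda>i\<in>{1..n}. \<mu> i + \<sigma> * z i) i - \<mu> i)\<^sup>2)"
proof -
  note [measurable] = measurable_estimator_component[OF est]
  have "(\<lambda>y. ennreal (\<Sum>i=1..n. (est y i - \<mu> i)\<^sup>2)) \<in> borel_measurable (vec_space n)" by measurable
  then show ?thesis
    unfolding risk_def obs_law_def
    by (intro nn_integral_distr measurable_affine_noise) (simp only: measurable_distr_eq1)
qed

lemma risk_zero:
  "(\<lambda>y. \<lambda>i\<in>{1..n}. 0) \<in> estimators n"
  "risk n \<sigma> (\<lambda>y. \<lambda>i\<in>{1..n}. 0) \<mu> = ennreal (\<Sum>i=1..n. (\<mu> i)\<^sup>2)"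
proof -
  show "(\<lambda>y. \<lambda>i\<in>{1..n}. 0) \<in> estimators n"
    unfolding vec_space_def by measurable
  interpret prob_space "obs_law n \<sigma> \<mu>" by (rule prob_space_obs_law)
  show "risk n \<sigma> (\<lambda>y. \<lambda>i\<in>{1..n}. 0) \<mu> = ennreal (\<Sum>i=1..n. (\<mu> i)\<^sup>2)"
    unfolding risk_def by (simp add: emeasure_space_1)
qed

lemma minimax_risk_le:
  assumes "est \<in> estimators n"
    and "\<And>\<mu>. \<mu> \<in> lp_ball n p \<sigma> \<eta> \<Longrightarrow> risk n \<sigma> est \<mu> \<le> B"
  shows "minimax_risk n p \<sigma> \<eta> \<le> B"
  unfolding minimax_risk_def sup_risk_def
  using assms by (intro INF_lower2[OF assms(1)] SUP_least)

lemma risk_identity_le: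
  assumes "\<sigma> > 0"
  shows "risk n \<sigma> (\<lambda>y. y) \<mu> \<le> ennreal (8 * (real n * \<sigma>\<^sup>2))"
proof -
  have "risk n \<sigma> (\<lambda>y. y) \<mu> = (\<integral>\<^sup>+z. ennreal (\<sigma>\<^sup>2) * ennreal (\<Sum>i=1..n. (z i)\<^sup>2) \<partial>noise_law n)"
    unfolding risk_eq_noise[OF measurable_ident_sets[OF refl], unfolded id_def]
    by (simp add: ennreal_mult'[symmetric] sum_distrib_left power_mult_distrib)
  also have "\<dots> = ennreal (\<sigma>\<^sup>2) * noise_mean n (\<lambda>z. \<Sum>i=1..n. (z i)\<^sup>2)"
    by (intro nn_integral_cmult measurable_compose[OF measurable_sum_squares measurable_ennreal]) simp
  also have "\<dots> \<le> ennreal (\<sigma>\<^sup>2) * ennreal (8 * real (card {1..n}))"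
    by (intro mult_left_mono noise_sum_squares_le) auto
  finally show ?thesis by (simp add: ennreal_mult'[symmetric] ac_simps)
qed

definition hard_threshold :: "nat \<Rightarrow> real \<Rightarrow> (nat \<Rightarrow> real) \<Rightarrow> nat \<Rightarrow> real" where
  "hard_threshold n t y = (\<lambda>i\<in>{1..n}. if t < \<bar>y i\<bar> then y i else 0)"

lemma measurable_hard_threshold: "hard_threshold n t \<in> estimators n"
  unfolding hard_threshold_def[abs_def] vec_space_def by measurable

text \<open>If the noise is at most half the threshold, a kept coordinate has error at most
  \<open>min\<close> and a killed one has \<open>\<bar>m\<bar> \<le> 3 / 2 * t\<close>, whence
  \<open>9 / 4\<close>. Otherwise the error is at most three times the noise and
  \<open>z\<^sup>2 \<ge> l\<^sup>2 / 4\<close>; this converts part of the exponential moment into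
  the factor \<open>exp (- l\<^sup>2 / 16)\<close>, and \<open>exp (3 / 4 * z\<^sup>2 / 2)\<close>
  still has finite mean.\<close>

lemma hard_threshold_loss:
  fixes m z l \<sigma> :: real
  assumes "\<sigma> > 0" "l > 0"
  defines "y \<equiv> m + \<sigma> * z"
  shows "((if \<sigma> * l < \<bar>y\<bar> then y else 0) - m)\<^sup>2
    \<le> 9 / 4 * min (m\<^sup>2) ((\<sigma> * l)\<^sup>2) + \<sigma>\<^sup>2 * (72 * exp (- l\<^sup>2 / 16) * exp (3 / 4 * z\<^sup>2 / 2))"
proof -
  define t where "t = \<sigma> * l"
  have t: "0 < t" using assms by (simp add: t_def)
  define w where "w = \<sigma> * z"
  let ?d = "(if t < \<bar>y\<bar> then y else 0) - m"
  have y: "y = m + w" by (simp add: y_def w_def)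
  have mn0: "0 \<le> min (m\<^sup>2) (t\<^sup>2)" by simp
  show ?thesis
  proof (cases "\<bar>w\<bar> \<le> t / 2")
    case True
    have "?d\<^sup>2 \<le> 9 / 4 * min (m\<^sup>2) (t\<^sup>2)"
    proof (cases "t < \<bar>y\<bar>")
      case kept: True
      then have "\<bar>w\<bar> \<le> \<bar>m\<bar>" "\<bar>w\<bar> \<le> \<bar>t\<bar>" using True y t by linarith+
      then have "w\<^sup>2 \<le> min (m\<^sup>2) (t\<^sup>2)" by (simp add: abs_le_square_iff)
      moreover have "?d = w" using kept y by simp
      ultimately have "?d\<^sup>2 \<le> min (m\<^sup>2) (t\<^sup>2)" by simp
      then show ?thesis using mn0 by linarith
    next
      case False
      then have "\<bar>m\<bar> \<le> \<bar>3 / 2 * t\<bar>" using True y t by linarith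
      then have "m\<^sup>2 \<le> (3 / 2 * t)\<^sup>2" by (simp only: abs_le_square_iff)
      then show ?thesis using False by (simp add: power_mult_distrib power2_eq_square min_def)
    qed
    moreover have "0 \<le> \<sigma>\<^sup>2 * (72 * exp (- l\<^sup>2 / 16) * exp (3 / 4 * z\<^sup>2 / 2))" by simp
    ultimately show ?thesis unfolding t_def by linarith
  next
    case False
    have "\<bar>?d\<bar> \<le> \<bar>3 * w\<bar>" using False y t by (auto simp: abs_if split: if_splits)
    then have "?d\<^sup>2 \<le> (3 * w)\<^sup>2" by (simp only: abs_le_square_iff)
    also have "\<dots> = \<sigma>\<^sup>2 * (9 * z\<^sup>2)" by (simp add: w_def power_mult_distrib)
    also have "\<dots> \<le> \<sigma>\<^sup>2 * (72 * exp (- l\<^sup>2 / 16) * exp (3 / 4 * z\<^sup>2 / 2))"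
    proof (rule mult_left_mono)
      have "z\<^sup>2 / 8 \<le> exp (z\<^sup>2 / 8)" using exp_ge_add_one_self[of "z\<^sup>2 / 8"] by linarith
      then have 1: "9 * z\<^sup>2 \<le> 72 * exp (z\<^sup>2 / 8)" by simp
      have "\<sigma> * (l / 2) \<le> \<sigma> * \<bar>z\<bar>" using False assms by (simp add: w_def t_def abs_mult)
      then have "l / 2 \<le> \<bar>z\<bar>" using assms by simp
      then have "(l / 2)\<^sup>2 \<le> \<bar>z\<bar>\<^sup>2" using assms by (intro power_mono) auto
      then have "l\<^sup>2 / 4 \<le> z\<^sup>2" by (simp add: power_divide)
      then have "z\<^sup>2 / 8 \<le> - l\<^sup>2 / 16 + 3 / 4 * z\<^sup>2 / 2" by simp
      then have "exp (z\<^sup>2 / 8) \<le> exp (- l\<^sup>2 / 16) * exp (3 / 4 * z\<^sup>2 / 2)" by (simp add: exp_add[symmetric])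
      then show "9 * z\<^sup>2 \<le> 72 * exp (- l\<^sup>2 / 16) * exp (3 / 4 * z\<^sup>2 / 2)" using 1 by simp
    qed simp
    finally show ?thesis using mn0 unfolding t_def by linarith
  qed
qed

lemma risk_hard_threshold_le:
  assumes "\<sigma> > 0" "l > 0"
  shows "risk n \<sigma> (hard_threshold n (\<sigma> * l)) \<mu>
    \<le> ennreal (9 / 4 * (\<Sum>i=1..n. min ((\<mu> i)\<^sup>2) ((\<sigma> * l)\<^sup>2)) + real n * (\<sigma>\<^sup>2 * (144 * exp (- l\<^sup>2 / 16))))"
  unfolding risk_eq_noise[OF measurable_hard_threshold]
proof (rule nn_integral_noise_sum_le[of "{1..n}" n, unfolded card_atLeastAtMost diff_Suc_1])
  let ?f = "\<lambda>z. \<sigma>\<^sup>2 * (72 * exp (- l\<^sup>2 / 16) * exp (3 / 4 * z\<^sup>2 / 2))"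
  show "?f \<in> borel_measurable borel" by measurable
  have s: "sqrt (1 - 3 / 4) = (1 / 2 :: real)" by (simp add: real_sqrt_divide)
  have "gauss_mean ?f = (\<integral>\<^sup>+x. ennreal (\<sigma>\<^sup>2 * (72 * exp (- l\<^sup>2 / 16))) * ennreal (exp (3 / 4 * x\<^sup>2 / 2)) \<partial>gauss)"
    by (simp add: ennreal_mult'[symmetric] ac_simps)
  also have "\<dots> = ennreal (\<sigma>\<^sup>2 * (72 * exp (- l\<^sup>2 / 16))) * ennreal 2"
    using gauss_exp_square[of "3 / 4"] unfolding s by (subst nn_integral_cmult) auto
  also have "\<dots> = ennreal (\<sigma>\<^sup>2 * (144 * exp (- l\<^sup>2 / 16)))" by (subst ennreal_mult'[symmetric]) auto
  finally show "gauss_mean ?f \<le> ennreal (\<sigma>\<^sup>2 * (144 * exp (- l\<^sup>2 / 16)))" by simp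
  show "(\<Sum>i=1..n. (hard_threshold n (\<sigma> * l) (\<lambda>i\<in>{1..n}. \<mu> i + \<sigma> * z i) i - \<mu> i)\<^sup>2)
    \<le> 9 / 4 * (\<Sum>i=1..n. min ((\<mu> i)\<^sup>2) ((\<sigma> * l)\<^sup>2)) + (\<Sum>i=1..n. ?f (z i))" for z
    unfolding sum_distrib_left[of "9 / 4"] sum.distrib[symmetric]
  proof (rule sum_mono)
    fix i assume "i \<in> {1..n}"
    then have eq: "hard_threshold n (\<sigma> * l) (\<lambda>i\<in>{1..n}. \<mu> i + \<sigma> * z i) i
      = (if \<sigma> * l < \<bar>\<mu> i + \<sigma> * z i\<bar> then \<mu> i + \<sigma> * z i else 0)"
      by (simp add: hard_threshold_def)
    show "(hard_threshold n (\<sigma> * l) (\<lambda>i\<in>{1..n}. \<mu> i + \<sigma> * z i) i - \<mu> i)\<^sup>2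
      \<le> 9 / 4 * min ((\<mu> i)\<^sup>2) ((\<sigma> * l)\<^sup>2) + ?f (z i)"
      unfolding eq by (rule hard_threshold_loss[OF assms])
  qed
qed (auto intro!: sum_nonneg)

section \<open>From inequalities to orders of magnitude\<close>

lemma is_bigoI:
  assumes "\<forall>\<^sub>F n in sequentially. f n \<le> ennreal (C * g n)" "\<forall>\<^sub>F n in sequentially. 0 \<le> g n" "0 \<le> C"
  shows "is_bigo f g"
  unfolding is_bigo_def
proof (intro bexI[of _ "\<lambda>n. enn2real (f n)"])
  show "\<forall>\<^sub>F n in sequentially. f n = ennreal (enn2real (f n))"
    using assms(1)
  proof eventually_elim
    case (elim n)
    then have "f n < \<infinity>" by (rule le_less_trans) simp
    then show ?case by simp
  qed
  show "(\<lambda>n. enn2real (f n)) \<in> O(g)"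
  proof (rule bigoI[of _ C])
    show "\<forall>\<^sub>F n in sequentially. norm (enn2real (f n)) \<le> C * norm (g n)"
      using assms(1,2)
    proof eventually_elim
      case (elim n)
      then have "enn2real (f n) \<le> enn2real (ennreal (C * g n))" by (intro enn2real_mono) auto
      then show ?case using elim assms(3) by simp
    qed
  qed
qed

text \<open>Only the sum is controlled; cutting \<open>f\<close> at \<open>C * g1\<close> yields two
  summands of the required orders.\<close>

lemma is_bigo_sumI:
  assumes f: "\<forall>\<^sub>F n in sequentially. f n \<le> ennreal (C * (g1 n + g2 n))"
    and g: "\<forall>\<^sub>F n in sequentially. 0 \<le> g1 n" "\<forall>\<^sub>F n in sequentially. 0 \<le> g2 n" and C: "0 \<le> C"
  shows "is_bigo_sum f g1 g2"
  unfolding is_bigo_sum_def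
proof (rule bexI[of _ "\<lambda>n. min (enn2real (f n)) (C * g1 n)"],
    rule bexI[of _ "\<lambda>n. enn2real (f n) - min (enn2real (f n)) (C * g1 n)"])
  show "\<forall>\<^sub>F n in sequentially. f n = ennreal (min (enn2real (f n)) (C * g1 n) + (enn2real (f n) - min (enn2real (f n)) (C * g1 n)))"
    using f
  proof eventually_elim
    case (elim n)
    then have "f n < \<infinity>" by (rule le_less_trans) simp
    then show ?case by simp
  qed
  show "(\<lambda>n. min (enn2real (f n)) (C * g1 n)) \<in> O(g1)"
  proof (rule bigoI[of _ C])
    show "\<forall>\<^sub>F n in sequentially. norm (min (enn2real (f n)) (C * g1 n)) \<le> C * norm (g1 n)"
      using g(1)
    proof eventually_elim
      case (elim n)
      then have "0 \<le> C * g1 n" using C by simp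
      then show ?case using elim by (simp add: min_def)
    qed
  qed
  show "(\<lambda>n. enn2real (f n) - min (enn2real (f n)) (C * g1 n)) \<in> O(g2)"
  proof (rule bigoI[of _ C])
    show "\<forall>\<^sub>F n in sequentially. norm (enn2real (f n) - min (enn2real (f n)) (C * g1 n)) \<le> C * norm (g2 n)"
      using f g
    proof eventually_elim
      case (elim n)
      then have "enn2real (f n) \<le> enn2real (ennreal (C * (g1 n + g2 n)))" by (intro enn2real_mono) auto
      also have "\<dots> = C * (g1 n + g2 n)" using elim C by simp
      finally have le: "enn2real (f n) \<le> C * g1 n + C * g2 n" by (simp add: distrib_left)
      have nn: "0 \<le> C * g1 n" "0 \<le> C * g2 n" using elim C by auto
      have "\<bar>enn2real (f n) - min (enn2real (f n)) (C * g1 n)\<bar> \<le> C * g2 n"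
        using le nn by (auto simp: min_def)
      then show ?case using elim by simp
    qed
  qed
qed

lemma same_orderI:
  assumes lower: "\<forall>\<^sub>F n in sequentially. ennreal (c * g n) \<le> f n"
    and upper: "\<forall>\<^sub>F n in sequentially. f n \<le> ennreal (C * g n)"
    and g: "\<forall>\<^sub>F n in sequentially. 0 < g n" and c: "0 < c"
  shows "same_order f g"
  unfolding same_order_def
proof (intro conjI)
  have "\<forall>\<^sub>F n in sequentially. ennreal c \<le> f n / ennreal (g n)"
    using lower g
  proof eventually_elim
    case (elim n)
    have "ennreal c = ennreal (c * g n) / ennreal (g n)"
      using elim c by (subst divide_ennreal) auto
    also have "\<dots> \<le> f n / ennreal (g n)" using elim by (intro divide_right_mono_ennreal)
    finally show ?case .
  qed
  then have "ennreal c \<le> liminf (\<lambda>n. f n / ennreal (g n))" by (rule Liminf_bounded)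
  moreover have "0 < ennreal c" using c by simp
  ultimately show "0 < liminf (\<lambda>n. f n / ennreal (g n))" by (rule less_le_trans[rotated])
  show "liminf (\<lambda>n. f n / ennreal (g n)) \<le> limsup (\<lambda>n. f n / ennreal (g n))"
    by (rule Liminf_le_Limsup) simp
  have "\<forall>\<^sub>F n in sequentially. f n / ennreal (g n) \<le> ennreal (max C 0)"
    using upper g
  proof eventually_elim
    case (elim n)
    have "f n / ennreal (g n) \<le> ennreal (max C 0 * g n) / ennreal (g n)"
      using elim by (intro divide_right_mono_ennreal order_trans[OF elim(1)] ennreal_leI mult_right_mono) auto
    also have "\<dots> = ennreal (max C 0)" using elim by (subst divide_ennreal) auto
    finally show ?case .
  qed
  then have "limsup (\<lambda>n. f n / ennreal (g n)) \<le> ennreal (max C 0)" by (rule Limsup_bounded)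
  then show "limsup (\<lambda>n. f n / ennreal (g n)) < \<infinity>" by (rule le_less_trans) simp
qed

section \<open>Rates\<close>

lemma poly_geometric_bounded:
  fixes rho :: real
  assumes "0 < rho" "rho < 1"
  obtains D where "0 < D" "\<And>n. (real n + 1)\<^sup>2 * rho ^ n \<le> D"
proof -
  have "(\<lambda>n. (real n + 1)\<^sup>2 * rho ^ n) \<longlonglongrightarrow> 0" using assms by real_asymp
  then have "Bseq (\<lambda>n. (real n + 1)\<^sup>2 * rho ^ n)" by (intro convergent_imp_Bseq convergentI)
  then obtain D where "0 < D" "\<And>n. norm ((real n + 1)\<^sup>2 * rho ^ n) \<le> D" by (auto elim: BseqE)
  then show ?thesis using that[of D] by (auto dest: abs_le_D1)
qed

lemma poly_geometric_small:
  fixes rho \<beta> :: real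
  assumes "0 < rho" "rho < 1"
  shows "\<forall>\<^sub>F n in sequentially. (real n + 1)\<^sup>2 * rho ^ n \<le> real n powr (- \<beta>) * ln (real n)"
  using assms by real_asymp

lemma exp_half_le_two: "exp (1/2) \<le> (2::real)"
proof -
  have "(exp (1/2))\<^sup>2 = exp (1::real)" by (simp add: power2_eq_square exp_add[symmetric])
  then have "(exp (1/2))\<^sup>2 \<le> (2::real)\<^sup>2" using exp_le by simp
  then show ?thesis by (rule power2_le_imp_le) simp
qed

text \<open>Blocks of length 2 with spikes of height \<open>\<sigma> * u\<close>:
  \<open>u \<le> 1/2\<close> gives \<open>exp (2 * u\<^sup>2) \<le> exp (1/2) \<le> 2\<close>, the
  largest value allowed for \<open>m = 2\<close>.\<close>

lemma minimax_risk_cube_lower_bound: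
  assumes "0 < p" "n \<ge> 2" "0 < \<sigma>" "0 < \<eta>" and u: "0 < u" "u \<le> 1/2" "u \<le> \<eta>"
  shows "ennreal (u\<^sup>2 / 12 * (real n * \<sigma>\<^sup>2)) \<le> minimax_risk n p \<sigma> \<eta>"
proof -
  define h where "h = \<sigma> * u"
  have h: "0 \<le> h" "h \<le> \<sigma> * \<eta>" using assms by (auto simp: h_def)
  have "2 * h\<^sup>2 / \<sigma>\<^sup>2 = 2 * u\<^sup>2" using assms by (simp add: h_def power_mult_distrib)
  also have "\<dots> \<le> 2 * (1/2)\<^sup>2" using u by (intro mult_left_mono power_mono) auto
  finally have "exp (2 * h\<^sup>2 / \<sigma>\<^sup>2) \<le> exp (1/2)" by (simp add: power2_eq_square)
  then have e: "exp (2 * h\<^sup>2 / \<sigma>\<^sup>2) \<le> 2 * (real 2 - 1)" using order_trans[OF _ exp_half_le_two] by simp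
  have k: "real n / 4 \<le> real (n div 2)"
  proof -
    have "n \<le> 2 * (n div 2) + 1" by linarith
    then have "real n \<le> 2 * real (n div 2) + 1" by linarith
    then show ?thesis using assms(2) by linarith
  qed
  have "u\<^sup>2 / 12 * (real n * \<sigma>\<^sup>2) = real n / 4 * (h\<^sup>2 / 3)" by (simp add: h_def power_mult_distrib)
  also have "\<dots> \<le> real (n div 2) * (h\<^sup>2 / 3)" using k by (intro mult_right_mono) auto
  finally have "ennreal (u\<^sup>2 / 12 * (real n * \<sigma>\<^sup>2)) \<le> ennreal (real (n div 2) * h\<^sup>2 / 3)"
    by (intro ennreal_leI) simp
  also have "\<dots> \<le> minimax_risk n p \<sigma> \<eta>"
    using assms h by (intro minimax_risk_lower_bound[OF assms(3) _ _ e] two_valued_mem_lp_ball_cube) auto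
  finally show ?thesis .
qed

lemma minimax_risk_l2_upper_bound:
  assumes "\<And>\<mu>. \<mu> \<in> lp_ball n p \<sigma> \<eta> \<Longrightarrow> (\<Sum>i=1..n. (\<mu> i)\<^sup>2) \<le> B"
  shows "minimax_risk n p \<sigma> \<eta> \<le> ennreal B"
  using assms by (intro minimax_risk_le[OF risk_zero(1)]) (auto simp: risk_zero(2) intro: ennreal_leI)

text \<open>A single block of length \<open>n\<close> whose spike has half of the maximal height
  \<open>\<sigma> * s\<close>. The smallness of the radius says
  \<open>s\<^sup>2 \<le> 2 * ln n\<close>, so the likelihood condition reduces to
  \<open>n \<le> 2 * (n - 1)\<close>.\<close>

lemma minimax_risk_spike_lower_bound:
  assumes q: "0 < q" and "n \<ge> 2" "0 < \<sigma>" "0 < \<eta>"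
    and small: "\<eta> powr q < 1 / real n * (2 * ln (real n)) powr (q / 2)"
  shows "ennreal (1 / 12 * (\<sigma>\<^sup>2 * real n powr (2 / q) * \<eta>\<^sup>2)) \<le> minimax_risk n (ereal q) \<sigma> \<eta>"
proof -
  define s where "s = real n powr (1 / q) * \<eta>"
  define h where "h = \<sigma> * s / 2"
  have s: "0 \<le> s" using assms by (simp add: s_def)
  have n0: "0 < real n" and ln0: "0 < ln (real n)" using assms by auto
  have sq: "s powr q = real n * \<eta> powr q" using assms by (simp add: s_def powr_mult powr_powr)
  have "s powr q \<le> (2 * ln (real n)) powr (q / 2)"
    unfolding sq using small n0 by (simp add: field_simps)
  also have "\<dots> = sqrt (2 * ln (real n)) powr q"
    using ln0 by (simp add: powr_half_sqrt[symmetric] powr_powr)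
  finally have "s \<le> sqrt (2 * ln (real n))" using q s ln0 by (subst (asm) powr_le_powr_iff) auto
  then have "s\<^sup>2 \<le> (sqrt (2 * ln (real n)))\<^sup>2" using s by (intro power_mono)
  then have s2: "s\<^sup>2 \<le> 2 * ln (real n)" using ln0 by simp
  have "2 * h\<^sup>2 / \<sigma>\<^sup>2 = s\<^sup>2 / 2" using assms by (simp add: h_def power_mult_distrib power_divide)
  also have "\<dots> \<le> ln (real n)" using s2 by simp
  finally have "exp (2 * h\<^sup>2 / \<sigma>\<^sup>2) \<le> exp (ln (real n))" by simp
  also have "\<dots> = real n" using n0 by simp
  also have "\<dots> \<le> 2 * (real n - 1)" using assms(2) by simp
  finally have e: "exp (2 * h\<^sup>2 / \<sigma>\<^sup>2) \<le> 2 * (real n - 1)" .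
  have hq: "real 1 * h powr q \<le> real n * (\<sigma> * \<eta>) powr q"
  proof -
    have "h powr q \<le> (\<sigma> * s) powr q" using assms s by (intro powr_mono2) (auto simp: h_def)
    also have "\<dots> = real n * (\<sigma> * \<eta>) powr q" using assms s by (simp add: powr_mult sq)
    finally show ?thesis by simp
  qed
  have "real n powr (2 / q) = (real n powr (1 / q))\<^sup>2"
    by (simp add: power2_eq_square powr_add[symmetric] add_divide_distrib[symmetric])
  then have "1 / 12 * (\<sigma>\<^sup>2 * real n powr (2 / q) * \<eta>\<^sup>2) = real 1 * h\<^sup>2 / 3"
    by (simp add: h_def s_def power_mult_distrib power_divide)
  then have "ennreal (1 / 12 * (\<sigma>\<^sup>2 * real n powr (2 / q) * \<eta>\<^sup>2)) = ennreal (real 1 * h\<^sup>2 / 3)" by simp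
  also have "\<dots> \<le> minimax_risk n (ereal q) \<sigma> \<eta>"
    using assms s hq by (intro minimax_risk_lower_bound[OF assms(3,2) _ e] two_valued_mem_lp_ball[where k = 1])
      (auto simp: h_def)
  finally show ?thesis .
qed

section \<open>The sparse regime of Case 3\<close>

lemma ln_binomial_le:
  assumes "1 \<le> k" "k \<le> n"
  shows "ln (real (n choose k)) \<le> real k * (1 + ln (real n / real k))"
proof -
  have C: "0 < real (n choose k)" using assms by simp
  have k: "0 < real k" "0 < real n" using assms by auto
  \<comment> \<open>One term of the exponential series. Combined with
    \<open>(n choose k) * fact k \<le> n ^ k\<close> it bounds the binomial coefficient by
    \<open>exp k * (n / k) ^ k\<close>.\<close>
  have "real k ^ k / fact k \<le> exp (real k)"
  proof -
    have "(\<lambda>i. real k ^ i / fact i) sums exp (real k)" using exp_converges[of "real k"] by (simp add: field_simps)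
    from sum_le_suminf[OF sums_summable[OF this], of "{k}"] sums_unique[OF this]
    show ?thesis by simp
  qed
  moreover have "real (n choose k) * fact k \<le> real n ^ k"
    using binomial_fact_pow[of n k] by (metis of_nat_fact of_nat_le_iff of_nat_mult of_nat_power)
  ultimately have "(real (n choose k) * fact k) * (real k ^ k / fact k) \<le> real n ^ k * exp (real k)"
    by (intro mult_mono) auto
  then have "real (n choose k) \<le> exp (real k) * (real n / real k) ^ k"
    using k by (simp add: power_divide field_simps)
  then have "ln (real (n choose k)) \<le> ln (exp (real k) * (real n / real k) ^ k)"
    using C k by (subst ln_le_cancel_iff) auto
  also have "\<dots> = real k + real k * ln (real n / real k)"
    using k by (subst ln_mult) (auto simp: ln_realpow)
  finally show ?thesis by (simp add: distrib_left)
qed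

text \<open>The squared threshold in units of \<open>\<sigma>\<^sup>2\<close>; the rate of Case 3 is
  \<open>\<sigma>\<^sup>2\<close> times \<open>sparsity\<close> times this value.\<close>

definition sparse_log :: "real \<Rightarrow> real \<Rightarrow> real" where
  "sparse_log q \<eta> = 2 * ln (\<eta> powr (- q))"

text \<open>At most \<open>sparsity q \<eta> n\<close> coordinates of a point of the ball exceed \<open>\<sigma> \<surd>(sparse_log q \<eta>)\<close>.\<close>

definition sparsity :: "real \<Rightarrow> real \<Rightarrow> nat \<Rightarrow> real" where
  "sparsity q \<eta> n = real n * \<eta> powr q * sparse_log q \<eta> powr (- (q / 2))"

context
  fixes q \<eta> \<sigma> :: real and n :: nat
  assumes q: "0 < q" "q < 2" and n: "n \<ge> 2" and \<sigma>: "0 < \<sigma>" and \<eta>: "0 < \<eta>"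
    and lower: "1 / real n * (2 * ln (real n)) powr (q / 2) \<le> \<eta> powr q"
    and upper: "\<eta> powr q \<le> exp (- (9 / 2))"
begin

lemma sparse_log_exp: "\<eta> powr q = exp (- (sparse_log q \<eta> / 2))"
  using \<eta> by (simp add: sparse_log_def powr_def)

lemma sparse_log_ge: "9 \<le> sparse_log q \<eta>"
  using upper unfolding sparse_log_exp by simp

lemma sparse_log_le: "sparse_log q \<eta> \<le> 2 * ln (real n)"
proof -
  \<comment> \<open>This gives \<open>2 * ln n \<ge> 1\<close>, so the power in \<open>lower\<close>
    is at least 1 and \<open>\<eta> powr q \<ge> 1 / n\<close>.\<close>
  have "2 / 3 \<le> ln (2::real)" by (rule ln2_ge_two_thirds)
  also have "\<dots> \<le> ln (real n)" using n by simp
  finally have "1 \<le> (2 * ln (real n)) powr (q / 2)" using q by (intro ge_one_powr_ge_zero) auto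
  then have "1 / real n \<le> 1 / real n * (2 * ln (real n)) powr (q / 2)" using n by (simp add: divide_right_mono)
  also have "\<dots> \<le> exp (- (sparse_log q \<eta> / 2))" using lower by (simp only: sparse_log_exp)
  finally have "ln (1 / real n) \<le> ln (exp (- (sparse_log q \<eta> / 2)))" using n by (subst ln_le_cancel_iff) auto
  then show ?thesis using n by (simp add: ln_div)
qed

text \<open>The lower end of the radius range serves this purpose: the sparsity does not drop below
  one, so rounding it down costs at most a factor 2.\<close>

lemma sparsity_ge: "1 \<le> sparsity q \<eta> n"
proof -
  have "sparse_log q \<eta> powr (q / 2) \<le> (2 * ln (real n)) powr (q / 2)"
    using sparse_log_le sparse_log_ge q by (intro powr_mono2) auto
  also have "\<dots> \<le> real n * \<eta> powr q" using lower n by (simp add: field_simps)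
  finally show ?thesis using sparse_log_ge by (simp add: sparsity_def powr_minus_divide)
qed

lemma sparsity_le: "sparsity q \<eta> n \<le> real n * \<eta> powr q"
proof -
  have "sparse_log q \<eta> powr (- (q / 2)) \<le> sparse_log q \<eta> powr 0" using sparse_log_ge q by (intro powr_mono) auto
  then have "sparse_log q \<eta> powr (- (q / 2)) \<le> 1" using sparse_log_ge by simp
  from mult_left_mono[OF this, of "real n * \<eta> powr q"] show ?thesis by (simp add: sparsity_def)
qed

lemma sparsity_mult_log:
  "sparsity q \<eta> n * sparse_log q \<eta> = real n * \<eta> powr q * sparse_log q \<eta> powr (1 - q / 2)"
  "sparsity q \<eta> n * sparse_log q \<eta> powr (q / 2) = real n * \<eta> powr q"
proof -
  have "sparse_log q \<eta> powr (1 - q / 2) = sparse_log q \<eta> powr (- (q / 2)) * sparse_log q \<eta> powr 1"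
    by (subst powr_add[symmetric]) simp
  then show "sparsity q \<eta> n * sparse_log q \<eta> = real n * \<eta> powr q * sparse_log q \<eta> powr (1 - q / 2)"
    using sparse_log_ge by (simp add: sparsity_def)
  show "sparsity q \<eta> n * sparse_log q \<eta> powr (q / 2) = real n * \<eta> powr q"
    using sparse_log_ge by (simp add: sparsity_def powr_minus)
qed

lemma sparsity_floor:
  "1 \<le> nat \<lfloor>sparsity q \<eta> n\<rfloor>" "real (nat \<lfloor>sparsity q \<eta> n\<rfloor>) \<le> sparsity q \<eta> n" "sparsity q \<eta> n \<le> 2 * real (nat \<lfloor>sparsity q \<eta> n\<rfloor>)"
  "nat \<lfloor>sparsity q \<eta> n\<rfloor> \<le> n"
proof -
  show 1: "1 \<le> nat \<lfloor>sparsity q \<eta> n\<rfloor>" using sparsity_ge by (simp add: le_nat_floor)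
  show 2: "real (nat \<lfloor>sparsity q \<eta> n\<rfloor>) \<le> sparsity q \<eta> n" using sparsity_ge by simp
  have "sparsity q \<eta> n < real (nat \<lfloor>sparsity q \<eta> n\<rfloor>) + 1" using sparsity_ge by linarith
  then show "sparsity q \<eta> n \<le> 2 * real (nat \<lfloor>sparsity q \<eta> n\<rfloor>)" using 1 by linarith
  have "\<eta> powr q \<le> 1" using upper by (rule order_trans) simp
  then have "real n * \<eta> powr q \<le> real n * 1" by (intro mult_left_mono) auto
  then show "nat \<lfloor>sparsity q \<eta> n\<rfloor> \<le> n" using 2 sparsity_le by linarith
qed

text \<open>As many blocks as the rounded sparsity, with spikes of half the threshold, so that
  \<open>exp (2 * h\<^sup>2 / \<sigma>\<^sup>2) = \<eta> powr (- q)\<close>. This is at most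
  \<open>n / k\<close>, hence at most \<open>m + 1\<close>; being at least 4 it forces
  \<open>m \<ge> 3\<close>, and then \<open>m + 1 \<le> 2 * (m - 1)\<close>.\<close>

lemma minimax_risk_sparse_lower_bound:
  "ennreal (1 / 24 * (\<sigma>\<^sup>2 * real n * \<eta> powr q * sparse_log q \<eta> powr (1 - q / 2)))
    \<le> minimax_risk n (ereal q) \<sigma> \<eta>"
proof -
  let ?L = "sparse_log q \<eta>"
  define k where "k = nat \<lfloor>sparsity q \<eta> n\<rfloor>"
  define m where "m = n div k"
  define h where "h = \<sigma> * sqrt ?L / 2"
  define x where "x = \<eta> powr q"
  have L: "9 \<le> ?L" by (rule sparse_log_ge)
  have x: "0 < x" using \<eta> by (simp add: x_def)
  have k: "1 \<le> k" "real k \<le> sparsity q \<eta> n" "sparsity q \<eta> n \<le> 2 * real k" using sparsity_floor by (auto simp: k_def)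
  have km: "k * m \<le> n" by (simp add: m_def)
  have h2: "2 * h\<^sup>2 / \<sigma>\<^sup>2 = ?L / 2" using \<sigma> L by (simp add: h_def power_mult_distrib power_divide)
  have ex: "exp (?L / 2) = 1 / x" unfolding x_def sparse_log_exp by (simp add: exp_minus field_simps)
  have m1: "1 / x \<le> real m + 1"
  proof -
    have "real k * (1 / x) \<le> real n"
      using k(2) sparsity_le x by (simp add: x_def pos_divide_le_eq)
    moreover have "n \<le> k * (m + 1)"
      unfolding m_def using k(1) dividend_less_times_div[of k n] by (simp add: algebra_simps)
    then have "real n \<le> real k * (real m + 1)" by (metis of_nat_1 of_nat_add of_nat_le_iff of_nat_mult)
    ultimately have "real k * (1 / x) \<le> real k * (real m + 1)" by linarith
    then show ?thesis by (rule mult_left_le_imp_le) (use k(1) in simp)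
  qed
  have x4: "4 \<le> 1 / x"
  proof -
    have "4 \<le> 1 + ?L / 2" using L by simp
    also have "\<dots> \<le> exp (?L / 2)" by (rule exp_ge_add_one_self)
    finally show ?thesis by (simp only: ex)
  qed
  have e: "exp (2 * h\<^sup>2 / \<sigma>\<^sup>2) \<le> 2 * (real m - 1)"
  proof -
    have "w \<le> 2 * (real m - 1)" if "w \<le> real m + 1" "4 \<le> w" for w using that by (simp add: algebra_simps)
    then show ?thesis unfolding h2 ex using m1 x4 by blast
  qed
  have m2: "2 \<le> m"
  proof -
    have "3 \<le> real m" using order_trans[OF x4 m1] by simp
    then show ?thesis by simp
  qed
  have ball: "real k * h powr q \<le> real n * (\<sigma> * \<eta>) powr q"
  proof -
    have "h powr q \<le> (\<sigma> * sqrt ?L) powr q" using \<sigma> L q by (intro powr_mono2) (auto simp: h_def)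
    also have "\<dots> = \<sigma> powr q * ?L powr (q / 2)"
      using \<sigma> L by (simp add: powr_mult powr_half_sqrt[symmetric] powr_powr)
    finally have "real k * h powr q \<le> sparsity q \<eta> n * (\<sigma> powr q * ?L powr (q / 2))"
      using k sparsity_ge by (intro mult_mono) auto
    also have "\<dots> = real n * (\<sigma> * \<eta>) powr q"
      using sparsity_mult_log(2) \<sigma> \<eta> by (simp add: powr_mult ac_simps)
    finally show ?thesis .
  qed
  have "1 / 24 * (\<sigma>\<^sup>2 * real n * \<eta> powr q * ?L powr (1 - q / 2)) = \<sigma>\<^sup>2 * (sparsity q \<eta> n * ?L) / 24"
    unfolding sparsity_mult_log(1) by simp
  also have "\<dots> \<le> \<sigma>\<^sup>2 * ((2 * real k) * ?L) / 24"
    using k L by (intro divide_right_mono mult_left_mono mult_right_mono) auto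
  also have "\<dots> = real k * h\<^sup>2 / 3" using L by (simp add: h_def power_mult_distrib power_divide)
  finally have "ennreal (1 / 24 * (\<sigma>\<^sup>2 * real n * \<eta> powr q * ?L powr (1 - q / 2))) \<le> ennreal (real k * h\<^sup>2 / 3)"
    by (rule ennreal_leI)
  also have "\<dots> \<le> minimax_risk n (ereal q) \<sigma> \<eta>"
    using q \<sigma> \<eta> L ball by (intro minimax_risk_lower_bound[OF \<sigma> m2 km e] two_valued_mem_lp_ball) (auto simp: h_def)
  finally show ?thesis .
qed

text \<open>Hard thresholding with \<open>l\<^sup>2 = 8 * sparse_log q \<eta>\<close>, chosen to
  make \<open>exp (- l\<^sup>2 / 16)\<close> equal to \<open>\<eta> powr q\<close>: the noise term
  then has the order of the bias term up to a power of the logarithm that is at least 1. The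
  constant is \<open>9 / 4 * 8 + 144\<close>.\<close>

lemma minimax_risk_sparse_upper_bound:
  "minimax_risk n (ereal q) \<sigma> \<eta>
    \<le> ennreal (162 * (\<sigma>\<^sup>2 * real n * \<eta> powr q * sparse_log q \<eta> powr (1 - q / 2)))"
proof (rule minimax_risk_le[OF measurable_hard_threshold])
  let ?L = "sparse_log q \<eta>"
  define l where "l = sqrt (8 * ?L)"
  have L: "9 \<le> ?L" by (rule sparse_log_ge)
  have l: "0 < l" using L by (simp add: l_def)
  fix \<mu> assume \<mu>: "\<mu> \<in> lp_ball n (ereal q) \<sigma> \<eta>"
  have ex: "exp (- l\<^sup>2 / 16) = \<eta> powr q" using L by (simp add: l_def sparse_log_exp)
  have lq: "l powr (2 - q) \<le> 8 * ?L powr (1 - q / 2)"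
  proof -
    have "l powr (2 - q) = (8 * ?L) powr (1/2 * (2 - q))"
      unfolding l_def using L by (subst powr_half_sqrt[symmetric]) (auto simp: powr_powr)
    also have "\<dots> = 8 powr (1 - q / 2) * ?L powr (1 - q / 2)"
      using L by (simp add: powr_mult diff_divide_distrib)
    also have "\<dots> \<le> 8 powr 1 * ?L powr (1 - q / 2)" using q by (intro mult_right_mono powr_mono) auto
    finally show ?thesis by simp
  qed
  have L1: "1 \<le> ?L powr (1 - q / 2)" using L q by (intro ge_one_powr_ge_zero) auto
  have "risk n \<sigma> (hard_threshold n (\<sigma> * l)) \<mu>
    \<le> ennreal (9 / 4 * (\<Sum>i=1..n. min ((\<mu> i)\<^sup>2) ((\<sigma> * l)\<^sup>2)) + real n * (\<sigma>\<^sup>2 * (144 * exp (- l\<^sup>2 / 16))))"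
    by (rule risk_hard_threshold_le[OF \<sigma> l])
  also have "\<dots> \<le> ennreal (162 * (\<sigma>\<^sup>2 * real n * \<eta> powr q * ?L powr (1 - q / 2)))"
  proof (rule ennreal_leI)
    define y where "y = \<sigma>\<^sup>2 * real n * \<eta> powr q"
    have y: "0 \<le> y" by (simp add: y_def)
    have "(\<Sum>i=1..n. min ((\<mu> i)\<^sup>2) ((\<sigma> * l)\<^sup>2)) \<le> y * l powr (2 - q)"
      using lp_ball_truncated_sum[OF _ _ \<sigma> \<eta> l \<mu>] q by (simp add: y_def mult.assoc)
    also have "\<dots> \<le> y * (8 * ?L powr (1 - q / 2))" using lq y by (intro mult_left_mono)
    finally have 1: "9 / 4 * (\<Sum>i=1..n. min ((\<mu> i)\<^sup>2) ((\<sigma> * l)\<^sup>2)) \<le> 18 * (y * ?L powr (1 - q / 2))" by simp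
    have "real n * (\<sigma>\<^sup>2 * (144 * exp (- l\<^sup>2 / 16))) = 144 * (y * 1)" unfolding ex by (simp add: y_def)
    also have "\<dots> \<le> 144 * (y * ?L powr (1 - q / 2))" using L1 y by (intro mult_left_mono) auto
    finally show "9 / 4 * (\<Sum>i=1..n. min ((\<mu> i)\<^sup>2) ((\<sigma> * l)\<^sup>2)) + real n * (\<sigma>\<^sup>2 * (144 * exp (- l\<^sup>2 / 16)))
      \<le> 162 * (\<sigma>\<^sup>2 * real n * \<eta> powr q * ?L powr (1 - q / 2))"
      using 1 unfolding y_def[symmetric] by linarith
  qed
  finally show "risk n \<sigma> (hard_threshold n (\<sigma> * sqrt (8 * ?L))) \<mu>
    \<le> ennreal (162 * (\<sigma>\<^sup>2 * real n * \<eta> powr q * ?L powr (1 - q / 2)))" by (simp only: l_def)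
qed

text \<open>The coordinates above the threshold are padded to a set of one prescribed size. The
  prior is not assumed monotone, so smaller sets need not be cheaper; with a fixed size the penalty
  is the same for all \<open>\<mu>\<close>, and padding only lowers the residual.\<close>

lemma sparse_oracle_set:
  assumes \<mu>: "\<mu> \<in> lp_ball n (ereal q) \<sigma> \<eta>"
  obtains M where "M \<subseteq> {1..n}" "card M = nat \<lfloor>sparsity q \<eta> n\<rfloor>"
    and "(\<Sum>i\<in>{1..n} - M. (\<mu> i)\<^sup>2) \<le> \<sigma>\<^sup>2 * (sparsity q \<eta> n * sparse_log q \<eta>)"
proof -
  let ?L = "sparse_log q \<eta>"
  define t where "t = sqrt ?L"
  have L: "9 \<le> ?L" by (rule sparse_log_ge)
  have t: "0 < t" using L by (simp add: t_def)
  have tp: "t powr a = ?L powr (a / 2)" for a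
    unfolding t_def using L by (subst powr_half_sqrt[symmetric]) (auto simp: powr_powr)
  let ?B = "{i \<in> {1..n}. \<sigma> * t < \<bar>\<mu> i\<bar>}"
  have "real (card ?B) \<le> sparsity q \<eta> n"
    using lp_ball_card_large[OF q(1) \<sigma> \<eta> t \<mu>] by (simp add: tp sparsity_def)
  then have "card ?B \<le> nat \<lfloor>sparsity q \<eta> n\<rfloor>" by (simp add: le_nat_floor)
  then obtain M where M: "?B \<subseteq> M" "M \<subseteq> {1..n}" "card M = nat \<lfloor>sparsity q \<eta> n\<rfloor>"
  proof -
    have "?B \<subseteq> {1..n}" "nat \<lfloor>sparsity q \<eta> n\<rfloor> \<le> card {1..n}" using sparsity_floor(4) by auto
    with \<open>card ?B \<le> _\<close> show ?thesis
      using exists_subset_between[of ?B "nat \<lfloor>sparsity q \<eta> n\<rfloor>" "{1..n}"] that finite_atLeastAtMost by blast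
  qed
  have "(\<Sum>i\<in>{1..n} - M. (\<mu> i)\<^sup>2) \<le> (\<Sum>i\<in>{1..n} - M. min ((\<mu> i)\<^sup>2) ((\<sigma> * t)\<^sup>2))"
  proof (rule sum_mono)
    fix i assume "i \<in> {1..n} - M"
    then have "\<bar>\<mu> i\<bar> \<le> \<bar>\<sigma> * t\<bar>" using M(1) by force
    then have "(\<mu> i)\<^sup>2 \<le> (\<sigma> * t)\<^sup>2" by (simp only: abs_le_square_iff)
    then show "(\<mu> i)\<^sup>2 \<le> min ((\<mu> i)\<^sup>2) ((\<sigma> * t)\<^sup>2)" by simp
  qed
  also have "\<dots> \<le> (\<Sum>i=1..n. min ((\<mu> i)\<^sup>2) ((\<sigma> * t)\<^sup>2))" by (intro sum_mono2) auto
  also have "\<dots> \<le> \<sigma>\<^sup>2 * (real n * \<eta> powr q * t powr (2 - q))"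
    using q by (intro lp_ball_truncated_sum[OF _ _ \<sigma> \<eta> t \<mu>]) auto
  also have "real n * \<eta> powr q * t powr (2 - q) = sparsity q \<eta> n * ?L"
    unfolding tp sparsity_mult_log by (simp add: diff_divide_distrib)
  finally show ?thesis using that M by blast
qed

text \<open>The binomial and the prior cost are both of order \<open>k * ln (n / k)\<close>. Since
  \<open>n / k \<le> 2 * exp (L / 2) * L powr (q / 2)\<close> for
  \<open>L = sparse_log q \<eta>\<close>, the logarithm is at most \<open>2 * L\<close>.\<close>

lemma sparse_penalty_bound:
  fixes prior :: "nat pmf"
  assumes c2: "0 < c2" and prior: "(real (nat \<lfloor>sparsity q \<eta> n\<rfloor>) / real n) powr (c2 * real (nat \<lfloor>sparsity q \<eta> n\<rfloor>)) \<le> pmf prior (nat \<lfloor>sparsity q \<eta> n\<rfloor>)"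
  shows "ln (real (n choose nat \<lfloor>sparsity q \<eta> n\<rfloor>)) - ln (pmf prior (nat \<lfloor>sparsity q \<eta> n\<rfloor>)) + real (nat \<lfloor>sparsity q \<eta> n\<rfloor>)
    \<le> (4 + 2 * c2) * (sparsity q \<eta> n * sparse_log q \<eta>)"
proof -
  let ?L = "sparse_log q \<eta>"
  define k where "k = nat \<lfloor>sparsity q \<eta> n\<rfloor>"
  have L: "9 \<le> ?L" by (rule sparse_log_ge)
  have k: "1 \<le> k" "real k \<le> sparsity q \<eta> n" "sparsity q \<eta> n \<le> 2 * real k" "k \<le> n" using sparsity_floor by (auto simp: k_def)
  have k0: "0 < real k" "0 < real n" "0 < sparsity q \<eta> n" using k n by linarith+
  have lnk: "ln (real n / real k) \<le> 2 * ?L"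
  proof -
    have "real n / real k \<le> real n / (sparsity q \<eta> n / 2)" using k k0 by (intro divide_left_mono) auto
    also have "\<dots> = 2 * (real n / sparsity q \<eta> n)" by simp
    finally have "ln (real n / real k) \<le> ln (2 * (real n / sparsity q \<eta> n))" using k0 by (subst ln_le_cancel_iff) auto
    also have "\<dots> = ln 2 + ln (real n / sparsity q \<eta> n)" using k0 by (subst ln_mult) auto
    also have "real n / sparsity q \<eta> n = exp (?L / 2) * ?L powr (q / 2)"
      using k0 L unfolding sparsity_def sparse_log_exp by (simp add: powr_minus exp_minus field_simps)
    also have "ln (exp (?L / 2) * ?L powr (q / 2)) = ?L / 2 + q / 2 * ln ?L"
      using L by (subst ln_mult) (auto simp: ln_powr)
    also have "q / 2 * ln ?L \<le> 1 * ln ?L" using q L by (intro mult_right_mono) auto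
    also have "ln ?L \<le> ?L - 1" using L by (intro ln_le_minus_one) simp
    finally have "ln (real n / real k) \<le> ln 2 + (?L / 2 + 1 * (?L - 1))" by simp
    moreover have "ln 2 \<le> (1::real)" using ln_2_less_1 by simp
    ultimately show ?thesis using L by simp
  qed
  have a: "ln (real (n choose k)) \<le> 3 * (real k * ?L)"
  proof -
    have "ln (real (n choose k)) \<le> real k * (1 + ln (real n / real k))" by (rule ln_binomial_le[OF k(1,4)])
    also have "\<dots> \<le> real k * (3 * ?L)" using lnk L by (intro mult_left_mono) auto
    finally show ?thesis by simp
  qed
  have b: "- ln (pmf prior k) \<le> 2 * c2 * (real k * ?L)"
  proof -
    have "0 < (real k / real n) powr (c2 * real k)" using k0 by simp
    then have "ln ((real k / real n) powr (c2 * real k)) \<le> ln (pmf prior k)"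
      using prior unfolding k_def[symmetric] by (subst ln_le_cancel_iff) linarith+
    then have "- ln (pmf prior k) \<le> c2 * real k * ln (real n / real k)"
      using k0 by (simp add: ln_powr ln_div algebra_simps)
    also have "\<dots> \<le> c2 * real k * (2 * ?L)" using lnk c2 by (intro mult_left_mono) auto
    finally show ?thesis by (simp add: ac_simps)
  qed
  have c: "real k \<le> real k * ?L" using L mult_left_mono[of 1 ?L "real k"] by simp
  have "ln (real (n choose k)) - ln (pmf prior k) + real k \<le> (4 + 2 * c2) * (real k * ?L)"
    using a b c by (simp add: distrib_right)
  also have "\<dots> \<le> (4 + 2 * c2) * (sparsity q \<eta> n * ?L)"
    using k L c2 by (intro mult_left_mono mult_right_mono) auto
  finally show ?thesis by (simp only: k_def)
qed

end

section \<open>The four cases\<close>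

theorem corollary1:
  fixes p :: ereal
    and \<sigma> \<tau> \<gamma> \<eta> :: "nat \<Rightarrow> real"
    and prior :: "nat \<Rightarrow> nat pmf"
    and khat :: "nat \<Rightarrow> (nat \<Rightarrow> real) \<Rightarrow> nat"
    and \<gamma>minus \<gamma>plus \<alpha> \<beta> c0 c1 c2 :: real
  assumes p: "0 < p"
    and \<sigma>: "\<forall>n\<ge>1. \<sigma> n > 0"
    and \<tau>: "\<forall>n\<ge>1. \<tau> n > 0"
    and \<eta>: "\<forall>n\<ge>1. \<eta> n > 0"
    and \<gamma>: "\<forall>n\<ge>1. \<gamma> n = (\<tau> n)\<^sup>2 / (\<sigma> n)\<^sup>2"
    and prior: "\<forall>n\<ge>1. set_pmf (prior n) = {0..n}"
    and khat: "\<forall>n\<ge>1. is_map_selector n (\<sigma> n) (\<gamma> n) (prior n) (khat n)"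
    and \<gamma>_const: "\<gamma>minus > 0" "\<gamma>plus > 0"
    and \<gamma>_bounds: "\<forall>n\<ge>1. \<gamma>minus \<le> \<gamma> n \<and> \<gamma> n \<le> \<gamma>plus"
    and const_signs: "\<beta> \<ge> 0" "c0 > 0" "c1 > 0" "c2 > 0"
    and \<alpha>: "\<alpha> = exp (- 9 / 2) \<or> \<alpha> = exp (- c_const \<gamma>minus)"
    and cond_i: "\<forall>\<^sub>F n in sequentially.
        pmf (prior n) 0 \<ge> real n powr (- c1 * real n powr (- \<beta>))"
    and cond_ii: "\<forall>\<^sub>F n in sequentially. \<forall>\<kappa>. 1 \<le> \<kappa> \<and> real \<kappa> \<le> \<alpha> * real n \<longrightarrow>
        pmf (prior n) \<kappa> \<ge> (real \<kappa> / real n) powr (c2 * real \<kappa>)"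
    and cond_iii: "\<forall>\<^sub>F n in sequentially. pmf (prior n) n \<ge> exp (- c0 * real n)"
  shows
    "let S = (\<lambda>n. sup_risk n p (\<sigma> n) (\<eta> n) (map_estimator n (khat n)));
         R = (\<lambda>n. minimax_risk n p (\<sigma> n) (\<eta> n));
         q = real_of_ereal p
     in
      ((\<forall>\<^sub>F n in sequentially. radius_gt p (\<eta> n) \<alpha>) \<longrightarrow>
         is_bigo S (\<lambda>n. real n * (\<sigma> n)\<^sup>2) \<and>
         same_order R (\<lambda>n. real n * (\<sigma> n)\<^sup>2)) \<and>
      (2 \<le> p \<and> (\<forall>\<^sub>F n in sequentially. radius_le p (\<eta> n) \<alpha>) \<longrightarrow>
         is_bigo_sum S (\<lambda>n. (\<sigma> n)\<^sup>2 * real n * (\<eta> n)\<^sup>2)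
                       (\<lambda>n. (\<sigma> n)\<^sup>2 * real n powr (- \<beta>) * ln (real n)) \<and>
         same_order R (\<lambda>n. (\<sigma> n)\<^sup>2 * real n * (\<eta> n)\<^sup>2)) \<and>
      (p < 2 \<and>
       (\<forall>\<^sub>F n in sequentially.
          1 / real n * (2 * ln (real n)) powr (q / 2) \<le> \<eta> n powr q \<and> \<eta> n powr q \<le> \<alpha>) \<longrightarrow>
         is_bigo S (\<lambda>n. (\<sigma> n)\<^sup>2 * real n * \<eta> n powr q *
                        (2 * ln (\<eta> n powr (- q))) powr (1 - q / 2)) \<and>
         same_order R (\<lambda>n. (\<sigma> n)\<^sup>2 * real n * \<eta> n powr q *
                        (2 * ln (\<eta> n powr (- q))) powr (1 - q / 2))) \<and>
      (p < 2 \<and>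
       (\<forall>\<^sub>F n in sequentially. \<eta> n powr q < 1 / real n * (2 * ln (real n)) powr (q / 2)) \<longrightarrow>
         is_bigo_sum S (\<lambda>n. (\<sigma> n)\<^sup>2 * real n powr (2 / q) * (\<eta> n)\<^sup>2)
                       (\<lambda>n. (\<sigma> n)\<^sup>2 * real n powr (- \<beta>) * ln (real n)) \<and>
         same_order R (\<lambda>n. (\<sigma> n)\<^sup>2 * real n powr (2 / q) * (\<eta> n)\<^sup>2))"
proof -
  obtain A \<rho> where A: "0 < A" and \<rho>: "0 < \<rho>" "\<rho> < 1"
    and risk_le: "\<And>n \<gamma> prior \<sigma> khat M \<mu>. \<lbrakk>n \<ge> 1; set_pmf prior = {0..n}; \<gamma>minus \<le> \<gamma>; \<gamma> \<le> \<gamma>plus; \<sigma> > 0;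
        is_map_selector n \<sigma> \<gamma> prior khat; M \<subseteq> {1..n}\<rbrakk> \<Longrightarrow>
      risk n \<sigma> (map_estimator n khat) \<mu> \<le> ennreal (A * selection_risk n \<sigma> prior \<rho> M \<mu>)"
    using map_oracle_inequality[OF \<gamma>_const] by metis
  obtain D where D: "0 < D" "\<And>n. (real n + 1)\<^sup>2 * \<rho> ^ n \<le> D"
    using poly_geometric_bounded[OF \<rho>] by metis
  define S where "S n = sup_risk n p (\<sigma> n) (\<eta> n) (map_estimator n (khat n))" for n
  define R where "R n = minimax_risk n p (\<sigma> n) (\<eta> n)" for n
  define q where "q = real_of_ereal p"
  let ?est = "\<lambda>n. map_estimator n (khat n)"
  have orc: "risk n (\<sigma> n) (?est n) \<mu> \<le> ennreal (A * selection_risk n (\<sigma> n) (prior n) \<rho> M \<mu>)"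
    if "n \<ge> 1" "M \<subseteq> {1..n}" for n M \<mu>
    using that prior khat \<gamma>_bounds \<sigma> by (intro risk_le[where \<gamma> = "\<gamma> n"]) auto
  have S_le: "S n \<le> B" if "\<And>\<mu>. \<mu> \<in> lp_ball n p (\<sigma> n) (\<eta> n) \<Longrightarrow> risk n (\<sigma> n) (?est n) \<mu> \<le> B" for n B
    unfolding S_def sup_risk_def using that by (rule SUP_least)
  \<comment> \<open>Both admissible values of \<open>\<alpha>\<close> respect the bound
    \<open>exp (- (9 / 2))\<close> of the sparse regime, because
    \<open>c_const \<gamma>minus \<ge> 9 / 2\<close>.\<close>
  have \<alpha>_le: "\<alpha> \<le> exp (- (9 / 2))"
  proof -
    have "(3 / 4)\<^sup>2 \<le> (\<gamma>minus + 3 / 4)\<^sup>2" using \<gamma>_const by (intro power_mono) auto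
    then have "9 / 2 \<le> c_const \<gamma>minus" by (simp add: c_const_def power2_eq_square)
    then show ?thesis using \<alpha> by auto
  qed
  have \<alpha>_pos: "0 < \<alpha>" using \<alpha> by auto
  have \<alpha>_less: "\<alpha> < 1" using \<alpha>_le by (rule le_less_trans) simp
  have ev2: "\<forall>\<^sub>F n in sequentially. n \<ge> (2::nat)" by (rule eventually_ge_at_top)

  \<comment> \<open>The comparison set is empty, so the whole signal is approximation error. With
    \<open>r = n powr (- \<beta>) * ln n\<close>, condition (i) bounds
    \<open>- ln (pmf (prior n) 0)\<close> by \<open>c1 * r\<close>, hence also
    \<open>1 - pmf (prior n) 0\<close>; the geometric term is eventually below \<open>r\<close>.
    This gives \<open>2 * c1 + 1\<close>.\<close>
  have l2_bound: "\<forall>\<^sub>F n in sequentially. \<forall>\<mu> B. (\<Sum>i=1..n. (\<mu> i)\<^sup>2) \<le> B \<longrightarrow>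
     risk n (\<sigma> n) (?est n) \<mu> \<le> ennreal (A * (2 * c1 + 1) * (B + (\<sigma> n)\<^sup>2 * real n powr (- \<beta>) * ln (real n)))"
    using ev2 cond_i poly_geometric_small[OF \<rho>, of \<beta>]
  proof eventually_elim
    case (elim n)
    define r where "r = real n powr (- \<beta>) * ln (real n)"
    have n: "0 < real n" using elim by simp
    have r: "0 \<le> r" using elim by (auto simp: r_def)
    have pos: "0 < pmf (prior n) 0" using prior elim by (intro pmf_positive) auto
    have "ln (real n powr (- c1 * real n powr (- \<beta>))) \<le> ln (pmf (prior n) 0)"
      using elim(2) pos n by (subst ln_le_cancel_iff) auto
    then have p0: "- ln (pmf (prior n) 0) \<le> c1 * r" using n by (simp add: ln_powr r_def)
    have p1: "1 - pmf (prior n) 0 \<le> c1 * r" using ln_le_minus_one[OF pos] p0 by linarith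
    show ?case
    proof (intro allI impI)
      fix \<mu> :: "nat \<Rightarrow> real" and B assume B: "(\<Sum>i=1..n. (\<mu> i)\<^sup>2) \<le> B"
      let ?U = "\<Sum>i=1..n. (\<mu> i)\<^sup>2" and ?t = "- ln (pmf (prior n) 0) + (1 - pmf (prior n) 0) + (real n + 1)\<^sup>2 * \<rho> ^ n"
      have B0: "0 \<le> B" using B by (rule order_trans[rotated]) (simp add: sum_nonneg)
      have "risk n (\<sigma> n) (?est n) \<mu> \<le> ennreal (A * (?U + (\<sigma> n)\<^sup>2 * ?t))"
        using orc[of n "{}" \<mu>] elim by (simp add: selection_risk_def)
      also have "\<dots> \<le> ennreal (A * (2 * c1 + 1) * (B + (\<sigma> n)\<^sup>2 * r))"
      proof (rule ennreal_leI)
        have "?t \<le> (2 * c1 + 1) * r"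
          using p0 p1 elim(3) by (simp add: r_def[symmetric] distrib_right)
        then have "(\<sigma> n)\<^sup>2 * ?t
          \<le> (\<sigma> n)\<^sup>2 * ((2 * c1 + 1) * r)" by (intro mult_left_mono) auto
        moreover have "B \<le> (2 * c1 + 1) * B" using B0 const_signs by (simp add: distrib_right)
        ultimately have "?U + (\<sigma> n)\<^sup>2 * ?t
          \<le> (2 * c1 + 1) * (B + (\<sigma> n)\<^sup>2 * r)" using B by (simp add: distrib_left mult.left_commute)
        then show "A * (?U + (\<sigma> n)\<^sup>2 * ?t)
          \<le> A * (2 * c1 + 1) * (B + (\<sigma> n)\<^sup>2 * r)" using A by (simp only: mult.assoc mult_left_mono less_imp_le)
      qed
      finally show "risk n (\<sigma> n) (?est n) \<mu>
        \<le> ennreal (A * (2 * c1 + 1) * (B + (\<sigma> n)\<^sup>2 * real n powr (- \<beta>) * ln (real n)))"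
        by (simp only: r_def mult.assoc)
    qed
  qed
  have K: "0 \<le> A * (2 * c1 + 1)" using A const_signs by simp
  have rem_nonneg: "\<forall>\<^sub>F n in sequentially. 0 \<le> (\<sigma> n)\<^sup>2 * real n powr (- \<beta>) * ln (real n)"
    using ev2 by eventually_elim simp

  \<comment> \<open>The comparison set is \<open>{1..n}\<close>: no approximation error, binomial
    coefficient 1, and condition (iii) prices the prior at \<open>c0 * n\<close>.\<close>
  have case1: "is_bigo S (\<lambda>n. real n * (\<sigma> n)\<^sup>2) \<and> same_order R (\<lambda>n. real n * (\<sigma> n)\<^sup>2)"
    if gt: "\<forall>\<^sub>F n in sequentially. radius_gt p (\<eta> n) \<alpha>"
  proof
    have "\<forall>\<^sub>F n in sequentially. S n \<le> ennreal (A * (c0 + 2 + D) * (real n * (\<sigma> n)\<^sup>2))"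
      using ev2 cond_iii
    proof eventually_elim
      case (elim n)
      have n: "1 \<le> real n" using elim by simp
      have "0 < pmf (prior n) n" using prior elim by (intro pmf_positive) auto
      then have "ln (exp (- c0 * real n)) \<le> ln (pmf (prior n) n)" using elim(2) by (subst ln_le_cancel_iff) auto
      then have 1: "- ln (pmf (prior n) n) \<le> c0 * real n" by simp
      have 2: "1 - pmf (prior n) 0 \<le> real n" using n pmf_nonneg[of "prior n" 0] by linarith
      have 3: "(real n + 1)\<^sup>2 * \<rho> ^ n \<le> D * real n" using D mult_left_mono[OF n, of D] by (force intro: order_trans)
      show ?case
      proof (rule S_le)
        fix \<mu>
        have "risk n (\<sigma> n) (?est n) \<mu> \<le> ennreal (A * ((\<sigma> n)\<^sup>2 * (- ln (pmf (prior n) n) + real n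
            + (1 - pmf (prior n) 0) + (real n + 1)\<^sup>2 * \<rho> ^ n)))"
          using orc[of n "{1..n}" \<mu>] elim by (simp add: selection_risk_def)
        also have "\<dots> \<le> ennreal (A * ((\<sigma> n)\<^sup>2 * ((c0 + 2 + D) * real n)))"
          using A 1 2 3 by (intro ennreal_leI mult_left_mono) (auto simp: distrib_right)
        finally show "risk n (\<sigma> n) (?est n) \<mu> \<le> ennreal (A * (c0 + 2 + D) * (real n * (\<sigma> n)\<^sup>2))"
          by (simp add: ac_simps)
      qed
    qed
    then show "is_bigo S (\<lambda>n. real n * (\<sigma> n)\<^sup>2)"
      by (rule is_bigoI) (use A const_signs D in auto)
    \<comment> \<open>The radius condition keeps \<open>\<eta> n\<close> above a constant: 1 for
      infinite \<open>p\<close>, a power of \<open>\<alpha>\<close> otherwise.\<close>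
    obtain u where u: "0 < u" "u \<le> 1/2" and u_le: "\<And>n. n \<ge> 1 \<Longrightarrow> radius_gt p (\<eta> n) \<alpha> \<Longrightarrow> u \<le> \<eta> n"
    proof (cases rule: pos_ereal_cases[OF p])
      case 1
      then show ?thesis using that[of "1/2"] by (force simp: radius_gt_def)
    next
      case (2 s)
      have "min (1/2) (\<alpha> powr (1 / s)) \<le> \<eta> n" if n: "n \<ge> 1" "radius_gt p (\<eta> n) \<alpha>" for n
      proof -
        have "\<alpha> powr (1 / s) \<le> (\<eta> n powr s) powr (1 / s)"
          using n 2 \<alpha>_pos by (intro powr_mono2) (auto simp: radius_gt_def)
        also have "\<dots> = \<eta> n" using 2 \<eta>[rule_format, OF n(1)] by (simp add: powr_powr)
        finally show ?thesis by simp
      qed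
      then show ?thesis using that[of "min (1/2) (\<alpha> powr (1 / s))"] \<alpha>_pos by simp
    qed
    show "same_order R (\<lambda>n. real n * (\<sigma> n)\<^sup>2)"
    proof (rule same_orderI)
      show "\<forall>\<^sub>F n in sequentially. ennreal (u\<^sup>2 / 12 * (real n * (\<sigma> n)\<^sup>2)) \<le> R n"
        using ev2 gt
      proof eventually_elim
        case (elim n)
        then show ?case
          unfolding R_def using p \<sigma> \<eta> u u_le[of n] by (intro minimax_risk_cube_lower_bound) auto
      qed
      show "\<forall>\<^sub>F n in sequentially. R n \<le> ennreal (8 * (real n * (\<sigma> n)\<^sup>2))"
        using ev2
      proof eventually_elim
        case (elim n)
        then show ?case unfolding R_def using \<sigma> by (intro minimax_risk_le[OF _ risk_identity_le]) (auto simp: measurable_ident_sets[OF refl, unfolded id_def])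
      qed
      show "\<forall>\<^sub>F n in sequentially. 0 < real n * (\<sigma> n)\<^sup>2"
        using ev2 by eventually_elim (intro mult_pos_pos zero_less_power; use \<sigma> in simp)
    qed (use u in simp)
  qed

  let ?rem = "\<lambda>n. (\<sigma> n)\<^sup>2 * real n powr (- \<beta>) * ln (real n)"
  \<comment> \<open>Cases 2 and 4 differ only in the bound \<open>g\<close> for the squared norm:
    the zero estimator stays below \<open>g\<close>, and the MAP estimator adds the
    remainder.\<close>
  have l2_case: "is_bigo_sum S g ?rem \<and> same_order R g"
    if l2: "\<And>n \<mu>. n \<ge> 2 \<Longrightarrow> \<mu> \<in> lp_ball n p (\<sigma> n) (\<eta> n) \<Longrightarrow> (\<Sum>i=1..n. (\<mu> i)\<^sup>2) \<le> g n"
      and pos: "\<And>n. n \<ge> 2 \<Longrightarrow> 0 < \<sigma> n \<Longrightarrow> 0 < \<eta> n \<Longrightarrow> 0 < g n"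
      and lower: "\<forall>\<^sub>F n in sequentially. ennreal (c * g n) \<le> R n" "0 < c" for g c
  proof
    have g: "\<forall>\<^sub>F n in sequentially. 0 < g n"
      using ev2 by eventually_elim (use pos \<sigma> \<eta> in auto)
    then have g0: "\<forall>\<^sub>F n in sequentially. 0 \<le> g n" by eventually_elim simp
    have "\<forall>\<^sub>F n in sequentially. S n \<le> ennreal (A * (2 * c1 + 1) * (g n + ?rem n))"
      using ev2 l2_bound
    proof eventually_elim
      case (elim n)
      then show ?case using l2[OF elim(1)] by (intro S_le) blast
    qed
    then show "is_bigo_sum S g ?rem" using g0 rem_nonneg K by (rule is_bigo_sumI)
    have "\<forall>\<^sub>F n in sequentially. R n \<le> ennreal (1 * g n)"
      using ev2
    proof eventually_elim
      case (elim n)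
      then show ?case unfolding R_def mult_1 by (intro minimax_risk_l2_upper_bound l2)
    qed
    then show "same_order R g" using lower(1) g lower(2) by (intro same_orderI)
  qed

  have case2: "is_bigo_sum S (\<lambda>n. (\<sigma> n)\<^sup>2 * real n * (\<eta> n)\<^sup>2) ?rem \<and> same_order R (\<lambda>n. (\<sigma> n)\<^sup>2 * real n * (\<eta> n)\<^sup>2)"
    if p2: "2 \<le> p" and le: "\<forall>\<^sub>F n in sequentially. radius_le p (\<eta> n) \<alpha>"
  proof (rule l2_case)
    show "(\<Sum>i=1..n. (\<mu> i)\<^sup>2) \<le> (\<sigma> n)\<^sup>2 * real n * (\<eta> n)\<^sup>2"
      if "n \<ge> 2" "\<mu> \<in> lp_ball n p (\<sigma> n) (\<eta> n)" for n \<mu>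
      using lp_ball_l2_large[OF p2 _ _ _ that(2)] that(1) \<sigma> \<eta> by (simp add: power_mult_distrib ac_simps)
    \<comment> \<open>The cube bound is applied with \<open>u = \<eta> n / 2\<close>, which has to
      be at most \<open>1/2\<close>; squaring this half explains \<open>48 = 4 * 12\<close>.\<close>
    have \<eta>_le: "\<eta> n \<le> 1" if "radius_le p (\<eta> n) \<alpha>" for n
    proof (cases rule: pos_ereal_cases[OF p])
      case 1
      then show ?thesis using that by (simp add: radius_le_def)
    next
      case (2 s)
      show ?thesis
      proof (rule ccontr)
        assume "\<not> \<eta> n \<le> 1"
        then have "1 \<le> \<eta> n powr s" using 2 by (intro ge_one_powr_ge_zero) auto
        then show False using that 2 \<alpha>_less by (simp add: radius_le_def)
      qed
    qed
    show "\<forall>\<^sub>F n in sequentially. ennreal (1 / 48 * ((\<sigma> n)\<^sup>2 * real n * (\<eta> n)\<^sup>2)) \<le> R n"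
      using ev2 le
    proof eventually_elim
      case (elim n)
      have "ennreal ((\<eta> n / 2)\<^sup>2 / 12 * (real n * (\<sigma> n)\<^sup>2)) \<le> R n"
        unfolding R_def using p \<sigma> \<eta> elim(1) \<eta>_le[OF elim(2)]
        by (intro minimax_risk_cube_lower_bound) (auto simp: less_imp_le)
      then show ?case by (simp add: power_divide ac_simps)
    qed
  qed auto

  have case3: "is_bigo S (\<lambda>n. (\<sigma> n)\<^sup>2 * real n * \<eta> n powr q * (2 * ln (\<eta> n powr (- q))) powr (1 - q / 2))
      \<and> same_order R (\<lambda>n. (\<sigma> n)\<^sup>2 * real n * \<eta> n powr q * (2 * ln (\<eta> n powr (- q))) powr (1 - q / 2))"
    if p2: "p < 2" and range: "\<forall>\<^sub>F n in sequentially.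
          1 / real n * (2 * ln (real n)) powr (q / 2) \<le> \<eta> n powr q \<and> \<eta> n powr q \<le> \<alpha>"
  proof -
    have pq: "p = ereal q" and q: "0 < q" "q < 2"
      using p p2 by (cases p; simp add: q_def)+
    let ?rate = "\<lambda>n. (\<sigma> n)\<^sup>2 * real n * \<eta> n powr q * sparse_log q (\<eta> n) powr (1 - q / 2)"
    have rate: "(\<lambda>n. (\<sigma> n)\<^sup>2 * real n * \<eta> n powr q * (2 * ln (\<eta> n powr (- q))) powr (1 - q / 2)) = ?rate"
      by (simp add: sparse_log_def)
    have regime: "\<forall>\<^sub>F n in sequentially. n \<ge> 2 \<and> 0 < \<sigma> n \<and> 0 < \<eta> n
        \<and> 1 / real n * (2 * ln (real n)) powr (q / 2) \<le> \<eta> n powr q \<and> \<eta> n powr q \<le> exp (- (9 / 2))"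
      using ev2 range
      by eventually_elim (use \<sigma> \<eta> \<alpha>_le in auto)
    have "\<forall>\<^sub>F n in sequentially. S n \<le> ennreal (A * (6 + 2 * c2 + D) * ?rate n)"
      using regime range cond_ii
    proof eventually_elim
      case (elim n)
      have reg': "n \<ge> 2" "0 < \<sigma> n" "0 < \<eta> n" using elim(1) by auto
      have reg'': "1 / real n * (2 * ln (real n)) powr (q / 2) \<le> \<eta> n powr q" "\<eta> n powr q \<le> exp (- (9 / 2))"
        using elim(1) by auto
      note reg = q reg' reg''
      let ?s = "sparsity q (\<eta> n) n" and ?L = "sparse_log q (\<eta> n)"
      let ?k = "nat \<lfloor>?s\<rfloor>"
      \<comment> \<open>In units of \<open>\<sigma>\<^sup>2\<close> the rate is at least 1, so
        \<open>1 - pmf (prior n) 0\<close> and the geometric term are absorbed and no remainder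
        appears.\<close>
      have sL: "1 \<le> ?s * ?L"
        using mult_mono[OF sparsity_ge[OF reg], of 1 ?L] sparse_log_ge[OF reg] sparsity_ge[OF reg] by simp
      \<comment> \<open>Condition (ii) reaches only up to \<open>\<alpha> * n\<close>; here
        \<open>\<eta> n powr q \<le> \<alpha>\<close> enters.\<close>
      have "real ?k \<le> \<alpha> * real n"
      proof -
        have "?s \<le> real n * \<eta> n powr q" by (rule sparsity_le[OF reg])
        also have "\<dots> \<le> real n * \<alpha>" using elim(2) by (intro mult_left_mono) auto
        finally show ?thesis using sparsity_floor(2)[OF reg] by (simp add: mult.commute)
      qed
      then have "(real ?k / real n) powr (c2 * real ?k) \<le> pmf (prior n) ?k"
        using elim(3) sparsity_floor(1)[OF reg] by blast
      note pen = sparse_penalty_bound[OF reg const_signs(4) this]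
      have 2: "1 - pmf (prior n) 0 \<le> ?s * ?L" using sL pmf_nonneg[of "prior n" 0] by linarith
      have 3: "(real n + 1)\<^sup>2 * \<rho> ^ n \<le> D * (?s * ?L)"
        using D mult_left_mono[OF sL, of D] by (force intro: order_trans)
      show ?case
      proof (rule S_le)
        fix \<mu> assume "\<mu> \<in> lp_ball n p (\<sigma> n) (\<eta> n)"
        \<comment> \<open>\<open>M\<close> varies with \<open>\<mu>\<close>, but its size does not,
          so \<open>pen\<close> applies to every point of the ball.\<close>
        then obtain M where M: "M \<subseteq> {1..n}" "card M = ?k" "(\<Sum>i\<in>{1..n} - M. (\<mu> i)\<^sup>2) \<le> (\<sigma> n)\<^sup>2 * (?s * ?L)"
          using sparse_oracle_set[OF reg, of \<mu>] unfolding pq by blast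
        have "risk n (\<sigma> n) (?est n) \<mu> \<le> ennreal (A * ((\<Sum>i\<in>{1..n} - M. (\<mu> i)\<^sup>2)
          + (\<sigma> n)\<^sup>2 * (ln (real (n choose ?k)) - ln (pmf (prior n) ?k) + real ?k
            + (1 - pmf (prior n) 0) + (real n + 1)\<^sup>2 * \<rho> ^ n)))"
          using orc[OF _ M(1), of \<mu>] reg(3) unfolding selection_risk_def M(2) by simp
        also have "\<dots> \<le> ennreal (A * ((\<sigma> n)\<^sup>2 * (?s * ?L) + (\<sigma> n)\<^sup>2 * ((4 + 2 * c2) * (?s * ?L) + ?s * ?L + D * (?s * ?L))))"
          using A M(3) pen 2 3 by (intro ennreal_leI mult_left_mono add_mono) auto
        also have "A * ((\<sigma> n)\<^sup>2 * (?s * ?L) + (\<sigma> n)\<^sup>2 * ((4 + 2 * c2) * (?s * ?L) + ?s * ?L + D * (?s * ?L)))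
          = A * (6 + 2 * c2 + D) * ((\<sigma> n)\<^sup>2 * (?s * ?L))" by (simp add: algebra_simps)
        also have "(\<sigma> n)\<^sup>2 * (?s * ?L) = ?rate n"
          unfolding sparsity_mult_log(1)[OF reg] by (simp only: mult.assoc)
        finally show "risk n (\<sigma> n) (?est n) \<mu> \<le> ennreal (A * (6 + 2 * c2 + D) * ?rate n)" .
      qed
    qed
    then have big: "is_bigo S ?rate" by (rule is_bigoI) (use A const_signs D in auto)
    have ord: "same_order R ?rate"
    proof (rule same_orderI)
      show "\<forall>\<^sub>F n in sequentially. ennreal (1 / 24 * ?rate n) \<le> R n"
        using regime unfolding R_def pq
        by eventually_elim (intro minimax_risk_sparse_lower_bound q; simp)
      show "\<forall>\<^sub>F n in sequentially. R n \<le> ennreal (162 * ?rate n)"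
        using regime unfolding R_def pq
        by eventually_elim (intro minimax_risk_sparse_upper_bound q; simp)
      show "\<forall>\<^sub>F n in sequentially. 0 < ?rate n"
        using regime
      proof eventually_elim
        case (elim n)
        then have "9 \<le> sparse_log q (\<eta> n)" using sparse_log_ge[OF q, of n "\<sigma> n" "\<eta> n"] by simp
        then show ?case using elim by simp
      qed
    qed simp
    show ?thesis unfolding rate using big ord by (rule conjI)
  qed

  have case4: "is_bigo_sum S (\<lambda>n. (\<sigma> n)\<^sup>2 * real n powr (2 / q) * (\<eta> n)\<^sup>2) ?rem \<and> same_order R (\<lambda>n. (\<sigma> n)\<^sup>2 * real n powr (2 / q) * (\<eta> n)\<^sup>2)"
    if p2: "p < 2" and small: "\<forall>\<^sub>F n in sequentially. \<eta> n powr q < 1 / real n * (2 * ln (real n)) powr (q / 2)"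
  proof (rule l2_case)
    have pq: "p = ereal q" and q: "0 < q" "q < 2"
      using p p2 by (cases p; simp add: q_def)+
    show "(\<Sum>i=1..n. (\<mu> i)\<^sup>2) \<le> (\<sigma> n)\<^sup>2 * real n powr (2 / q) * (\<eta> n)\<^sup>2"
      if "n \<ge> 2" "\<mu> \<in> lp_ball n p (\<sigma> n) (\<eta> n)" for n \<mu>
      using that \<sigma> \<eta> q unfolding pq by (intro lp_ball_l2_small) auto
    show "\<forall>\<^sub>F n in sequentially. ennreal (1 / 12 * ((\<sigma> n)\<^sup>2 * real n powr (2 / q) * (\<eta> n)\<^sup>2)) \<le> R n"
      using ev2 small
    proof eventually_elim
      case (elim n)
      then show ?case unfolding R_def pq using \<sigma> \<eta> q by (intro minimax_risk_spike_lower_bound) auto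
    qed
  qed auto
  show ?thesis
    unfolding Let_def S_def[abs_def, symmetric] R_def[abs_def, symmetric] q_def[symmetric]
    using case1 case2 case3 case4 by blast
qed

end
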